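(* Let $n$ be a positive integer with $n\equiv 2 \pmod 3$, let $c,e$ be indeterminates, and let $M=(n+1)/3$ or $M=n-1$. Then, modulo $[n]\Phi_n(q)^3$, \begin{align*} &\sum_{k=0}^M[6k-1]\frac{\left(q^{-1};q^3\right)^4_k\left(cq^{-1},eq^{-1};q^3\right)_k} {{\left(q^3;q^3\right)^4_k}\left(q^3/c,q^3/e;q^3\right)_k}\left(\frac{q^9}{ce}\right)^k\\ &\equiv[n]q^{(n+1)/3}\frac{\left(q^{-2};q^3\right)_{(n+1)/3}}{\left(q^3;q^3\right)_{(n+1)/3}}\left (1-[n]^2\sum_{i=1}^{(n+1)/3}\frac{q^{3i}}{[3i]^2}\right) \sum_{k=0}^{(n+1)/3}\frac{\left(q^4/(ce);q^3\right)_k\left(q^{-1};q^3\right)^3_k}{\left(q^3/c,q^3/e,q^3,q^{-2};q^3\right)_k}q^{3k}. \end{align*}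
   Context: $q$ is an indeterminate. The $q$-shifted factorial is $(a;q)_0=1$, $(a;q)_m=(1-a)(1-aq)\cdots(1-aq^{m-1})$ for positive integers $m$, and $(a_1,\dots,a_s;q)_m=(a_1;q)_m\cdots(a_s;q)_m$; $(a;q)_m^j$ means $((a;q)_m)^j$. For an integer $m$, $[m]=[m]_q=(1-q^m)/(1-q)$ (so $[m]=1+q+\cdots+q^{m-1}$ for $m\ge1$). $\Phi_n(q)$ is the $n$-th cyclotomic polynomial. For rational functions $A,B$ in $q$ (and the parameters) and a polynomial $P$ in $q$, $A\equiv B \pmod P$ means that $A-B=P\cdot F/G$ with $F,G$ polynomials and $G$ coprime to $P$. *)

theory Defs
  imports "HOL-Computational_Algebra.Computational_Algebra"
begin

text \<open>Ground ring: polynomials in q (outermost variable) with coefficients in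
  Q[c,e] (namely rat poly poly; middle variable c, innermost variable e).
  Field of rational functions: its fraction field Q(q,c,e).\<close>
type_synonym R = "rat poly poly poly"
type_synonym F = "R fract"

definition qR :: R where "qR = [:0, 1:]"
definition cR :: R where "cR = [:[:0, 1:]:]"
definition eR :: R where "eR = [:[:[:0, 1:]:]:]"

definition qv :: F where "qv = Fract qR 1"
definition cv :: F where "cv = Fract cR 1"
definition ev :: F where "ev = Fract eR 1"

definition qpoch :: "F \<Rightarrow> F \<Rightarrow> nat \<Rightarrow> F" where
  "qpoch a b m = (\<Prod>j<m. 1 - a * b ^ j)"

definition qint :: "int \<Rightarrow> F" where
  "qint m = (1 - qv powi m) / (1 - qv)"

text \<open>Cyclotomic polynomials over Q via X^n - 1 = prod_{d | n} Phi_d.\<close>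
function cyclo :: "nat \<Rightarrow> rat poly" where
  "cyclo n = (if n = 0 then 1 else
     (monom 1 n - 1) div (\<Prod>d\<in>{d. d dvd n \<and> d < n}. cyclo d))"
  by pat_completeness auto
termination by (relation "measure id") auto

definition cycloR :: "nat \<Rightarrow> R" where
  "cycloR n = map_poly (\<lambda>a. [:[:a:]:]) (cyclo n)"

definition qintR :: "nat \<Rightarrow> R" where
  "qintR n = (\<Sum>i<n. qR ^ i)"

definition qcong :: "F \<Rightarrow> F \<Rightarrow> R \<Rightarrow> bool" where
  "qcong A B P \<longleftrightarrow> (\<exists>f g. g \<noteq> 0 \<and> coprime g P \<and> A - B = Fract (P * f) g)"

end

theory Submission
  imports Defs "HOL-Computational_Algebra.Field_as_Ring"
begin

text \<open>Write \<open>N = (n + 1) / 3\<close>. Both sides are compared modulo \<open>\<Phi>\<^sub>n^4\<close> and modulo \<open>\<Phi>\<^sub>d\<close> for the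
  other divisors \<open>d > 1\<close> of \<open>n\<close>; these moduli are coprime and their product is \<open>[n] \<Phi>\<^sub>n^3\<close>.

  Modulo \<open>\<Phi>\<^sub>d\<close> the left-hand sum splits into blocks of length \<open>d\<close>, and each block vanishes because
  reflecting its summation index changes the sign of the terms. On the right-hand side one counts the
  factors divisible by \<open>\<Phi>\<^sub>d\<close>.

  Modulo \<open>\<Phi>\<^sub>n^4\<close>, replace three of the parameters \<open>1 / q\<close> of the very-well-poised sum by \<open>x / q\<close>,
  \<open>1 / (x q)\<close> and \<open>y / q\<close>, which gives \<open>S(x, y)\<close> with \<open>S(1, 1)\<close> the given sum. The sum terminates if
  \<open>x = q^n\<close> or \<open>y = q^(-n)\<close>, and Watson's transformation evaluates \<open>S(q^n, 1)\<close>, \<open>S(q^n, q^(-n))\<close> and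
  \<open>S(1, q^(-n))\<close>. Since \<open>S\<close> depends on \<open>x\<close> only through \<open>x + 1 / x\<close>, the mixed second difference
  \<open>S(q^n, 1) - S(q^n, q^(-n)) - S(1, 1) + S(1, q^(-n))\<close> has order 3 at \<open>\<Phi>\<^sub>n\<close>, and the reflection symmetry
  raises the order to 4. Solving for \<open>S(1, 1)\<close> and expanding the three values yields the right-hand side;
  the factor \<open>1 - [n]\<^sup>2 \<Sum> \<dots>\<close> is the first-order expansion of the prefactor of Watson's transformation in
  \<open>x + 1 / x - 2\<close>.\<close>

section \<open>Watson's transformation\<close>

text \<open>The undeformed sum has no terminating parameter, and a single specialisation does not
  reach order 4: the change in x is measured by x + 1/x - 2 = (1 - x)^2 / x, of order 2 at x = q^n,
  the change in y by y - 1, of order 1 at y = q^(-n). The error of the mixed difference therefore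
  starts with a mixed derivative in order 3. Each summand is a constant times a factor in x times a
  factor in y, so this derivative is the summand times two logarithmic derivatives. Under k -> N - k
  the summands are antisymmetric modulo the cyclotomic polynomial while the logarithmic derivatives
  are symmetric; this is why the coefficient of order 3 vanishes. The special points are forced by 3
  N = n + 1: the parameter 1/(x q) at x = q^n and the parameter y/q at y = q^(-n) are both q^(-3 N).
  The reflection itself comes from well-poisedness: numerator and denominator parameters multiply to
  q^2 = a q^3 with a = 1/q, and the inverse of 3 modulo the divisor gives the index about which to
  reflect.\<close>

lemma qpoch_0 [simp]: "qpoch a b 0 = 1"
  by (simp add: qpoch_def)

lemma qpoch_Suc: "qpoch a b (Suc m) = qpoch a b m * (1 - a * b ^ m)"
  by (simp add: qpoch_def)

lemma qpoch_Suc_left: "qpoch a b (Suc m) = (1 - a) * qpoch (a * b) b m"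
  unfolding qpoch_def by (simp only: prod.lessThan_Suc_shift) (simp add: algebra_simps)

lemma qpoch_add: "qpoch a b (m + k) = qpoch a b m * qpoch (a * b ^ m) b k"
  by (induction k) (simp_all add: qpoch_Suc power_add algebra_simps)

lemma qpoch_self_nonzero:
  assumes "\<And>k. k > 0 \<Longrightarrow> p ^ k \<noteq> 1"
  shows "qpoch p p m \<noteq> 0"
  using assms[of "Suc _"] by (auto simp: qpoch_def)

text \<open>The telescoping step of the next proof with the common factor \<open>D\<close> pulled
  out. \<open>X\<close> and \<open>R\<close> stand for \<open>p ^ j\<close> and
  \<open>p ^ r\<close>; once the powers are free variables, only a polynomial identity
  remains.\<close>

lemma saalschuetz_step_poly:
  fixes A B W X p R D :: "'a :: comm_ring_1"
  shows "(1 - p * (p * X * R)) * (D * ((1 - W * R) * (1 - A * B * W * (p * X) * R)))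
     - (1 - A * W * (p * X * R)) * (1 - B * W * (p * X * R)) * (D * (1 - p * R))
   = - (R * (1 - A * (p * X)) * (1 - B * (p * X)) * W * (D * (1 - p * R)))
     + p * R * (D * ((1 - p * X) * (1 - W * R) * (1 - A * B * W * X)))"
  by (simp add: algebra_simps)

text \<open>The convolution form of the q-Pfaff-Saalschuetz sum. It is proved by telescoping: \<open>g\<close> below
  is the Wilf-Zeilberger companion of the summand.\<close>

lemma q_saalschuetz:
  fixes A B W p :: F
  assumes p: "\<And>k. k > 0 \<Longrightarrow> p ^ k \<noteq> 1"
  shows "(\<Sum>i\<le>m. qpoch A p i * qpoch B p i * qpoch W p (m - i) * W ^ i
            * qpoch (A * B * W * p ^ i) p (m - i) / (qpoch p p i * qpoch p p (m - i)))
         = qpoch (A * W) p m * qpoch (B * W) p m / qpoch p p m"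
proof (induction m)
  case 0
  show ?case by simp
next
  case (Suc m)
  define T where "T m i = qpoch A p i * qpoch B p i * qpoch W p (m - i) * W ^ i
            * qpoch (A * B * W * p ^ i) p (m - i) / (qpoch p p i * qpoch p p (m - i))" for m i
  define g where "g i = (case i of 0 \<Rightarrow> 0 | Suc j \<Rightarrow>
      - (p ^ (m - j) * W * (1 - A * p ^ j) * (1 - B * p ^ j) * T m j))" for i
  define C where "C = (1 - A * W * p ^ m) * (1 - B * W * p ^ m)"
  have nz: "1 - p * p ^ k \<noteq> 0" for k
    using p[of "Suc k"] by simp
  have nz': "qpoch p p k \<noteq> 0" for k
    by (rule qpoch_self_nonzero[OF p])
  have step: "(1 - p ^ Suc m) * T (Suc m) i - C * T m i = g (Suc i) - g i" if le: "i \<le> m" for i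
  proof (cases i)
    case 0
    have "(1 - p ^ Suc m) * T (Suc m) 0 = (1 - W * p ^ m) * (1 - A * B * W * p ^ m) * T m 0"
      using nz[of m] by (simp add: T_def qpoch_Suc[of _ _ m] mult_ac)
    then show ?thesis
      unfolding 0 by (simp add: g_def C_def algebra_simps)
  next
    case (Suc j)
    obtain r where m: "m = Suc j + r"
      using le Suc le_Suc_ex[of "Suc j" m] by auto
    define D where "D = qpoch A p i * qpoch B p i * qpoch W p r * W ^ i * qpoch (A * B * W * p ^ i) p r
      / (qpoch p p i * qpoch p p (Suc r))"
    have 1: "T (Suc m) i = D * ((1 - W * p ^ r) * (1 - A * B * W * p ^ i * p ^ r))"
      unfolding T_def D_def Suc m by (simp add: qpoch_Suc)
    have 2: "T m i = D * (1 - p * p ^ r)"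
      unfolding T_def D_def Suc m using nz[of r] by (simp add: qpoch_Suc[of p p r])
    have 3: "(1 - A * p ^ j) * (1 - B * p ^ j) * W * T m j
        = D * ((1 - p * p ^ j) * (1 - W * p ^ r) * (1 - A * B * W * p ^ j))"
    proof -
      have "m - j = Suc r" using m by simp
      then have "T m j = qpoch A p j * qpoch B p j * (qpoch W p r * (1 - W * p ^ r)) * W ^ j
            * ((1 - A * B * W * p ^ j) * qpoch (A * B * W * p ^ i) p r) / (qpoch p p j * qpoch p p (Suc r))"
        using qpoch_Suc_left[of "A * B * W * p ^ j" p r]
        unfolding T_def by (simp add: qpoch_Suc[of W] Suc mult_ac)
      moreover have "D = qpoch A p j * qpoch B p j * (1 - A * p ^ j) * (1 - B * p ^ j) * qpoch W p r * W * W ^ j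
          * qpoch (A * B * W * p ^ i) p r / (qpoch p p j * (1 - p * p ^ j) * qpoch p p (Suc r))"
        unfolding D_def Suc by (simp add: qpoch_Suc[of A] qpoch_Suc[of B] qpoch_Suc[of p p j] mult_ac)
      ultimately show ?thesis
        using nz[of j] by simp
    qed
    have gd: "g (Suc i) - g i = - (p ^ r * (1 - A * p ^ i) * (1 - B * p ^ i) * W * T m i)
       + p ^ Suc r * ((1 - A * p ^ j) * (1 - B * p ^ j) * W * T m j)"
      unfolding g_def Suc m by (simp add: algebra_simps)
    show ?thesis
      unfolding gd 1 2 3 C_def unfolding Suc m power_add power_Suc by (rule saalschuetz_step_poly)
  qed
  \<comment> \<open>The sum for \<open>Suc m\<close> has one summand more than the sum for
    \<open>m\<close>; it cancels exactly the boundary value left by telescoping.\<close>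
  have last: "(1 - p ^ Suc m) * T (Suc m) (Suc m) = - g (Suc m)"
    unfolding T_def g_def using nz[of m] by (simp add: qpoch_Suc mult_ac)
  have "(1 - p ^ Suc m) * (\<Sum>i\<le>Suc m. T (Suc m) i) - C * (\<Sum>i\<le>m. T m i)
      = (\<Sum>i\<le>m. (1 - p ^ Suc m) * T (Suc m) i - C * T m i) + (1 - p ^ Suc m) * T (Suc m) (Suc m)"
    by (simp only: sum_subtractf sum_distrib_left[symmetric] sum.atMost_Suc distrib_left)
  also have "(\<Sum>i\<le>m. (1 - p ^ Suc m) * T (Suc m) i - C * T m i) = (\<Sum>i\<le>m. g (Suc i) - g i)"
    by (intro sum.cong refl step) auto
  also have "\<dots> = g (Suc m) - g 0"
    using sum_lessThan_telescope[of g "Suc m"] by (simp only: lessThan_Suc_atMost)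
  finally have "(1 - p ^ Suc m) * (\<Sum>i\<le>Suc m. T (Suc m) i) = C * (\<Sum>i\<le>m. T m i)"
    unfolding last by (simp add: g_def)
  also have "(\<Sum>i\<le>m. T m i) = qpoch (A * W) p m * qpoch (B * W) p m / qpoch p p m"
    using Suc.IH by (simp add: T_def)
  finally have "(\<Sum>i\<le>Suc m. T (Suc m) i) = C * (qpoch (A * W) p m * qpoch (B * W) p m / qpoch p p m) / (1 - p * p ^ m)"
    using nonzero_eq_divide_eq[OF nz[of m]] by (simp only: power_Suc mult.commute)
  then show ?case
    unfolding T_def C_def by (simp add: qpoch_Suc mult_ac)
qed


text \<open>Insert the defining sum of \<beta> and exchange the summations. For fixed
  \<open>r\<close>, the shift j = r + i turns the inner sum into a q-Pfaff-Saalschuetz sum with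
  parameters \<open>d * p ^ r\<close> and \<open>e * p ^ r\<close>.\<close>

lemma bailey_lemma:
  fixes a d e p :: F
  assumes p: "\<And>k. k > 0 \<Longrightarrow> p ^ k \<noteq> 1"
    and a: "\<And>m. qpoch (a * p) p m \<noteq> 0"
    and d: "d \<noteq> 0" "\<And>m. qpoch (a * p / d) p m \<noteq> 0"
    and e: "e \<noteq> 0" "\<And>m. qpoch (a * p / e) p m \<noteq> 0"
    and \<beta>: "\<And>n. \<beta> n = (\<Sum>r\<le>n. \<alpha> r / (qpoch p p (n - r) * qpoch (a * p) p (n + r)))"
  defines "w \<equiv> a * p / (d * e)"
  shows "(\<Sum>j\<le>n. qpoch d p j * qpoch e p j * qpoch w p (n - j) * w ^ j * \<beta> j / qpoch p p (n - j))
    = qpoch (a * p / d) p n * qpoch (a * p / e) p n *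
      (\<Sum>r\<le>n. qpoch d p r * qpoch e p r * w ^ r / (qpoch (a * p / d) p r * qpoch (a * p / e) p r) * \<alpha> r
          / (qpoch p p (n - r) * qpoch (a * p) p (n + r)))"
proof -
  have nz: "qpoch p p k \<noteq> 0" for k
    by (rule qpoch_self_nonzero[OF p])
  define t where "t j r = qpoch d p j * qpoch e p j * qpoch w p (n - j) * w ^ j
      * (\<alpha> r / (qpoch p p (j - r) * qpoch (a * p) p (j + r))) / qpoch p p (n - j)" for j r
  have "(\<Sum>j\<le>n. qpoch d p j * qpoch e p j * qpoch w p (n - j) * w ^ j * \<beta> j / qpoch p p (n - j))
      = (\<Sum>j\<le>n. \<Sum>r\<le>j. t j r)"
    unfolding t_def by (intro sum.cong refl, subst \<beta>) (simp only: sum_distrib_left sum_divide_distrib)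
  also have "\<dots> = (\<Sum>r\<le>n. \<Sum>j\<in>{r..n}. t j r)"
  proof -
    have "(\<Sum>j\<le>n. \<Sum>r\<le>j. t j r) = (\<Sum>j\<in>{..n}. \<Sum>r\<in>{r \<in> {..n}. r \<le> j}. t j r)"
      by (intro sum.cong refl) auto
    also have "\<dots> = (\<Sum>r\<in>{..n}. \<Sum>j\<in>{j \<in> {..n}. r \<le> j}. t j r)"
      by (rule sum.swap_restrict) auto
    also have "\<dots> = (\<Sum>r\<le>n. \<Sum>j\<in>{r..n}. t j r)"
      by (intro sum.cong refl) auto
    finally show ?thesis .
  qed
  also have "\<dots> = (\<Sum>r\<le>n. qpoch (a * p / d) p n * qpoch (a * p / e) p n *
        (qpoch d p r * qpoch e p r * w ^ r / (qpoch (a * p / d) p r * qpoch (a * p / e) p r) * \<alpha> r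
          / (qpoch p p (n - r) * qpoch (a * p) p (n + r))))"
  proof (intro sum.cong refl)
    fix r assume "r \<in> {..n}"
    then obtain m where n: "n = r + m"
      using le_Suc_ex by auto
    define A B where "A = d * p ^ r" and "B = e * p ^ r"
    \<comment> \<open>This product makes the third Pochhammer symbol of the Saalschuetz sum
      precisely the cofactor that completes \<open>qpoch (a * p) p (r + i + r)\<close> to
      \<open>qpoch (a * p) p (n + r)\<close>.\<close>
    have C: "A * B * w = a * p * p ^ (r + r)"
      using d(1) e(1) by (simp add: A_def B_def w_def power_add)
    have AW: "A * w = a * p / e * p ^ r" and BW: "B * w = a * p / d * p ^ r"
      using d(1) e(1) by (simp_all add: A_def B_def w_def)
    have "(\<Sum>j\<in>{r..n}. t j r) = (\<Sum>i\<le>m. t (r + i) r)"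
      unfolding n atMost_atLeast0 using sum.shift_bounds_cl_nat_ivl[of "\<lambda>j. t j r" 0 r m]
      by (simp add: add.commute)
    also have "\<dots> = (\<Sum>i\<le>m. qpoch d p r * qpoch e p r * w ^ r * \<alpha> r / qpoch (a * p) p (n + r) *
        (qpoch A p i * qpoch B p i * qpoch w p (m - i) * w ^ i
            * qpoch (A * B * w * p ^ i) p (m - i) / (qpoch p p i * qpoch p p (m - i))))"
    proof (intro sum.cong refl)
      fix i assume "i \<in> {..m}"
      then obtain l where m: "m = i + l"
        using le_Suc_ex by auto
      have "qpoch (a * p) p (n + r) = qpoch (a * p) p (r + i + r) * qpoch (A * B * w * p ^ i) p l"
        unfolding C n m using qpoch_add[of "a * p" p "r + i + r" l]
        by (simp add: power_add algebra_simps)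
      with a[of "n + r"] have "1 / qpoch (a * p) p (r + i + r) = qpoch (A * B * w * p ^ i) p l / qpoch (a * p) p (n + r)"
        by simp
      moreover have "t (r + i) r = qpoch d p r * qpoch A p i * (qpoch e p r * qpoch B p i) * qpoch w p l * (w ^ r * w ^ i)
          * (\<alpha> r / qpoch p p i * (1 / qpoch (a * p) p (r + i + r))) / qpoch p p l"
        unfolding t_def n m by (simp add: qpoch_add A_def B_def power_add)
      ultimately show "t (r + i) r = qpoch d p r * qpoch e p r * w ^ r * \<alpha> r / qpoch (a * p) p (n + r) *
        (qpoch A p i * qpoch B p i * qpoch w p (m - i) * w ^ i
            * qpoch (A * B * w * p ^ i) p (m - i) / (qpoch p p i * qpoch p p (m - i)))"
        unfolding m by (simp add: mult_ac)
    qed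
    also have "\<dots> = qpoch d p r * qpoch e p r * w ^ r * \<alpha> r / qpoch (a * p) p (n + r) *
        (qpoch (A * w) p m * qpoch (B * w) p m / qpoch p p m)"
      unfolding sum_distrib_left[symmetric] by (subst q_saalschuetz[OF p]) auto
    also have "qpoch (A * w) p m = qpoch (a * p / e) p n / qpoch (a * p / e) p r"
      unfolding AW n qpoch_add using e(2)[of r] by simp
    also have "qpoch (B * w) p m = qpoch (a * p / d) p n / qpoch (a * p / d) p r"
      unfolding BW n qpoch_add using d(2)[of r] by simp
    finally show "(\<Sum>j\<in>{r..n}. t j r) = qpoch (a * p / d) p n * qpoch (a * p / e) p n *
        (qpoch d p r * qpoch e p r * w ^ r / (qpoch (a * p / d) p r * qpoch (a * p / e) p r) * \<alpha> r
          / (qpoch p p (n - r) * qpoch (a * p) p (n + r)))"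
      unfolding n by (simp add: mult_ac)
  qed
  finally show ?thesis
    by (simp only: sum_distrib_left)
qed

text \<open>The Bailey pair whose \<beta> is the Kronecker delta; the product in \<alpha> is (-1)^r
  p^(r(r-1)/2). For positive \<open>n\<close> the partial sums have a closed form, and the one up to
  n - 1 is minus the last summand.\<close>

lemma unit_bailey_pair:
  fixes a p :: F
  assumes p: "\<And>k. k > 0 \<Longrightarrow> p ^ k \<noteq> 1"
    and a: "\<And>m. qpoch (a * p) p m \<noteq> 0" "a \<noteq> 1"
  defines "\<alpha> \<equiv> \<lambda>r. (1 - a * p ^ (2 * r)) / (1 - a) * qpoch a p r / qpoch p p r * (\<Prod>j<r. - (p ^ j))"
  shows "(\<Sum>r\<le>n. \<alpha> r / (qpoch p p (n - r) * qpoch (a * p) p (n + r))) = (if n = 0 then 1 else 0)"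
proof (cases n)
  case 0
  then show ?thesis
    using a(2) by (simp add: \<alpha>_def)
next
  case (Suc n')
  define t where "t r = \<alpha> r / (qpoch p p (n - r) * qpoch (a * p) p (n + r))" for r
  define s where "s k = (\<Prod>j<k. - (p * p ^ j))" for k
  have nz: "1 - p * p ^ k \<noteq> 0" for k
    using p[of "Suc k"] by simp
  have nzp: "qpoch p p k \<noteq> 0" for k
    by (rule qpoch_self_nonzero[OF p])
  have nza: "1 - a * p * p ^ k \<noteq> 0" for k
    using a(1)[of "Suc k"] by (simp add: qpoch_Suc)
  have nzn: "1 - p ^ n \<noteq> 0"
    using p[of n] Suc by simp
  have \<alpha>: "\<alpha> (Suc k) = - (1 - a * p ^ (2 * Suc k)) * qpoch (a * p) p k * s k / qpoch p p (Suc k)" for k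
  proof -
    have "(\<Prod>j<Suc k. - (p ^ j)) = - s k"
      unfolding s_def by (subst prod.lessThan_Suc_shift) simp
    moreover define C where "C = 1 - a * p ^ (2 * Suc k)"
    ultimately show ?thesis
      unfolding \<alpha>_def qpoch_Suc_left[of a] C_def[symmetric] using a(2) by (simp del: prod.lessThan_Suc)
  qed
  \<comment> \<open>The closed form stops before k = n: there truncated subtraction would replace
    the vanishing reciprocal of \<open>qpoch p p (-1)\<close> by 1. The last summand is therefore
    added separately.\<close>
  have H: "(\<Sum>r\<le>k. t r) = s k * qpoch (a * p) p k
      / (qpoch p p k * qpoch p p (n - 1 - k) * qpoch (a * p) p (n + k) * (1 - p ^ n))" if "k < n" for k
    using that
  proof (induction k)
    case 0
    have "qpoch p p n = qpoch p p (n - 1) * (1 - p ^ n)"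
      unfolding Suc by (simp add: qpoch_Suc)
    then show ?case
      using a(2) by (simp add: t_def s_def \<alpha>_def)
  next
    case (Suc k)
    obtain l where n: "n = Suc (Suc k) + l"
      using Suc.prems le_Suc_ex[of "Suc (Suc k)" n] by auto
    define E where "E = s k * qpoch (a * p) p k
      / (qpoch p p (Suc k) * qpoch p p (Suc l) * qpoch (a * p) p (n + Suc k) * (1 - p ^ n))"
    define K M where "K = p ^ Suc k" and "M = p ^ Suc l"
    have pn: "p ^ n = K * M"
      unfolding n K_def M_def by (simp add: power_add)
    have 1: "s k * qpoch (a * p) p k
      / (qpoch p p k * qpoch p p (n - 1 - k) * qpoch (a * p) p (n + k) * (1 - p ^ n))
      = E * ((1 - K) * (1 - a * K * (K * M)))"
    proof -
      have "n - 1 - k = Suc l" using n by simp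
      moreover have "qpoch (a * p) p (n + Suc k) = qpoch (a * p) p (n + k) * (1 - a * K * (K * M))"
        by (simp add: qpoch_Suc power_add pn K_def mult_ac)
      moreover have "1 - a * K * (K * M) \<noteq> 0"
        using nza[of "n + k"] by (simp add: power_add pn K_def mult_ac)
      moreover have "qpoch p p (Suc k) = qpoch p p k * (1 - K)" "1 - K \<noteq> 0"
        using nz[of k] by (simp_all add: qpoch_Suc K_def)
      ultimately show ?thesis
        by (simp add: E_def)
    qed
    have 2: "t (Suc k) = E * (- (1 - a * K\<^sup>2) * (1 - K * M))"
    proof -
      have "n - Suc k = Suc l" using n by simp
      moreover have "p ^ (2 * Suc k) = K\<^sup>2"
        by (simp only: K_def power_mult[symmetric] mult.commute)
      moreover have "1 - K * M \<noteq> 0"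
        using nzn pn by simp
      ultimately show ?thesis
        by (simp add: t_def \<alpha> E_def pn)
    qed
    have 3: "s (Suc k) * qpoch (a * p) p (Suc k)
      / (qpoch p p (Suc k) * qpoch p p (n - 1 - Suc k) * qpoch (a * p) p (n + Suc k) * (1 - p ^ n))
      = E * (- K * (1 - a * K) * (1 - M))"
    proof -
      have "n - 1 - Suc k = l" using n by simp
      moreover have "s (Suc k) = s k * - K" by (simp add: s_def K_def)
      moreover have "qpoch (a * p) p (Suc k) = qpoch (a * p) p k * (1 - a * K)"
        by (simp add: qpoch_Suc K_def mult_ac)
      moreover have "qpoch p p (Suc l) = qpoch p p l * (1 - M)" "1 - M \<noteq> 0"
        using nz[of l] by (simp_all add: qpoch_Suc M_def)
      ultimately show ?thesis
        by (simp add: E_def mult_ac)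
    qed
    have "(1 - K) * (1 - a * K * (K * M)) + (- (1 - a * K\<^sup>2) * (1 - K * M)) = - K * (1 - a * K) * (1 - M)"
      by (simp add: algebra_simps power2_eq_square)
    then have "E * ((1 - K) * (1 - a * K * (K * M))) + E * (- (1 - a * K\<^sup>2) * (1 - K * M)) = E * (- K * (1 - a * K) * (1 - M))"
      by (simp only: distrib_left[symmetric])
    then show ?case
      using Suc.IH Suc.prems unfolding sum.atMost_Suc 3 2 by (simp only: 1)
  qed
  have n2: "p ^ (2 * Suc n') = p ^ Suc (n + n')"
    unfolding Suc by (simp add: mult_2)
  have "t n = - (1 - a * p ^ (2 * Suc n')) * qpoch (a * p) p n' * s n' / (qpoch p p (Suc n') * qpoch (a * p) p (Suc (n + n')))"
    unfolding t_def Suc \<alpha> by simp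
  also have "\<dots> = - (s n' * qpoch (a * p) p n' / (qpoch p p n' * (1 - p ^ n) * qpoch (a * p) p (n + n')))"
  proof -
    define X where "X = 1 - a * p * p ^ (n + n')"
    have "1 - a * p ^ (2 * Suc n') = X"
      unfolding n2 X_def by (simp add: mult_ac)
    moreover have "qpoch (a * p) p (Suc (n + n')) = qpoch (a * p) p (n + n') * X"
      by (simp add: qpoch_Suc X_def)
    moreover have "qpoch p p (Suc n') = qpoch p p n' * (1 - p ^ n)"
      by (simp add: qpoch_Suc Suc)
    moreover have "X \<noteq> 0"
      unfolding X_def by (rule nza)
    ultimately show ?thesis
      by (simp add: mult_ac)
  qed
  finally have "(\<Sum>r\<le>n'. t r) + t n = 0"
    using H[of n'] Suc by (simp add: mult_ac)
  then have "(\<Sum>r\<le>n. t r) = 0"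
    by (simp add: Suc)
  then show ?thesis
    using Suc by (simp add: t_def)
qed

text \<open>Watson's transformation: Bailey's lemma applied twice to the unit Bailey pair, first with
  \<open>(b, c)\<close> and then with \<open>(d, e)\<close>.\<close>

theorem watson_transformation:
  fixes a b c d e p :: F
  assumes p: "\<And>k. k > 0 \<Longrightarrow> p ^ k \<noteq> 1"
    and a: "\<And>m. qpoch (a * p) p m \<noteq> 0" "a \<noteq> 1"
    and b: "b \<noteq> 0" "\<And>m. qpoch (a * p / b) p m \<noteq> 0"
    and c: "c \<noteq> 0" "\<And>m. qpoch (a * p / c) p m \<noteq> 0"
    and d: "d \<noteq> 0" "\<And>m. qpoch (a * p / d) p m \<noteq> 0"
    and e: "e \<noteq> 0" "\<And>m. qpoch (a * p / e) p m \<noteq> 0"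
  defines "w \<equiv> a * p / (d * e)"
  shows "qpoch (a * p / d) p N * qpoch (a * p / e) p N *
      (\<Sum>r\<le>N. (1 - a * p ^ (2 * r)) / (1 - a) * (\<Prod>j<r. - (p ^ j)) * (a ^ 2 * p ^ 2 / (b * c * d * e)) ^ r
          * (qpoch a p r * qpoch b p r * qpoch c p r * qpoch d p r * qpoch e p r)
          / (qpoch p p r * qpoch (a * p / b) p r * qpoch (a * p / c) p r * qpoch (a * p / d) p r * qpoch (a * p / e) p r)
          / (qpoch p p (N - r) * qpoch (a * p) p (N + r)))
    = (\<Sum>j\<le>N. qpoch d p j * qpoch e p j * qpoch w p (N - j) * w ^ j * qpoch (a * p / (b * c)) p j
          / (qpoch p p (N - j) * qpoch p p j * qpoch (a * p / b) p j * qpoch (a * p / c) p j))"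
proof -
  define \<alpha> where "\<alpha> r = (1 - a * p ^ (2 * r)) / (1 - a) * qpoch a p r / qpoch p p r * (\<Prod>j<r. - (p ^ j))" for r
  define v where "v = a * p / (b * c)"
  define \<alpha>' where "\<alpha>' r = qpoch b p r * qpoch c p r * v ^ r / (qpoch (a * p / b) p r * qpoch (a * p / c) p r) * \<alpha> r" for r
  define \<beta>' where "\<beta>' n = qpoch v p n / (qpoch p p n * qpoch (a * p / b) p n * qpoch (a * p / c) p n)" for n
  have unit: "(if n = 0 then 1 else 0) = (\<Sum>r\<le>n. \<alpha> r / (qpoch p p (n - r) * qpoch (a * p) p (n + r)))" for n
    unfolding \<alpha>_def by (rule unit_bailey_pair[OF p a, symmetric])
  \<comment> \<open>Applied to the unit pair, the left side of Bailey's lemma keeps only j = 0, so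
    the new \<beta> is a single quotient.\<close>
  have \<beta>': "\<beta>' n = (\<Sum>r\<le>n. \<alpha>' r / (qpoch p p (n - r) * qpoch (a * p) p (n + r)))" for n
  proof -
    have "(\<Sum>j\<le>n. qpoch b p j * qpoch c p j * qpoch v p (n - j) * v ^ j * (if j = 0 then 1 else 0) / qpoch p p (n - j))
      = qpoch (a * p / b) p n * qpoch (a * p / c) p n * (\<Sum>r\<le>n. \<alpha>' r / (qpoch p p (n - r) * qpoch (a * p) p (n + r)))"
      unfolding \<alpha>'_def v_def
      by (rule bailey_lemma[OF p a(1) b c unit])
    moreover have "(\<Sum>j\<le>n. qpoch b p j * qpoch c p j * qpoch v p (n - j) * v ^ j * (if j = 0 then 1 else 0) / qpoch p p (n - j))
      = (\<Sum>j\<in>{0}. qpoch b p j * qpoch c p j * qpoch v p (n - j) * v ^ j * (if j = 0 then 1 else 0) / qpoch p p (n - j))"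
      by (intro sum.mono_neutral_right) auto
    ultimately have "qpoch (a * p / b) p n * qpoch (a * p / c) p n
      * (\<Sum>r\<le>n. \<alpha>' r / (qpoch p p (n - r) * qpoch (a * p) p (n + r))) = qpoch v p n / qpoch p p n"
      by simp
    moreover have "y = z / (u * (x1 * x2))" if "x1 * x2 * y = z / u" "x1 \<noteq> 0" "x2 \<noteq> 0" for x1 x2 y z u :: F
    proof -
      have "z / (u * (x1 * x2)) = (z / u) / (x1 * x2)"
        by simp
      then show ?thesis
        using that(2,3) by (simp only: that(1)[symmetric]) simp
    qed
    ultimately show ?thesis
      unfolding \<beta>'_def using b(2)[of n] c(2)[of n] by (simp add: mult.assoc)
  qed
  have "(\<Sum>j\<le>N. qpoch d p j * qpoch e p j * qpoch w p (N - j) * w ^ j * \<beta>' j / qpoch p p (N - j))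
    = qpoch (a * p / d) p N * qpoch (a * p / e) p N *
      (\<Sum>r\<le>N. qpoch d p r * qpoch e p r * w ^ r / (qpoch (a * p / d) p r * qpoch (a * p / e) p r) * \<alpha>' r
          / (qpoch p p (N - r) * qpoch (a * p) p (N + r)))"
    unfolding w_def by (rule bailey_lemma[OF p a(1) d e \<beta>'])
  moreover have "(a ^ 2 * p ^ 2 / (b * c * d * e)) ^ r = v ^ r * w ^ r" for r
    by (simp add: v_def w_def power2_eq_square power_mult_distrib[symmetric] mult_ac)
  ultimately show ?thesis
    unfolding \<alpha>'_def \<alpha>_def \<beta>'_def v_def by (simp add: mult_ac)
qed

section \<open>Cyclotomic polynomials\<close>

lemma minus_one_dvd_power_minus_one:
  fixes x :: "'a :: comm_ring_1"
  shows "x - 1 dvd x ^ k - 1"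
  using power_diff_1_eq[of x k] by (cases "k = 0") auto

text \<open>Bezout in the form a u = b v + gcd a b, over the naturals, so that no inverse of
  \<open>x\<close> modulo \<open>h\<close> is required.\<close>

lemma dvd_power_gcd_minus_one:
  fixes x :: "'a :: comm_ring_1"
  assumes "h dvd x ^ a - 1" "h dvd x ^ b - 1" "a > 0"
  shows "h dvd x ^ gcd a b - 1"
proof -
  have mult: "x ^ k - 1 dvd x ^ (k * l) - 1" for k l
    using minus_one_dvd_power_minus_one[of "x ^ k" l] by (simp add: power_mult)
  obtain u v where uv: "a * u = b * v + gcd a b"
    using bezout_nat[of a b] assms(3) by auto
  have "h dvd x ^ (a * u) - 1" "h dvd x ^ (b * v) - 1"
    using assms mult dvd_trans by blast+
  then have "h dvd (x ^ (a * u) - 1) - x ^ gcd a b * (x ^ (b * v) - 1)"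
    by simp
  also have "\<dots> = x ^ gcd a b - 1"
    unfolding uv by (simp add: power_add algebra_simps)
  finally show ?thesis .
qed

text \<open>If h^2 divides P = X^n - 1, then \<open>h\<close> divides P and P', hence also X P' - n
  P, which is the nonzero constant n.\<close>

lemma monom_minus_one_squarefree:
  fixes h :: "rat poly"
  assumes "n > 0" "h * h dvd monom 1 n - 1"
  shows "is_unit h"
proof -
  obtain k where k: "monom 1 n - 1 = h * h * k"
    using assms(2) by auto
  have "pderiv (monom 1 n - 1 :: rat poly) = h * (h * pderiv k + 2 * k * pderiv h)"
    unfolding k pderiv_mult by (simp add: algebra_simps)
  then have "h dvd monom (of_nat n) (n - 1)"
    by (simp add: pderiv_diff pderiv_monom)
  moreover have "h dvd monom 1 n - 1"
    unfolding k by simp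
  ultimately have "h dvd monom 1 1 * monom (of_nat n) (n - 1) - smult (of_nat n) (monom 1 n - 1)"
    by (rule dvd_diff[OF dvd_mult dvd_smult])
  also have "\<dots> = [:of_nat n:]"
    using assms(1) by (simp add: mult_monom smult_monom smult_diff_right)
  finally show ?thesis
    by (rule dvd_unit_imp_unit) (use assms(1) in \<open>simp add: is_unit_const_poly_iff dvd_field_iff\<close>)
qed

declare cyclo.simps [simp del]

text \<open>\<open>cyclo d * (monom 1 g - 1)\<close> divides the squarefree polynomial X^d - 1, so
  the two factors share no divisor. The product formulas are hypotheses because the lemma serves
  inside the induction that establishes them.\<close>

lemma coprime_cyclo_of_prod:
  assumes d: "(\<Prod>k | k dvd d. cyclo k) = monom 1 d - 1" "d > 0"
    and g: "(\<Prod>k | k dvd g. cyclo k) = monom 1 g - 1" "g dvd d" "g < d"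
  shows "coprime (cyclo d) (monom 1 g - 1)"
proof (rule coprimeI)
  fix h assume h: "h dvd cyclo d" "h dvd monom 1 g - 1"
  have fin: "finite {k. k dvd d}"
    using d(2) by simp
  have "(\<Prod>k | k dvd g. cyclo k) dvd (\<Prod>k\<in>{k. k dvd d} - {d}. cyclo k)"
  proof (rule prod_dvd_prod_subset)
    show "{k. k dvd g} \<subseteq> {k. k dvd d} - {d}"
      using dvd_trans[OF _ g(2)] dvd_imp_le[of d g] dvd_pos_nat[OF d(2) g(2)] g(3) by auto
  qed (use fin in auto)
  then have "cyclo d * (monom 1 g - 1) dvd (\<Prod>k | k dvd d. cyclo k)"
    unfolding g(1)[symmetric] by (subst prod.remove[OF fin, of d]) (auto intro: mult_dvd_mono)
  then have "h * h dvd monom 1 d - 1"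
    unfolding d(1) using h mult_dvd_mono dvd_trans by blast
  then show "is_unit h"
    by (rule monom_minus_one_squarefree[OF d(2)])
qed

lemma prod_dvd_of_coprime:
  fixes f :: "'a \<Rightarrow> 'b :: semiring_gcd"
  assumes "finite A" "\<And>x. x \<in> A \<Longrightarrow> f x dvd m"
    and "\<And>x y. x \<in> A \<Longrightarrow> y \<in> A \<Longrightarrow> x \<noteq> y \<Longrightarrow> coprime (f x) (f y)"
  shows "(\<Prod>x\<in>A. f x) dvd m"
  using assms
proof (induction A rule: finite_induct)
  case (insert x A)
  have "coprime (f x) (\<Prod>x\<in>A. f x)"
    using insert by (intro prod_coprime_right) auto
  then show ?case
    using insert by (auto intro: divides_mult)
qed auto

text \<open>The point is that the division in the definition of \<open>cyclo\<close> is exact: by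
  induction the earlier cyclotomic polynomials are pairwise coprime divisors of X^n - 1, so their
  product divides it.\<close>

lemma prod_cyclo:
  assumes "n > 0"
  shows "(\<Prod>d | d dvd n. cyclo d) = monom 1 n - 1"
  using assms
proof (induction n rule: less_induct)
  case (less n)
  define A where "A = {d. d dvd n \<and> d < n}"
  have fin: "finite A"
    by (simp add: A_def)
  have IH: "(\<Prod>k | k dvd d. cyclo k) = monom 1 d - 1" "d > 0" if "d \<in> A" for d
    using that less A_def dvd_pos_nat by auto
  have dvd: "cyclo d dvd monom 1 d - 1" if "d \<in> A" for d
    using IH[OF that] dvd_prodI[of "{k. k dvd d}" d cyclo] by simp
  \<comment> \<open>Non-divisibility makes gcd d e a proper divisor of \<open>d\<close>. Of two
    distinct indices at least one does not divide the other, so this asymmetric form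
    suffices.\<close>
  have "coprime (cyclo d) (cyclo e)" if de: "d \<in> A" "e \<in> A" "\<not> d dvd e" for d e
  proof (rule coprimeI)
    fix h assume h: "h dvd cyclo d" "h dvd cyclo e"
    have "h dvd monom 1 1 ^ d - 1" "h dvd monom 1 1 ^ e - 1"
      using dvd_trans[OF h(1) dvd[OF de(1)]] dvd_trans[OF h(2) dvd[OF de(2)]] by (simp_all add: monom_power)
    then have "h dvd monom 1 (gcd d e) - 1"
      using dvd_power_gcd_minus_one[of h "monom 1 1" d e] IH[OF de(1)] by (simp add: monom_power)
    moreover have "gcd d e \<noteq> d"
      using de(3) by (metis gcd_dvd2)
    then have "gcd d e < d"
      using IH[OF de(1)] by (metis gcd_le1_nat le_neq_implies_less less_numeral_extra(3))
    moreover have "gcd d e \<in> A"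
      using de \<open>gcd d e < d\<close> dvd_trans[OF gcd_dvd1] by (auto simp: A_def)
    ultimately show "is_unit h"
      using coprime_cyclo_of_prod[OF IH[OF de(1)] IH(1)[of "gcd d e"]] h(1) coprime_common_divisor by blast
  qed
  then have cop: "coprime (cyclo d) (cyclo e)" if "d \<in> A" "e \<in> A" "d \<noteq> e" for d e
    using that by (metis coprime_commute dvd_antisym)
  have "cyclo d dvd monom 1 n - 1" if dA: "d \<in> A" for d
  proof -
    obtain k where "n = d * k"
      using dA by (auto simp: A_def)
    then have "monom 1 d - 1 dvd (monom 1 n - 1 :: rat poly)"
      using minus_one_dvd_power_minus_one[of "monom 1 d :: rat poly" k] by (simp add: monom_power)
    then show ?thesis
      using dvd[OF dA] dvd_trans by blast
  qed
  then have "(\<Prod>d\<in>A. cyclo d) dvd monom 1 n - 1"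
    using fin cop by (intro prod_dvd_of_coprime) auto
  moreover have "cyclo n = (monom 1 n - 1) div (\<Prod>d\<in>A. cyclo d)"
    using less.prems by (subst cyclo.simps) (simp add: A_def)
  ultimately have "cyclo n * (\<Prod>d\<in>A. cyclo d) = monom 1 n - 1"
    by simp
  moreover have "{d. d dvd n} = insert n A" "n \<notin> A"
    using less.prems by (auto simp: A_def dest: dvd_imp_le)
  ultimately show ?case
    using fin by simp
qed

lemma cyclo_dvd: "n > 0 \<Longrightarrow> cyclo n dvd monom 1 n - 1"
  using prod_cyclo[of n] dvd_prodI[of "{k. k dvd n}" n cyclo] by simp

lemma coprime_cyclo_monom:
  assumes "d > 0" "m > 0" "\<not> d dvd m"
  shows "coprime (cyclo d) (monom 1 m - 1)"
proof (rule coprimeI)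
  fix h assume h: "h dvd cyclo d" "h dvd monom 1 m - 1"
  have "h dvd monom 1 1 ^ d - 1" "h dvd monom 1 1 ^ m - 1"
    using dvd_trans[OF h(1) cyclo_dvd[OF assms(1)]] h(2) by (simp_all add: monom_power)
  then have "h dvd monom 1 (gcd d m) - 1"
    using dvd_power_gcd_minus_one[of h "monom 1 1" d m] assms by (simp add: monom_power)
  moreover have "gcd d m < d"
    using assms by (metis gcd_dvd2 gcd_le1_nat le_neq_implies_less less_numeral_extra(3))
  ultimately show "is_unit h"
    using coprime_cyclo_of_prod[OF prod_cyclo[of d] _ prod_cyclo[of "gcd d m"]] h(1) assms
      coprime_common_divisor by (metis gcd_dvd1 gcd_pos_nat less_numeral_extra(3))
qed

lemma coprime_cyclo:
  assumes "d > 0" "e > 0" "d \<noteq> e"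
  shows "coprime (cyclo d) (cyclo e)"
proof -
  have *: "coprime (cyclo d) (cyclo e)" if "d > 0" "e > 0" "\<not> d dvd e" for d e
    using coprime_cyclo_monom[OF that] cyclo_dvd[OF that(2)] by (meson coprime_divisors dvd_refl)
  show ?thesis
    using assms * by (metis coprime_commute dvd_antisym)
qed

section \<open>Transfer of cyclotomic polynomials to the ground ring\<close>

definition lift_poly :: "rat poly \<Rightarrow> R" where
  "lift_poly p = map_poly (\<lambda>a. [:[:a:]:]) p"

lemma coeff_lift_poly: "coeff (lift_poly p) i = [:[:coeff p i:]:]"
  by (simp add: lift_poly_def coeff_map_poly)

lemma lift_poly_simps [simp]:
  "lift_poly 0 = 0" "lift_poly 1 = 1" "lift_poly (p + q) = lift_poly p + lift_poly q"
  "lift_poly (p - q) = lift_poly p - lift_poly q" "lift_poly (monom 1 n) = qR ^ n"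
proof -
  have "lift_poly (monom 1 n) = monom [:[:1:]:] n"
    by (simp add: lift_poly_def map_poly_monom)
  also have "[:[:1:]:] = (1 :: rat poly poly)"
    by (simp add: one_pCons)
  also have "monom 1 n = qR ^ n"
    by (simp add: qR_def monom_altdef)
  finally show "lift_poly (monom 1 n) = qR ^ n" .
qed (auto intro!: poly_eqI simp: coeff_lift_poly one_pCons coeff_pCons split: nat.splits)

lemma lift_poly_mult [simp]: "lift_poly (p * q) = lift_poly p * lift_poly q"
proof (rule poly_eqI)
  fix i
  have add: "[:[:x + y:]:] = [:[:x:]:] + [:[:y:]:]" for x y :: rat
    by simp
  have "[:[:sum f A:]:] = (\<Sum>x\<in>A. [:[:f x:]:])" for f :: "nat \<Rightarrow> rat" and A
    by (induction A rule: infinite_finite_induct) (simp_all add: add del: add_pCons)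
  then show "coeff (lift_poly (p * q)) i = coeff (lift_poly p * lift_poly q) i"
    by (simp add: coeff_mult coeff_lift_poly)
qed

lemma lift_poly_prod: "lift_poly (\<Prod>x\<in>A. f x) = (\<Prod>x\<in>A. lift_poly (f x))"
  by (induction A rule: infinite_finite_induct) auto

lemma cycloR_eq: "cycloR n = lift_poly (cyclo n)"
  by (simp add: cycloR_def lift_poly_def)

text \<open>Coprimality need not survive a ring homomorphism, but a Bezout identity does, and over
  the rationals there is one.\<close>

lemma coprime_lift_poly:
  assumes "coprime p q"
  shows "coprime (lift_poly p) (lift_poly q)"
proof (rule coprimeI)
  fix h assume h: "h dvd lift_poly p" "h dvd lift_poly q"
  obtain u v where "u * p + v * q = 1"
    using bezout_coefficients_fst_snd[of p q] assms by auto
  then have "lift_poly u * lift_poly p + lift_poly v * lift_poly q = 1"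
    by (metis lift_poly_mult lift_poly_simps(2,3))
  then show "is_unit h"
    using h by (metis dvd_add dvd_mult)
qed

lemma cycloR_dvd: "n > 0 \<Longrightarrow> cycloR n dvd qR ^ n - 1"
  using cyclo_dvd[of n] unfolding cycloR_eq
  by (metis dvd_def lift_poly_mult lift_poly_simps(2,4,5))

lemma coprime_cycloR_qR_power:
  assumes "d > 0" "m > 0" "\<not> d dvd m"
  shows "coprime (cycloR d) (qR ^ m - 1)"
  using coprime_lift_poly[OF coprime_cyclo_monom[OF assms]] by (simp add: cycloR_eq)

lemma coprime_cycloR: "d > 0 \<Longrightarrow> e > 0 \<Longrightarrow> d \<noteq> e \<Longrightarrow> coprime (cycloR d) (cycloR e)"
  unfolding cycloR_eq by (intro coprime_lift_poly coprime_cyclo)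

lemma cyclo_1: "cyclo 1 = monom 1 1 - 1"
  using prod_cyclo[of 1] by simp

lemma qintR_eq_prod:
  assumes "n > 0"
  shows "qintR n = (\<Prod>d | d dvd n \<and> d \<noteq> 1. cycloR d)"
proof -
  have "(qR - 1) * qintR n = qR ^ n - 1"
    unfolding qintR_def by (simp add: power_diff_1_eq)
  also have "\<dots> = lift_poly (\<Prod>d | d dvd n. cyclo d)"
    using prod_cyclo[OF assms] by simp
  also have "{d. d dvd n} = insert 1 {d. d dvd n \<and> d \<noteq> 1}"
    by auto
  also have "lift_poly (\<Prod>d\<in>\<dots>. cyclo d) = (qR - 1) * (\<Prod>d | d dvd n \<and> d \<noteq> 1. cycloR d)"
    using assms by (subst prod.insert) (auto simp: lift_poly_prod cycloR_eq cyclo_1[simplified])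
  finally have "(qR - 1) * qintR n = (qR - 1) * (\<Prod>d | d dvd n \<and> d \<noteq> 1. cycloR d)" .
  moreover have "qR - 1 \<noteq> 0"
    by (simp add: qR_def one_pCons)
  ultimately show ?thesis
    using mult_left_cancel by blast
qed

section \<open>Congruences modulo powers of a polynomial\<close>

text \<open>\<open>adic P k\<close> is the \<open>k\<close>-th power of the ideal \<open>P\<close> in the localisation of the ground ring
  at the elements coprime to \<open>P\<close>, and \<open>aunit P\<close> its group of units.\<close>

definition adic :: "R \<Rightarrow> nat \<Rightarrow> F \<Rightarrow> bool" where
  "adic P k x \<longleftrightarrow> (\<exists>f g. g \<noteq> 0 \<and> coprime g P \<and> x = Fract (P ^ k * f) g)"

definition aunit :: "R \<Rightarrow> F \<Rightarrow> bool" where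
  "aunit P x \<longleftrightarrow> x \<noteq> 0 \<and> adic P 0 x \<and> adic P 0 (inverse x)"

lemma adicI: "g \<noteq> 0 \<Longrightarrow> coprime g P \<Longrightarrow> x = Fract (P ^ k * f) g \<Longrightarrow> adic P k x"
  unfolding adic_def by blast

lemma adic_zero [simp]: "adic P k 0"
  by (rule adicI[of 1 _ _ _ 0]) (auto simp: fract_collapse)

lemma adic_one [simp]: "adic P 0 1"
  by (rule adicI[of 1 _ _ _ 1]) (auto simp: One_fract_def)

lemma adic_add [intro]:
  assumes "adic P k x" "adic P k y"
  shows "adic P k (x + y)"
proof -
  obtain f g f' g' where "g \<noteq> 0" "coprime g P" "x = Fract (P ^ k * f) g"
    "g' \<noteq> 0" "coprime g' P" "y = Fract (P ^ k * f') g'"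
    using assms by (auto simp: adic_def)
  then show ?thesis
    by (intro adicI[of "g * g'" _ _ _ "f * g' + f' * g"]) (auto simp: algebra_simps)
qed

lemma adic_uminus [intro]: "adic P k x \<Longrightarrow> adic P k (- x)"
  unfolding adic_def by (metis minus_fract mult_minus_right)

lemma adic_diff [intro]: "adic P k x \<Longrightarrow> adic P k y \<Longrightarrow> adic P k (x - y)"
  using adic_add[OF _ adic_uminus, of P k x y] by simp

lemma adic_mult:
  assumes "adic P i x" "adic P j y"
  shows "adic P (i + j) (x * y)"
proof -
  obtain f g f' g' where "g \<noteq> 0" "coprime g P" "x = Fract (P ^ i * f) g"
    "g' \<noteq> 0" "coprime g' P" "y = Fract (P ^ j * f') g'"
    using assms by (auto simp: adic_def)
  then show ?thesis
    by (intro adicI[of "g * g'" _ _ _ "f * f'"]) (auto simp: power_add algebra_simps)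
qed

lemma adic_mult_left: "adic P 0 x \<Longrightarrow> adic P k y \<Longrightarrow> adic P k (x * y)"
  using adic_mult[of P 0 x k y] by simp

lemma adic_mult_right: "adic P k x \<Longrightarrow> adic P 0 y \<Longrightarrow> adic P k (x * y)"
  using adic_mult[of P k x 0 y] by simp

lemma adic_mono:
  assumes "adic P k x" "l \<le> k"
  shows "adic P l x"
proof -
  obtain f g where "g \<noteq> 0" "coprime g P" "x = Fract (P ^ k * f) g"
    using assms by (auto simp: adic_def)
  moreover have "P ^ k = P ^ l * P ^ (k - l)"
    using assms(2) by (simp add: power_add[symmetric])
  ultimately show ?thesis
    by (intro adicI[of g _ _ _ "P ^ (k - l) * f"]) (auto simp: mult_ac)
qed

lemma adic_sum: "(\<And>i. i \<in> A \<Longrightarrow> adic P k (f i)) \<Longrightarrow> adic P k (sum f A)"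
  by (induction A rule: infinite_finite_induct) auto

lemma adic_prod: "(\<And>i. i \<in> A \<Longrightarrow> adic P 0 (f i)) \<Longrightarrow> adic P 0 (prod f A)"
  by (induction A rule: infinite_finite_induct) (auto intro: adic_mult_left)

lemma adic_power: "adic P k x \<Longrightarrow> adic P (k * m) (x ^ m)"
  by (induction m) (auto dest: adic_mult)

lemma adic_power0: "adic P 0 x \<Longrightarrow> adic P 0 (x ^ m)"
  using adic_power[of P 0 x m] by simp

lemma aunit_adic [dest]: "aunit P x \<Longrightarrow> adic P 0 x"
  by (simp add: aunit_def)

lemma aunit_nonzero: "aunit P x \<Longrightarrow> x \<noteq> 0"
  by (simp add: aunit_def)

lemma aunit_one [simp]: "aunit P 1"
  by (simp add: aunit_def)

lemma aunit_inverse: "aunit P x \<Longrightarrow> aunit P (inverse x)"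
  by (simp add: aunit_def)

lemma aunit_mult: "aunit P x \<Longrightarrow> aunit P y \<Longrightarrow> aunit P (x * y)"
  by (auto simp: aunit_def intro: adic_mult_left)

lemma aunit_divide: "aunit P x \<Longrightarrow> aunit P y \<Longrightarrow> aunit P (x / y)"
  by (simp add: divide_inverse aunit_mult aunit_inverse)

lemma aunit_uminus: "aunit P x \<Longrightarrow> aunit P (- x)"
  by (auto simp: aunit_def)

lemma aunit_power: "aunit P x \<Longrightarrow> aunit P (x ^ m)"
  by (induction m) (auto intro: aunit_mult)

lemma aunit_powi: "aunit P x \<Longrightarrow> aunit P (x powi m)"
  by (auto simp: power_int_def intro: aunit_power aunit_inverse)

lemma aunit_prod: "(\<And>i. i \<in> A \<Longrightarrow> aunit P (f i)) \<Longrightarrow> aunit P (prod f A)"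
  by (induction A rule: infinite_finite_induct) (auto intro: aunit_mult)

lemma adic_divide: "adic P k x \<Longrightarrow> aunit P y \<Longrightarrow> adic P k (x / y)"
  by (auto simp: aunit_def divide_inverse intro: adic_mult_right)

lemma aunit_Fract:
  assumes "r \<noteq> 0" "s \<noteq> 0" "coprime r P" "coprime s P"
  shows "aunit P (Fract r s)"
  using assms adicI[of s P "Fract r s" 0 r] adicI[of r P "Fract s r" 0 s]
  by (auto simp: aunit_def Zero_fract_def eq_fract)

lemma adic_cong_mult:
  assumes "adic P k (x - x')" "adic P k (y - y')" "adic P 0 x'" "adic P 0 y"
  shows "adic P k (x * y - x' * y')"
proof -
  have "x * y - x' * y' = (x - x') * y + x' * (y - y')"
    by (simp add: algebra_simps)
  then show ?thesis
    using adic_add[OF adic_mult_right[OF assms(1,4)] adic_mult_left[OF assms(3,2)]] by simp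
qed

lemma adic_cong_divide:
  assumes "adic P k (x - x')" "adic P k (y - y')" "adic P 0 x" "aunit P y" "aunit P y'"
  shows "adic P k (x / y - x' / y')"
proof -
  have "x / y - x' / y' = (x - x') / y' - x * (y - y') / (y * y')"
    using assms(4,5)[THEN aunit_nonzero] by (simp add: field_simps)
  moreover have "adic P k ((x - x') / y' - x * (y - y') / (y * y'))"
    by (rule adic_diff[OF adic_divide[OF assms(1,5)]
          adic_divide[OF adic_mult_left[OF assms(3,2)] aunit_mult[OF assms(4,5)]]])
  ultimately show ?thesis
    by simp
qed

lemma adic_cong_prod:
  assumes "\<And>i. i \<in> A \<Longrightarrow> adic P k (f i - g i)"
    "\<And>i. i \<in> A \<Longrightarrow> adic P 0 (f i)" "\<And>i. i \<in> A \<Longrightarrow> adic P 0 (g i)"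
  shows "adic P k (prod f A - prod g A)"
  using assms
  by (induction A rule: infinite_finite_induct) (auto intro!: adic_cong_mult adic_prod)

lemma adic_cong_trans: "adic P k (x - y) \<Longrightarrow> adic P k (y - z) \<Longrightarrow> adic P k (x - z)"
  using adic_add[of P k "x - y" "y - z"] by simp

lemma adic_cong_sym: "adic P k (x - y) \<Longrightarrow> adic P k (y - x)"
  using adic_uminus[of P k "x - y"] by simp

lemma qcong_iff_adic: "qcong x y P \<longleftrightarrow> adic P 1 (x - y)"
  by (simp add: qcong_def adic_def)

lemma adic_power_modulus: "adic P k x \<Longrightarrow> k > 0 \<Longrightarrow> adic (P ^ k) 1 x"
  unfolding adic_def by auto

text \<open>Coprime moduli are combined by looking at the numerator in lowest terms.\<close>

lemma adic_lowest_terms: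
  assumes "coprime a b" "b \<noteq> 0"
  shows "adic P 1 (Fract a b) \<longleftrightarrow> P dvd a \<and> coprime b P"
proof
  assume "adic P 1 (Fract a b)"
  then obtain f g where fg: "g \<noteq> 0" "coprime g P" "a * g = P * f * b"
    using assms(2) by (auto simp: adic_def eq_fract)
  have "P dvd a * g"
    using fg(3) by (simp add: mult.assoc)
  then have "P dvd a"
    using fg(2) by (simp add: coprime_dvd_mult_left_iff coprime_commute)
  moreover have "b dvd a * g"
    using fg(3) by simp
  then have "b dvd g"
    using assms(1) by (simp add: coprime_dvd_mult_right_iff coprime_commute)
  then have "coprime b P"
    using fg(2) by (meson coprime_divisors dvd_refl)
  ultimately show "P dvd a \<and> coprime b P" ..
next
  assume P: "P dvd a \<and> coprime b P"
  then obtain f where "a = P * f" by auto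
  then show "adic P 1 (Fract a b)"
    using P assms(2) by (intro adicI[of b _ _ _ f]) auto
qed

lemma adic_combine:
  assumes "adic P 1 x" "adic Q 1 x" "coprime P Q"
  shows "adic (P * Q) 1 x"
proof -
  obtain a' b' where "x = Fract a' b'" "b' \<noteq> 0"
    by (cases x) auto
  moreover from this obtain a b where "a' = a * gcd a' b'" "b' = b * gcd a' b'" "coprime a b"
    using gcd_coprime_exists[of a' b'] by auto
  ultimately have x: "x = Fract a b" "b \<noteq> 0" "coprime a b"
    using mult_fract_cancel[of "gcd a' b'" a b] by (auto simp: mult.commute)
  show ?thesis
    using assms unfolding x(1) adic_lowest_terms[OF x(3,2)] by (auto intro: divides_mult)
qed

lemma adic_combine_prod:
  assumes "finite A" "\<And>i. i \<in> A \<Longrightarrow> adic (f i) 1 x"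
    and "\<And>i j. i \<in> A \<Longrightarrow> j \<in> A \<Longrightarrow> i \<noteq> j \<Longrightarrow> coprime (f i) (f j)"
    and "adic 1 1 x"
  shows "adic (\<Prod>i\<in>A. f i) 1 x"
  using assms
proof (induction A rule: finite_induct)
  case (insert i A)
  have "coprime (f i) (\<Prod>i\<in>A. f i)"
    using insert by (intro prod_coprime_right) auto
  moreover have "adic (f i) 1 x" "adic (prod f A) 1 x"
    using insert by auto
  ultimately show ?case
    unfolding prod.insert[OF insert.hyps] by (intro adic_combine)
qed auto

section \<open>Units modulo a cyclotomic polynomial\<close>

lemma qR_power: "qR ^ d = monom 1 d"
  by (simp add: qR_def monom_altdef)

text \<open>Dividing a nonzero constant forces \<open>h\<close> to have degree 0 in q, and a
  constant that divides the polynomial q^d - 1 divides its leading coefficient 1.\<close>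

lemma is_unit_of_dvd_const:
  assumes "h dvd [:s:]" "s \<noteq> 0" "h dvd qR ^ d - 1" "d > 0"
  shows "is_unit h"
proof -
  have "degree h \<le> degree [:s:]"
    using assms(1,2) by (intro dvd_imp_degree_le) auto
  then obtain t where h: "h = [:t:]"
    using degree_eq_zeroE[of h] by auto
  have "t dvd coeff (qR ^ d - 1) d"
    using assms(3) unfolding h const_poly_dvd_iff by blast
  then have "t dvd 1"
    using assms(4) by (simp add: qR_power one_pCons coeff_pCons split: nat.splits)
  then show ?thesis
    unfolding h by (simp add: is_unit_const_poly_iff)
qed

lemma coprime_cycloR_if:
  assumes "coprime r (qR ^ d - 1)" "d > 0"
  shows "coprime r (cycloR d)"
  using assms cycloR_dvd by (meson coprime_divisors dvd_refl)

lemma coprime_const_cycloR: "s \<noteq> 0 \<Longrightarrow> d > 0 \<Longrightarrow> coprime [:s:] (cycloR d)"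
  by (intro coprime_cycloR_if coprimeI) (auto intro: is_unit_of_dvd_const)

text \<open>Modulo a common divisor, s = q^m and q^d = 1, hence s^d = 1; so the nonzero constant s^d
  - 1 is divisible by it. This is what makes denominators containing c or e harmless.\<close>

lemma coprime_const_minus_cycloR:
  assumes "s ^ d \<noteq> 1" "d > 0"
  shows "coprime ([:s:] - qR ^ m) (cycloR d)"
proof (intro coprime_cycloR_if coprimeI)
  fix h assume h: "h dvd [:s:] - qR ^ m" "h dvd qR ^ d - 1"
  have "h dvd [:s:] ^ d - (qR ^ m) ^ d"
    unfolding power_diff_sumr2 by (rule dvd_mult2[OF h(1)])
  moreover have "h dvd (qR ^ d) ^ m - 1"
    using h(2) minus_one_dvd_power_minus_one by (rule dvd_trans)
  ultimately have "h dvd ([:s:] ^ d - (qR ^ m) ^ d) + ((qR ^ d) ^ m - 1)"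
    by (rule dvd_add)
  also have "\<dots> = [:s ^ d - 1:]"
    by (simp add: power_mult[symmetric] mult.commute poly_const_pow one_pCons)
  finally show "is_unit h"
    using assms h(2) by (intro is_unit_of_dvd_const[of h "s ^ d - 1" d]) auto
qed (use assms in auto)

lemma qv_power: "qv ^ m = Fract (qR ^ m) 1"
  by (induction m) (auto simp: qv_def One_fract_def)

lemma qR_nonzero: "qR \<noteq> 0"
  by (simp add: qR_def)

lemma qv_nonzero [simp]: "qv \<noteq> 0"
  by (simp add: qv_def Zero_fract_def eq_fract qR_nonzero)

lemma cv_nonzero [simp]: "cv \<noteq> 0"
  by (simp add: cv_def cR_def Zero_fract_def eq_fract)

lemma ev_nonzero [simp]: "ev \<noteq> 0"
  by (simp add: ev_def eR_def Zero_fract_def eq_fract)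

lemma monom_neq_1: "m > 0 \<Longrightarrow> monom (1 :: 'a :: comm_semiring_1) m \<noteq> 1"
  using degree_monom_eq[of "1 :: 'a" m] by auto

lemma qR_power_neq_1: "m > 0 \<Longrightarrow> qR ^ m \<noteq> 1"
  unfolding qR_power by (rule monom_neq_1)

lemma qv_power_neq_1: "m > 0 \<Longrightarrow> qv ^ m \<noteq> 1"
  using qR_power_neq_1[of m] by (simp add: qv_power One_fract_def eq_fract)

lemma one_minus_powi_minus: "1 - qv powi (- m) = - (qv powi (- m)) * (1 - qv powi m)"
  by (simp add: algebra_simps power_int_add[symmetric])

lemma one_minus_qv_powi_nonzero:
  assumes "m \<noteq> 0"
  shows "1 - qv powi m \<noteq> 0"
proof (cases m rule: int_cases2)
  case (nonneg k)
  then show ?thesis using qv_power_neq_1[of k] assms by simp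
next
  case (nonpos k)
  then show ?thesis
    using qv_power_neq_1[of k] assms one_minus_powi_minus[of "int k"] by simp
qed

context
  fixes d :: nat
  assumes d: "d > 0"
begin

lemma aunit_qv: "aunit (cycloR d) qv"
proof -
  have "coprime qR (qR ^ d - 1)"
  proof (rule coprimeI)
    fix h assume h: "h dvd qR" "h dvd qR ^ d - 1"
    have "h dvd qR ^ d"
      using h(1) d by (meson dvd_power dvd_trans)
    then have "h dvd qR ^ d - (qR ^ d - 1)"
      using h(2) by (rule dvd_diff)
    then show "is_unit h" by simp
  qed
  then show ?thesis
    unfolding qv_def using d by (intro aunit_Fract coprime_cycloR_if qR_nonzero) auto
qed

lemma aunit_qv_powi: "aunit (cycloR d) (qv powi m)"
  by (rule aunit_powi[OF aunit_qv])

lemma aunit_const: "s \<noteq> 0 \<Longrightarrow> aunit (cycloR d) (Fract [:s:] 1)"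
  using d by (intro aunit_Fract coprime_const_cycloR) auto

lemma aunit_cv: "aunit (cycloR d) cv"
  unfolding cv_def cR_def by (rule aunit_const) simp

lemma aunit_ev: "aunit (cycloR d) ev"
  unfolding ev_def eR_def by (rule aunit_const) simp

lemma aunit_one_minus_const:
  assumes "s ^ d \<noteq> 1" "s \<noteq> 0"
  shows "aunit (cycloR d) (1 - qv ^ m / Fract [:s:] 1)"
proof -
  have nz: "[:s:] - qR ^ m \<noteq> 0"
  proof
    assume "[:s:] - qR ^ m = 0"
    then have eq: "[:s:] = monom 1 m" by (simp add: qR_power)
    then have "m = 0"
      using degree_monom_eq[of "1 :: rat poly poly" m] by (metis degree_pCons_0 one_neq_zero)
    then show False using eq assms(1) by (simp add: monom_0)
  qed
  have "1 - qv ^ m / Fract [:s:] 1 = Fract ([:s:] - qR ^ m) 1 / Fract [:s:] 1"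
    using assms(2) by (simp add: qv_power One_fract_def eq_fract)
  then show ?thesis
    using assms d nz by (auto intro!: aunit_divide aunit_Fract coprime_const_minus_cycloR coprime_const_cycloR)
qed

lemma aunit_one_minus_cv: "aunit (cycloR d) (1 - qv ^ m / cv)"
proof -
  have "[:0, 1:] ^ d = (monom 1 d :: rat poly poly)"
    by (simp add: monom_altdef)
  then have "[:0, 1:] ^ d \<noteq> (1 :: rat poly poly)"
    using monom_neq_1[OF d, where 'a = "rat poly"] by simp
  then show ?thesis
    unfolding cv_def cR_def by (rule aunit_one_minus_const) auto
qed

lemma aunit_one_minus_ev: "aunit (cycloR d) (1 - qv ^ m / ev)"
proof -
  have "[:[:0, 1:]:] ^ d = ([:monom 1 d:] :: rat poly poly)"
    by (simp add: monom_altdef poly_const_pow)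
  then have "[:[:0, 1:]:] ^ d \<noteq> (1 :: rat poly poly)"
    using monom_neq_1[OF d, where 'a = rat] by (simp add: one_pCons)
  then show ?thesis
    unfolding ev_def eR_def by (rule aunit_one_minus_const) auto
qed

lemma aunit_one_minus_qv_powi:
  assumes "\<not> int d dvd m"
  shows "aunit (cycloR d) (1 - qv powi m)"
proof -
  have *: "aunit (cycloR d) (1 - qv powi int k)" if "\<not> d dvd k" for k
  proof -
    have "k > 0" using that by (auto intro: Nat.gr0I)
    then have "aunit (cycloR d) (Fract (qR ^ k - 1) 1)"
      using coprime_cycloR_qR_power[OF d _ that] qR_power_neq_1 by (intro aunit_Fract) (auto simp: coprime_commute)
    moreover have "1 - qv powi int k = - Fract (qR ^ k - 1) 1"
      by (simp add: qv_power One_fract_def)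
    ultimately show ?thesis by (simp only: aunit_uminus)
  qed
  show ?thesis
  proof (cases m rule: int_cases2)
    case (nonneg k)
    then show ?thesis using *[of k] assms nonneg by auto
  next
    case (nonpos k)
    then have "aunit (cycloR d) (1 - qv powi (- m))"
      using *[of k] assms nonpos by auto
    then show ?thesis
      unfolding one_minus_powi_minus[of "- m", simplified]
      using aunit_mult[OF aunit_uminus[OF aunit_qv_powi]] by simp
  qed
qed

lemma adic_one_minus_qv_powi:
  assumes "int d dvd m"
  shows "adic (cycloR d) 1 (1 - qv powi m)"
proof -
  have *: "adic (cycloR d) 1 (1 - qv powi int k)" if k: "d dvd k" for k
  proof -
    obtain l where k: "k = d * l" using k by auto
    have "cycloR d dvd qR ^ d - 1" by (rule cycloR_dvd[OF d])
    also have "qR ^ d - 1 dvd qR ^ k - 1"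
      unfolding k power_mult by (rule minus_one_dvd_power_minus_one)
    finally obtain f where "qR ^ k - 1 = cycloR d * f" by auto
    then have "1 - qv powi int k = Fract (cycloR d ^ 1 * (- f)) 1"
      by (simp add: qv_power One_fract_def) (metis minus_diff_eq)
    then show ?thesis by (intro adicI[of 1 _ _ _ "- f"]) auto
  qed
  show ?thesis
  proof (cases m rule: int_cases2)
    case (nonneg k)
    then show ?thesis using *[of k] assms nonneg by auto
  next
    case (nonpos k)
    then have "adic (cycloR d) 1 (1 - qv powi (- m))"
      using *[of k] assms nonpos by auto
    then show ?thesis
      unfolding one_minus_powi_minus[of "- m", simplified]
      using aunit_qv_powi[of m] by (auto intro!: adic_mult_left)
  qed
qed

lemma qv_powi_cong:
  assumes "int d dvd m - l"
  shows "adic (cycloR d) 1 (qv powi m - qv powi l)"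
proof -
  have "qv powi m - qv powi l = - (qv powi l) * (1 - qv powi (m - l))"
    by (simp add: algebra_simps power_int_add[symmetric])
  then show ?thesis
    using adic_one_minus_qv_powi[OF assms] aunit_qv_powi[of l] by (auto intro!: adic_mult_left)
qed

text \<open>The quotient is \<open>1 + q^d + \<dots> + q^(d(l-1))\<close>, which is \<open>l\<close> modulo \<open>\<Phi>\<^sub>d\<close>.\<close>

lemma aunit_one_minus_qv_powi_ratio:
  assumes "int d dvd m" "m \<noteq> 0"
  shows "aunit (cycloR d) ((1 - qv powi m) / (1 - qv ^ d))"
proof -
  have nz: "1 - qv ^ d \<noteq> 0" using qv_power_neq_1[OF d] by simp
  have *: "aunit (cycloR d) ((1 - qv powi int k) / (1 - qv ^ d))" if dk: "d dvd k" "k > 0" for k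
  proof -
    obtain l where k: "k = d * l" "l > 0" using dk by auto
    define s where "s = (\<Sum>i<l. (qR ^ d) ^ i)"
    have eq: "qR ^ k - 1 = (qR ^ d - 1) * s"
      unfolding k power_mult s_def by (rule power_diff_1_eq)
    have "coprime s (qR ^ d - 1)"
    proof (rule coprimeI)
      fix h assume h: "h dvd s" "h dvd qR ^ d - 1"
      have "h dvd (\<Sum>i<l. (qR ^ d) ^ i - 1)"
        using h(2) minus_one_dvd_power_minus_one by (intro dvd_sum) (rule dvd_trans)
      with h(1) have "h dvd s - (\<Sum>i<l. (qR ^ d) ^ i - 1)"
        by (rule dvd_diff)
      also have "\<dots> = [:of_nat l:]"
        by (simp add: s_def sum_subtractf of_nat_poly)
      finally show "is_unit h"
        using h(2) k(2) d by (intro is_unit_of_dvd_const[of h "of_nat l" d]) auto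
    qed
    moreover have "s \<noteq> 0"
      using eq qR_power_neq_1[OF dk(2)] by auto
    moreover have "1 - qv powi int k = (1 - qv ^ d) * Fract s 1"
    proof -
      have "1 - qv powi int k = - Fract (qR ^ k - 1) 1"
        by (simp add: qv_power One_fract_def)
      also have "\<dots> = (1 - qv ^ d) * Fract s 1"
        unfolding eq by (simp add: qv_power One_fract_def algebra_simps)
      finally show ?thesis .
    qed
    ultimately show ?thesis
      using nz d by (auto intro!: aunit_Fract coprime_cycloR_if)
  qed
  show ?thesis
  proof (cases m rule: int_cases2)
    case (nonneg k)
    then show ?thesis using *[of k] assms nonneg by auto
  next
    case (nonpos k)
    then have "aunit (cycloR d) ((1 - qv powi (- m)) / (1 - qv ^ d))"
      using *[of k] assms nonpos by auto
    from aunit_mult[OF aunit_uminus[OF aunit_qv_powi[of m]] this] show ?thesis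
      unfolding one_minus_powi_minus[of "- m", simplified] by simp
  qed
qed

end

lemma adic_two_cancel:
  assumes "d > 0" "adic (cycloR d) k (2 * x)"
  shows "adic (cycloR d) k x"
proof -
  have "(2 :: F) = Fract [:2:] 1"
    by (metis Fract_of_nat_eq numeral_poly of_nat_numeral)
  then have "aunit (cycloR d) 2"
    using aunit_const[OF assms(1), of 2] by simp
  then have "adic (cycloR d) k (2 * x / 2)"
    by (rule adic_divide[OF assms(2)])
  then show ?thesis by simp
qed

text \<open>Adding the reversed sum doubles it, and 2 is a unit. This also treats a fixed middle
  index without a case distinction.\<close>

lemma adic_sum_antisymmetric:
  assumes d: "d > 0" and s: "\<And>k. k < m \<Longrightarrow> adic (cycloR d) i (s (m - Suc k) + s k)"
  shows "adic (cycloR d) i (\<Sum>k<m. s k)"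
proof -
  have "adic (cycloR d) i (\<Sum>k<m. s (m - Suc k) + s k)"
    using s by (intro adic_sum) auto
  also have "(\<Sum>k<m. s (m - Suc k) + s k) = 2 * (\<Sum>k<m. s k)"
    by (simp add: sum.distrib sum.nat_diff_reindex)
  finally show ?thesis
    by (rule adic_two_cancel[OF d])
qed

text \<open>For small \<open>k\<close> the difference is the sum over the middle block, which the
  reflection maps to itself. The induction peels one summand off each end.\<close>

lemma adic_partial_sum_symmetric:
  assumes d: "d > 0" and f: "\<And>j. j < m \<Longrightarrow> adic (cycloR d) i (f (m - Suc j) + f j)" and "k \<le> m"
  shows "adic (cycloR d) i ((\<Sum>j<m - k. f j) - (\<Sum>j<k. f j))"
  using \<open>k \<le> m\<close>
proof (induction k)
  case 0
  then show ?case using adic_sum_antisymmetric[of d m i f, OF d f] by simp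
next
  case (Suc k)
  have "m - k = Suc (m - Suc k)" using Suc.prems by simp
  then have eq: "(\<Sum>j<m - Suc k. f j) - (\<Sum>j<Suc k. f j)
      = ((\<Sum>j<m - k. f j) - (\<Sum>j<k. f j)) - (f (m - Suc k) + f k)"
    by simp
  show ?case
    unfolding eq by (intro adic_diff Suc.IH f) (use Suc.prems in auto)
qed

section \<open>The left-hand sum modulo a cyclotomic polynomial\<close>

text \<open>These are the bases in the factors with index \<open>j\<close> of (1/q; q^3) and (q^3;
  q^3). Integer exponents are used because 3 j - 1 is negative at j = 0.\<close>

definition wq :: "nat \<Rightarrow> F" where "wq j = qv powi (3 * int j - 1)"
definition zq :: "nat \<Rightarrow> F" where "zq j = qv powi (3 * int j + 3)"

lemma powi_shift: "qv powi a * (qv ^ 3) ^ j = qv powi (3 * int j + a)"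
  by (simp add: power_int_add power_int_mult power_mult[symmetric] mult.commute)

lemma powi_power: "(qv powi a) ^ k = qv powi (a * int k)"
  by (simp add: power_int_mult)

lemma qpoch_powi: "qpoch (qv powi a) (qv ^ 3) k = (\<Prod>j<k. 1 - qv powi (3 * int j + a))"
  by (simp add: qpoch_def powi_shift)

lemma qpoch_wq: "qpoch (A * inverse qv) (qv ^ 3) k = (\<Prod>j<k. 1 - A * wq j)"
  using powi_shift[of "-1"] by (simp add: qpoch_def wq_def mult.assoc)

lemma qpoch_wq1: "qpoch (inverse qv) (qv ^ 3) k = (\<Prod>j<k. 1 - wq j)"
  using qpoch_wq[of 1] by simp

lemma qpoch_zq: "qpoch (qv ^ 3 / B) (qv ^ 3) k = (\<Prod>j<k. 1 - zq j / B)"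
  using powi_shift[of 3] by (simp add: qpoch_def zq_def)

lemma qpoch_zq': "qpoch (qv ^ 3 * B) (qv ^ 3) k = (\<Prod>j<k. 1 - zq j * B)"
  using qpoch_zq[of "inverse B"] by (simp add: divide_inverse)

lemma qpoch_zq1: "qpoch (qv ^ 3) (qv ^ 3) k = (\<Prod>j<k. 1 - zq j)"
  using qpoch_zq[of 1] by simp

lemma wq_nonzero [simp]: "wq j \<noteq> 0" and zq_nonzero [simp]: "zq j \<noteq> 0"
  by (simp_all add: wq_def zq_def)

lemma zq_power: "zq j = qv ^ (3 * j + 3)"
  unfolding zq_def power_int_of_nat[symmetric] by simp

text \<open>Numerator and denominator of the ratio of consecutive summands of the left-hand side.\<close>

definition num :: "F \<Rightarrow> F" where "num x = (1 - x) ^ 4 * ((1 - cv * x) * (1 - ev * x))"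
definition den :: "F \<Rightarrow> F" where "den x = (1 - x) ^ 4 * ((1 - x / cv) * (1 - x / ev))"
definition \<rho> :: "nat \<Rightarrow> F" where "\<rho> j = num (wq j) / den (zq j) * (qv ^ 9 / (cv * ev))"
definition \<tau> :: "nat \<Rightarrow> F" where "\<tau> k = (\<Prod>j<k. \<rho> j)"

text \<open>Well-poisedness: each factor satisfies 1 - a x = - a x (1 - 1/(a x)), and the parameters
  of \<open>den\<close> are the inverses of those of \<open>num\<close>. All reflection properties
  rest on this.\<close>

lemma num_eq_den_inverse:
  assumes "x \<noteq> 0"
  shows "num x = cv * ev * x ^ 6 * den (inverse x)"
proof -
  have 1: "1 - x = - x * (1 - inverse x)" and 2: "1 - a * x = - a * x * (1 - inverse x / a)" if "a \<noteq> 0" for a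
    using assms that by (simp_all add: field_simps)
  have "num x = (- x * (1 - inverse x)) ^ 4 * ((- cv * x * (1 - inverse x / cv)) * (- ev * x * (1 - inverse x / ev)))"
    unfolding num_def using 1[of 1] 2[of cv] 2[of ev] by simp
  also have "\<dots> = cv * ev * x ^ 6 * den (inverse x)"
    unfolding den_def power_mult_distrib by (simp add: mult_ac eval_nat_numeral)
  finally show ?thesis .
qed

lemma summand_eq:
  "qint (6 * int k - 1) * qpoch (inverse qv) (qv ^ 3) k ^ 4
        * qpoch (cv * inverse qv) (qv ^ 3) k * qpoch (ev * inverse qv) (qv ^ 3) k
        / (qpoch (qv ^ 3) (qv ^ 3) k ^ 4
           * qpoch (qv ^ 3 / cv) (qv ^ 3) k * qpoch (qv ^ 3 / ev) (qv ^ 3) k)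
        * (qv ^ 9 / (cv * ev)) ^ k = qint (6 * int k - 1) * \<tau> k"
proof -
  have "\<tau> k = (\<Prod>j<k. num (wq j)) / (\<Prod>j<k. den (zq j)) * (qv ^ 9 / (cv * ev)) ^ k"
    unfolding \<tau>_def \<rho>_def prod.distrib prod_constant by (simp add: prod_dividef)
  then show ?thesis
    by (simp add: qpoch_wq qpoch_wq1 qpoch_zq qpoch_zq1 num_def den_def prod.distrib prod_power_distrib mult_ac)
qed

lemma card_mod_eq:
  assumes "r < (d :: nat)"
  shows "card {j. j < k \<and> j mod d = r} = (k + (d - 1 - r)) div d"
proof (induction k)
  case 0
  then show ?case using assms by simp
next
  case (Suc k)
  have "{j. j < Suc k \<and> j mod d = r} = (if k mod d = r then insert k {j. j < k \<and> j mod d = r} else {j. j < k \<and> j mod d = r})"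
    by (auto simp: less_Suc_eq)
  then have "card {j. j < Suc k \<and> j mod d = r} = (k + (d - 1 - r)) div d + (if k mod d = r then 1 else 0)"
    using Suc by simp
  also have "\<dots> = Suc (k + (d - 1 - r)) div d"
  proof -
    have "Suc (k + (d - 1 - r)) mod d = 0 \<longleftrightarrow> k mod d = r"
    proof -
      have "Suc (k + (d - 1 - r)) = k + (d - r)" using assms by simp
      moreover have "d dvd k + (d - r) \<longleftrightarrow> int d dvd int k - int r"
      proof -
        have "int (k + (d - r)) = (int k - int r) + int d"
          using assms by simp
        then show ?thesis
          unfolding int_dvd_int_iff[symmetric] by (simp only: dvd_add_triv_right_iff)
      qed
      moreover have "int d dvd int k - int r \<longleftrightarrow> k mod d = r"
        using assms by (simp add: mod_eq_dvd_iff[symmetric] zmod_int[symmetric])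
      ultimately show ?thesis by (metis dvd_eq_mod_eq_0)
    qed
    then show ?thesis by (simp add: div_Suc)
  qed
  finally show ?case by simp
qed

text \<open>\<open>d1\<close> is the inverse of 3 modulo \<open>d\<close>; it plays the role of \<open>(n + 1) / 3\<close>.\<close>

locale inverse_of_three =
  fixes d d1 :: nat
  assumes d: "d > 1" and d1: "d1 < d" "int d dvd 3 * int d1 - 1"
begin

abbreviation "\<Phi> \<equiv> cycloR d"

lemma d_pos: "d > 0" using d by simp

lemma dvd_three_diff_iff: "int d dvd 3 * int j - 3 * int r \<longleftrightarrow> j mod d = r mod d"
proof -
  have "coprime (int d) 3"
  proof (rule coprimeI)
    fix h :: int assume h: "h dvd int d" "h dvd 3"
    have "h dvd 3 * int d1 - (3 * int d1 - 1)"
      by (rule dvd_diff[OF dvd_mult2[OF h(2)] dvd_trans[OF h(1) d1(2)]])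
    also have "\<dots> = 1" by simp
    finally show "is_unit h" .
  qed
  then have "int d dvd 3 * (int j - int r) \<longleftrightarrow> int d dvd int j - int r"
    by (rule coprime_dvd_mult_right_iff)
  then show ?thesis
    by (simp add: mod_eq_dvd_iff[symmetric] zmod_int[symmetric] right_diff_distrib)
qed

text \<open>Modulo \<Phi> the numerator factors degenerate at residue \<open>d1\<close> and the
  denominator factors at residue \<open>d - 1\<close>. As \<open>d1 < d\<close>, within a block a
  zero never comes later than the pole.\<close>

lemma dvd_wq_iff: "int d dvd 3 * int j - 1 \<longleftrightarrow> j mod d = d1"
proof -
  have "3 * int j - 1 = (3 * int j - 3 * int d1) + (3 * int d1 - 1)" by simp
  then have "int d dvd 3 * int j - 1 \<longleftrightarrow> int d dvd 3 * int j - 3 * int d1"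
    using d1(2) by (metis dvd_add_left_iff)
  then show ?thesis
    using dvd_three_diff_iff d1(1) by simp
qed

lemma dvd_zq_iff: "int d dvd 3 * int j + 3 \<longleftrightarrow> j mod d = d - 1"
proof -
  have "3 * int j + 3 = (3 * int j - 3 * int (d - 1)) + 3 * int d"
    using d by (simp add: of_nat_diff)
  then have "int d dvd 3 * int j + 3 \<longleftrightarrow> int d dvd 3 * int j - 3 * int (d - 1)"
    by (metis dvd_add_left_iff dvd_triv_right)
  then show ?thesis
    unfolding dvd_three_diff_iff using d by simp
qed

lemma dvd_twice_iff: "int d dvd 3 * int j - 2 \<longleftrightarrow> j mod d = (2 * d1) mod d"
proof -
  have "3 * int j - 2 = (3 * int j - 3 * int (2 * d1)) + 2 * (3 * int d1 - 1)" by simp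
  then have "int d dvd 3 * int j - 2 \<longleftrightarrow> int d dvd 3 * int j - 3 * int (2 * d1)"
    using d1(2) by (metis dvd_add_left_iff dvd_mult)
  then show ?thesis
    unfolding dvd_three_diff_iff by simp
qed

lemma aunit_wq: "aunit \<Phi> (wq j)" and aunit_zq: "aunit \<Phi> (zq j)"
  unfolding wq_def zq_def by (rule aunit_qv_powi[OF d_pos])+

lemma aunit_one_minus_wq: "j mod d \<noteq> d1 \<Longrightarrow> aunit \<Phi> (1 - wq j)"
  unfolding wq_def by (rule aunit_one_minus_qv_powi[OF d_pos]) (simp add: dvd_wq_iff)

lemma aunit_one_minus_zq: "j mod d \<noteq> d - 1 \<Longrightarrow> aunit \<Phi> (1 - zq j)"
  unfolding zq_def by (rule aunit_one_minus_qv_powi[OF d_pos]) (simp add: dvd_zq_iff)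

lemma adic_num: "adic \<Phi> 0 x \<Longrightarrow> adic \<Phi> 0 (num x)"
  unfolding num_def using aunit_cv[OF d_pos] aunit_ev[OF d_pos]
  by (intro adic_mult_left adic_power0 adic_diff adic_one) auto

lemma adic_den: "adic \<Phi> 0 x \<Longrightarrow> adic \<Phi> 0 (den x)"
  unfolding den_def using aunit_cv[OF d_pos] aunit_ev[OF d_pos]
  by (intro adic_mult_left adic_power0 adic_diff adic_one adic_divide) auto

lemma aunit_den_zq: "j mod d \<noteq> d - 1 \<Longrightarrow> aunit \<Phi> (den (zq j))"
  unfolding den_def
  using aunit_one_minus_zq[of j] aunit_one_minus_cv[OF d_pos] aunit_one_minus_ev[OF d_pos]
  by (intro aunit_mult aunit_power) (simp_all add: zq_power)

lemma adic_cong_power: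
  assumes "adic P k (x - y)" "adic P 0 x" "adic P 0 y"
  shows "adic P k (x ^ m - y ^ m)"
  using adic_cong_prod[of "{..<m}" P k "\<lambda>_. x" "\<lambda>_. y"] assms by simp

lemma den_cong:
  assumes "adic \<Phi> k (x - y)" "adic \<Phi> 0 x" "adic \<Phi> 0 y"
  shows "adic \<Phi> k (den x - den y)"
proof -
  have 1: "adic \<Phi> k ((1 - x / a) - (1 - y / a))" if "aunit \<Phi> a" for a
  proof -
    have "(1 - x / a) - (1 - y / a) = - ((x - y) / a)" by (simp add: diff_divide_distrib)
    then show ?thesis using that assms(1) by (simp add: adic_uminus adic_divide del: minus_diff_eq)
  qed
  have 2: "adic \<Phi> 0 (1 - x / a)" "adic \<Phi> 0 (1 - y / a)" if "aunit \<Phi> a" for a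
    using assms(2,3) that by (auto intro: adic_diff adic_divide)
  note c = aunit_cv[OF d_pos] and e = aunit_ev[OF d_pos]
  show ?thesis
    unfolding den_def
    by (rule adic_cong_mult[OF adic_cong_power adic_cong_mult[OF 1[OF c] 1[OF e] 2(2)[OF c] 2(1)[OF e]]])
      (use 1[of 1] 2[of 1] 2[OF c] 2[OF e] in \<open>auto intro: adic_mult_left adic_power0\<close>)
qed

text \<open>The exponents of \<open>zq (d1 - Suc j)\<close> and \<open>wq j\<close> add up to
  \<open>3 * d1 - 1\<close>, a multiple of \<open>d\<close>.\<close>

lemma zq_reflect:
  assumes "j < d1"
  shows "adic \<Phi> 1 (zq (d1 - Suc j) - inverse (wq j))"
proof -
  have "inverse (wq j) = qv powi (- (3 * int j - 1))"
    by (simp only: wq_def power_int_minus)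
  then show ?thesis
    unfolding zq_def using assms d1(2)
    by (simp only:) (rule qv_powi_cong[OF d_pos], simp add: of_nat_diff algebra_simps)
qed

lemma num_wq_cong:
  assumes "j < d1"
  shows "adic \<Phi> 1 (num (wq j) - cv * ev * wq j ^ 6 * den (zq (d1 - Suc j)))"
proof -
  have "adic \<Phi> 1 (den (inverse (wq j)) - den (zq (d1 - Suc j)))"
    by (rule den_cong[OF adic_cong_sym[OF zq_reflect[OF assms]]])
      (use aunit_inverse[OF aunit_wq] aunit_zq in auto)
  then have "adic \<Phi> 1 (cv * ev * wq j ^ 6 * (den (inverse (wq j)) - den (zq (d1 - Suc j))))"
    using aunit_cv[OF d_pos] aunit_ev[OF d_pos] aunit_wq
    by (intro adic_mult_left adic_power0) auto
  then show ?thesis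
    by (simp add: num_eq_den_inverse right_diff_distrib)
qed

lemma adic_wq: "adic \<Phi> 0 (wq j)" and adic_zq: "adic \<Phi> 0 (zq j)"
  using aunit_wq aunit_zq by auto

lemma adic_\<rho>: "j mod d \<noteq> d - 1 \<Longrightarrow> adic \<Phi> 0 (\<rho> j)"
  unfolding \<rho>_def
  using aunit_cv[OF d_pos] aunit_ev[OF d_pos] aunit_qv[OF d_pos] adic_wq
  by (intro adic_mult_left adic_divide adic_num aunit_den_zq adic_power0 aunit_mult) auto

lemma small_index: "j < d1 \<Longrightarrow> j mod d \<noteq> d - 1" "j < d1 \<Longrightarrow> d1 - Suc j < d1"
  using d1(1) by auto

text \<open>By \<open>num_wq_cong\<close> the numerator of each ratio cancels the denominator of the
  other one. The parameters c and e cancel too, and the surviving exponent is 18 d1 - 12 = 6 (3 d1 -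
  1) - 6.\<close>

lemma \<rho>_reflect:
  assumes "j < d1"
  shows "adic \<Phi> 1 (\<rho> (d1 - Suc j) * \<rho> j - qv powi (- 6))"
proof -
  define j' where "j' = d1 - Suc j"
  have j': "j' < d1" "d1 - Suc j' = j"
    using assms by (auto simp: j'_def)
  define A where "A = cv * ev * wq j ^ 6 * den (zq j')"
  define B where "B = cv * ev * wq j' ^ 6 * den (zq j)"
  have u: "aunit \<Phi> (den (zq j))" "aunit \<Phi> (den (zq j'))"
    using assms j' by (auto intro!: aunit_den_zq small_index(1))
  note nz = u[THEN aunit_nonzero]
  have cong: "adic \<Phi> 1 (num (wq j') * num (wq j) - B * A)"
    unfolding A_def B_def
    using num_wq_cong[OF assms] num_wq_cong[OF j'(1)] adic_num adic_wq u
      aunit_cv[OF d_pos] aunit_ev[OF d_pos]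
    by (intro adic_cong_mult adic_mult_left adic_power0) (auto simp: j' j'_def[symmetric])
  define K where "K = (qv ^ 9 / (cv * ev)) ^ 2 / (den (zq j') * den (zq j))"
  have "adic \<Phi> 0 K"
    unfolding K_def using u aunit_cv[OF d_pos] aunit_ev[OF d_pos] aunit_qv[OF d_pos]
    by (intro aunit_adic aunit_divide aunit_power aunit_mult)
  then have "adic \<Phi> 1 (K * (num (wq j') * num (wq j) - B * A))"
    using cong by (rule adic_mult_left)
  moreover have "K * (num (wq j') * num (wq j)) = \<rho> j' * \<rho> j"
  proof -
    define \<kappa> where "\<kappa> = qv ^ 9 / (cv * ev)"
    show ?thesis
      unfolding K_def \<rho>_def \<kappa>_def[symmetric] by (simp add: power2_eq_square mult_ac)
  qed
  moreover have "K * (B * A) = qv ^ 18 * (wq j' * wq j) ^ 6"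
    unfolding K_def A_def B_def using nz
    by (simp add: power_divide power_mult_distrib power_mult[symmetric] power2_eq_square)
  moreover have "qv ^ 18 * (wq j' * wq j) ^ 6 = qv powi (18 * int d1 - 12)"
  proof -
    have ww: "wq j' * wq j = qv powi (3 * int d1 - 5)"
      using assms unfolding wq_def j'_def
      by (subst power_int_add[symmetric]) (simp_all add: of_nat_diff algebra_simps)
    have "qv ^ 18 * (wq j' * wq j) ^ 6 = qv powi 18 * qv powi ((3 * int d1 - 5) * 6)"
      unfolding ww powi_power by simp
    also have "\<dots> = qv powi (18 + (3 * int d1 - 5) * 6)"
      by (simp only: power_int_add[OF disjI1[OF qv_nonzero]])
    finally show ?thesis by (simp add: algebra_simps)
  qed
  moreover have "adic \<Phi> 1 (qv powi (18 * int d1 - 12) - qv powi (- 6))"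
  proof (rule qv_powi_cong[OF d_pos])
    have "18 * int d1 - 12 - (- 6) = 6 * (3 * int d1 - 1)" by simp
    then show "int d dvd 18 * int d1 - 12 - (- 6)"
      using d1(2) by (metis dvd_mult)
  qed
  ultimately show ?thesis
    using adic_cong_trans by (simp add: right_diff_distrib j'_def)
qed

text \<open>Reversing the order of the denominators pairs \<open>wq j\<close> with
  \<open>zq (d1 - Suc j)\<close>, and every quotient becomes a power of q. The total exponent 9 d1^2
  - 6 d1 is (3 d1 - 1)^2 - 1.\<close>

lemma \<tau>_d1: "adic \<Phi> 1 (\<tau> d1 - qv powi (- 1))"
proof -
  define h where "h j = num (wq j) / den (zq (d1 - Suc j)) * (qv ^ 9 / (cv * ev))" for j
  have "\<tau> d1 = (\<Prod>j<d1. h j)"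
    unfolding \<tau>_def \<rho>_def h_def prod.distrib prod_dividef
    using prod.nat_diff_reindex[of "\<lambda>j. den (zq j)" d1] by simp
  moreover have "adic \<Phi> 1 ((\<Prod>j<d1. h j) - (\<Prod>j<d1. wq j ^ 6 * qv ^ 9))"
  proof (rule adic_cong_prod)
    fix j assume "j \<in> {..<d1}"
    then have j: "j < d1" by simp
    have u: "aunit \<Phi> (den (zq (d1 - Suc j)))"
      using j by (intro aunit_den_zq small_index)
    note u' = u aunit_cv[OF d_pos] aunit_ev[OF d_pos] aunit_qv[OF d_pos] aunit_wq
    define K where "K = qv ^ 9 / (cv * ev) / den (zq (d1 - Suc j))"
    have "adic \<Phi> 0 K"
      unfolding K_def using u' by (intro aunit_adic aunit_divide aunit_power aunit_mult)
    then have "adic \<Phi> 1 (K * (num (wq j) - cv * ev * wq j ^ 6 * den (zq (d1 - Suc j))))"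
      using num_wq_cong[OF j] by (rule adic_mult_left)
    then show "adic \<Phi> 1 (h j - wq j ^ 6 * qv ^ 9)"
      using aunit_nonzero[OF u] by (simp add: K_def h_def right_diff_distrib mult_ac)
    show "adic \<Phi> 0 (h j)" "adic \<Phi> 0 (wq j ^ 6 * qv ^ 9)"
      unfolding h_def using u' by (auto intro!: adic_mult_left adic_divide adic_num adic_power0 aunit_mult)
  qed
  moreover have "(\<Prod>j<m. wq j ^ 6 * qv ^ 9) = qv powi (9 * int m ^ 2 - 6 * int m)" for m
  proof (induction m)
    case (Suc m)
    have "wq m ^ 6 * qv ^ 9 = qv powi ((3 * int m - 1) * 6) * qv powi 9"
      unfolding wq_def powi_power by simp
    also have "\<dots> = qv powi ((3 * int m - 1) * 6 + 9)"
      by (simp only: power_int_add[OF disjI1[OF qv_nonzero]])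
    finally have "(\<Prod>j<Suc m. wq j ^ 6 * qv ^ 9)
       = qv powi ((9 * int m ^ 2 - 6 * int m) + ((3 * int m - 1) * 6 + 9))"
      using Suc by (simp only: prod.lessThan_Suc power_int_add[OF disjI1[OF qv_nonzero]])
    then show ?case by (simp add: algebra_simps power2_eq_square)
  qed simp
  moreover have "adic \<Phi> 1 (qv powi (9 * int d1 ^ 2 - 6 * int d1) - qv powi (- 1))"
  proof (rule qv_powi_cong[OF d_pos])
    have "9 * int d1 ^ 2 - 6 * int d1 - (- 1) = (3 * int d1 - 1) * (3 * int d1 - 1)"
      by (simp add: algebra_simps power2_eq_square)
    then show "int d dvd 9 * int d1 ^ 2 - 6 * int d1 - (- 1)"
      using d1(2) by (metis dvd_mult)
  qed
  ultimately show ?thesis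
    using adic_cong_trans by metis
qed

lemma adic_\<tau>_small: "k < d \<Longrightarrow> adic \<Phi> 0 (\<tau> k)"
  unfolding \<tau>_def by (intro adic_prod adic_\<rho>) auto

text \<open>Passing from \<open>k\<close> to \<open>Suc k\<close> removes one ratio from the left
  side and adds its mirror image on the right; by \<open>\<rho>_reflect\<close> this costs q^6,
  starting from \<open>\<tau>_d1\<close>.\<close>

lemma \<tau>_reflect:
  assumes "k \<le> d1"
  shows "adic \<Phi> 1 (\<tau> (d1 - k) - qv powi (6 * int k - 1) * \<tau> k)"
  using assms
proof (induction k)
  case 0
  then show ?case using \<tau>_d1 by (simp add: \<tau>_def[of 0])
next
  case (Suc k)
  define t where "t = \<tau> (d1 - Suc k)"
  have 1: "\<tau> (d1 - k) = t * \<rho> (d1 - Suc k)"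
    using Suc.prems Suc_diff_Suc[of k d1] unfolding \<tau>_def t_def by (metis Suc_le_lessD prod.lessThan_Suc)
  have k: "k < d1" "d1 - Suc k < d" "k mod d \<noteq> d - 1" using Suc.prems d1(1) by auto
  \<comment> \<open>Multiplying by \<open>\<rho> k\<close> creates the product known from
    \<open>\<rho>_reflect\<close>, so no ratio has to be inverted.\<close>
  have "adic \<Phi> 1 ((t * \<rho> (d1 - Suc k) - qv powi (6 * int k - 1) * \<tau> k) * \<rho> k)"
    using Suc.IH Suc.prems adic_\<rho>[OF k(3)] unfolding 1 by (intro adic_mult_right) auto
  moreover have "adic \<Phi> 1 (t * (\<rho> (d1 - Suc k) * \<rho> k - qv powi (- 6)))"
    unfolding t_def using adic_\<tau>_small[OF k(2)] \<rho>_reflect[OF k(1)] by (rule adic_mult_left)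
  ultimately have "adic \<Phi> 1 ((t * \<rho> (d1 - Suc k) - qv powi (6 * int k - 1) * \<tau> k) * \<rho> k
      - t * (\<rho> (d1 - Suc k) * \<rho> k - qv powi (- 6)))"
    by (rule adic_diff)
  then have "adic \<Phi> 1 (qv ^ 6 * ((t * \<rho> (d1 - Suc k) - qv powi (6 * int k - 1) * \<tau> k) * \<rho> k
      - t * (\<rho> (d1 - Suc k) * \<rho> k - qv powi (- 6))))"
    by (rule adic_mult_left[OF adic_power0[OF aunit_adic[OF aunit_qv[OF d_pos]]]])
  also have "(t * \<rho> (d1 - Suc k) - qv powi (6 * int k - 1) * \<tau> k) * \<rho> k
      - t * (\<rho> (d1 - Suc k) * \<rho> k - qv powi (- 6)) = t * qv powi (- 6) - qv powi (6 * int k - 1) * \<tau> (Suc k)"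
    by (simp add: \<tau>_def algebra_simps)
  also have "qv ^ 6 * (t * qv powi (- 6) - qv powi (6 * int k - 1) * \<tau> (Suc k))
     = t - (qv powi 6 * qv powi (6 * int k - 1)) * \<tau> (Suc k)"
    by (simp add: right_diff_distrib power_int_minus)
  also have "qv powi 6 * qv powi (6 * int k - 1) = qv powi (6 * int (Suc k) - 1)"
    by (subst power_int_add[symmetric]) (simp_all add: algebra_simps)
  finally show ?case by (simp only: t_def)
qed

end

definition lhs_term :: "nat \<Rightarrow> F" where "lhs_term k = qint (6 * int k - 1) * \<tau> k"

context inverse_of_three
begin

lemma aunit_one_minus_qv: "aunit \<Phi> (1 - qv)"
  using aunit_one_minus_qv_powi[OF d_pos, of 1] d by simp

lemma adic_qint: "adic \<Phi> 0 (qint m)"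
  unfolding qint_def using aunit_qv_powi[OF d_pos] aunit_one_minus_qv
  by (intro adic_divide adic_diff adic_one) auto

lemma qint_cong:
  assumes "int d dvd a - b"
  shows "adic \<Phi> 1 (qint a - qint b)"
proof -
  have "qint a - qint b = - ((qv powi a - qv powi b) / (1 - qv))"
    by (simp add: qint_def diff_divide_distrib)
  then show ?thesis
    using adic_uminus[OF adic_divide[OF qv_powi_cong[OF d_pos assms] aunit_one_minus_qv]] by simp
qed

lemma adic_lhs_term_small: "k < d \<Longrightarrow> adic \<Phi> 0 (lhs_term k)"
  unfolding lhs_term_def by (intro adic_mult_left adic_qint adic_\<tau>_small)

text \<open>The index 6 (d1 - k) - 1 is congruent to -(6 k - 1), and [-m] = - q^(-m) [m]. The power
  of q cancels the one in \<open>\<tau>_reflect\<close> and only the sign remains.\<close>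

lemma lhs_term_reflect:
  assumes "k \<le> d1"
  shows "adic \<Phi> 1 (lhs_term (d1 - k) + lhs_term k)"
proof -
  define r where "r = qint (1 - 6 * int k)"
  have "6 * int (d1 - k) - 1 - (1 - 6 * int k) = 2 * (3 * int d1 - 1)"
    using assms by (simp add: of_nat_diff)
  then have 1: "adic \<Phi> 1 (qint (6 * int (d1 - k) - 1) - r)"
    unfolding r_def using d1(2) by (intro qint_cong) (metis dvd_mult)
  have "r * (qv powi (6 * int k - 1) * \<tau> k) = - lhs_term k"
    using one_minus_powi_minus[of "6 * int k - 1"]
    by (simp add: r_def lhs_term_def qint_def power_int_add[symmetric])
  moreover have "adic \<Phi> 1 (lhs_term (d1 - k) - r * (qv powi (6 * int k - 1) * \<tau> k))"
    unfolding lhs_term_def using 1 \<tau>_reflect[OF assms] d1(1)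
    by (intro adic_cong_mult) (auto simp: r_def intro!: adic_qint adic_\<tau>_small)
  ultimately show ?thesis
    by simp
qed

text \<open>Weights invariant under the reflection preserve the antisymmetry. Weight 1 serves the
  block sums; products of logarithmic derivatives serve the mixed second difference.\<close>

lemma adic_sum_lhs_term_weighted:
  assumes "\<And>k. k \<le> d1 \<Longrightarrow> adic \<Phi> 0 (h k)" "\<And>k. k \<le> d1 \<Longrightarrow> adic \<Phi> 1 (h (d1 - k) - h k)"
  shows "adic \<Phi> 1 (\<Sum>k\<le>d1. lhs_term k * h k)"
  unfolding lessThan_Suc_atMost[symmetric]
proof (rule adic_sum_antisymmetric[OF d_pos])
  fix k assume "k < Suc d1"
  then have k: "k \<le> d1" "d1 - k \<le> d1" "k < d" using d1(1) by auto
  have "adic \<Phi> 1 ((lhs_term (d1 - k) + lhs_term k) * h (d1 - k) - lhs_term k * (h (d1 - k) - h k))"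
    by (rule adic_diff[OF adic_mult_right[OF lhs_term_reflect[OF k(1)] assms(1)[OF k(2)]]
          adic_mult_left[OF adic_lhs_term_small[OF k(3)] assms(2)[OF k(1)]]])
  then show "adic \<Phi> 1 (lhs_term (Suc d1 - Suc k) * h (Suc d1 - Suc k) + lhs_term k * h k)"
    by (simp add: algebra_simps)
qed

text \<open>Only the number of exponents divisible by \<open>d\<close> matters, since \<open>1 - q^m\<close> is a unit or
  a unit times \<open>1 - q^d\<close>.\<close>

lemma prod_one_minus_powi:
  assumes "finite A" "\<And>j. j \<in> A \<Longrightarrow> f j \<noteq> 0"
  obtains u where "aunit \<Phi> u"
    "(\<Prod>j\<in>A. 1 - qv powi f j) = (1 - qv ^ d) ^ card {j\<in>A. int d dvd f j} * u"
proof -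
  have nz: "1 - qv ^ d \<noteq> 0" using qv_power_neq_1[OF d_pos] by simp
  have "\<exists>u. aunit \<Phi> u \<and> (\<Prod>j\<in>A. 1 - qv powi f j) = (1 - qv ^ d) ^ card {j\<in>A. int d dvd f j} * u"
    using assms
  proof (induction A rule: finite_induct)
    case empty
    show ?case by (intro exI[of _ 1]) auto
  next
    case (insert a A)
    then obtain u where u: "aunit \<Phi> u"
      "(\<Prod>j\<in>A. 1 - qv powi f j) = (1 - qv ^ d) ^ card {j\<in>A. int d dvd f j} * u"
      by auto
    show ?case
    proof (cases "int d dvd f a")
      case True
      have "{j \<in> insert a A. int d dvd f j} = insert a {j\<in>A. int d dvd f j}"
        using True by auto
      then have "card {j \<in> insert a A. int d dvd f j} = Suc (card {j\<in>A. int d dvd f j})"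
        using insert.hyps by simp
      moreover have "aunit \<Phi> ((1 - qv powi f a) / (1 - qv ^ d) * u)"
        using u(1) True insert.prems by (intro aunit_mult aunit_one_minus_qv_powi_ratio[OF d_pos]) auto
      ultimately show ?thesis
        using u(2) insert.hyps nz
        by (intro exI[of _ "(1 - qv powi f a) / (1 - qv ^ d) * u"]) simp
    next
      case False
      have "{j \<in> insert a A. int d dvd f j} = {j\<in>A. int d dvd f j}"
        using False by auto
      moreover have "aunit \<Phi> ((1 - qv powi f a) * u)"
        using u(1) False by (intro aunit_mult aunit_one_minus_qv_powi[OF d_pos])
      ultimately show ?thesis
        using u(2) insert.hyps by (intro exI[of _ "(1 - qv powi f a) * u"]) simp
    qed
  qed
  then show ?thesis using that by blast
qed

lemma adic_prod_ratio:
  assumes "finite A" "finite B" "\<And>j. j \<in> A \<Longrightarrow> f j \<noteq> 0" "\<And>j. j \<in> B \<Longrightarrow> g j \<noteq> 0"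
    and "card {j\<in>B. int d dvd g j} \<le> card {j\<in>A. int d dvd f j}"
  shows "adic \<Phi> 0 ((\<Prod>j\<in>A. 1 - qv powi f j) / (\<Prod>j\<in>B. 1 - qv powi g j))"
proof -
  obtain u where u: "aunit \<Phi> u"
    "(\<Prod>j\<in>A. 1 - qv powi f j) = (1 - qv ^ d) ^ card {j\<in>A. int d dvd f j} * u"
    using prod_one_minus_powi assms(1,3) by blast
  obtain v where v: "aunit \<Phi> v"
    "(\<Prod>j\<in>B. 1 - qv powi g j) = (1 - qv ^ d) ^ card {j\<in>B. int d dvd g j} * v"
    using prod_one_minus_powi assms(2,4) by blast
  define k where "k = card {j\<in>A. int d dvd f j} - card {j\<in>B. int d dvd g j}"
  have "card {j\<in>A. int d dvd f j} = card {j\<in>B. int d dvd g j} + k"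
    using assms(5) by (simp add: k_def)
  moreover have "1 - qv ^ d \<noteq> 0" using qv_power_neq_1[OF d_pos] by simp
  ultimately have "(\<Prod>j\<in>A. 1 - qv powi f j) / (\<Prod>j\<in>B. 1 - qv powi g j) = (1 - qv ^ d) ^ k * u / v"
    unfolding u(2) v(2) by (simp add: power_add)
  then show ?thesis
    using u(1) v(1) aunit_qv[OF d_pos]
    by (auto intro!: adic_divide adic_mult_left adic_power0 adic_diff adic_one)
qed

lemma card_wq: "card {j \<in> {..<k}. int d dvd 3 * int j - 1} = (k + (d - 1 - d1)) div d"
  using card_mod_eq[OF d1(1)] by (simp add: dvd_wq_iff)

lemma card_zq: "card {j \<in> {..<k}. int d dvd 3 * int j + 3} = k div d"
  using card_mod_eq[of "d - 1" d k] d by (simp add: dvd_zq_iff)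

lemma adic_wq_zq_ratio: "adic \<Phi> 0 ((\<Prod>j<k. 1 - wq j) / (\<Prod>j<k. 1 - zq j))"
  unfolding wq_def zq_def
proof (rule adic_prod_ratio)
  show "3 * int j - 1 \<noteq> 0" for j by presburger
  show "card {j \<in> {..<k}. int d dvd 3 * int j + 3} \<le> card {j \<in> {..<k}. int d dvd 3 * int j - 1}"
    unfolding card_wq card_zq by (rule div_le_mono) simp
qed auto

lemma adic_\<tau>: "adic \<Phi> 0 (\<tau> k)"
proof -
  have "\<tau> k = ((\<Prod>j<k. 1 - wq j) / (\<Prod>j<k. 1 - zq j)) ^ 4
     * (\<Prod>j<k. (1 - cv * wq j) * (1 - ev * wq j) / ((1 - zq j / cv) * (1 - zq j / ev)) * (qv ^ 9 / (cv * ev)))"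
    unfolding \<tau>_def \<rho>_def num_def den_def prod_dividef[symmetric] prod_power_distrib prod.distrib[symmetric]
    by (simp add: power_divide mult_ac)
  then show ?thesis
    using adic_wq_zq_ratio[of k] aunit_cv[OF d_pos] aunit_ev[OF d_pos] aunit_qv[OF d_pos] adic_wq
      aunit_one_minus_cv[OF d_pos] aunit_one_minus_ev[OF d_pos]
    by (auto simp: zq_power intro!: adic_mult_left adic_power0 adic_prod adic_divide aunit_mult adic_diff)
qed

section \<open>Periodicity of the ratios and summation over blocks\<close>

lemma num_cong:
  assumes "adic \<Phi> k (x - y)" "aunit \<Phi> x" "aunit \<Phi> y"
  shows "adic \<Phi> k (num x - num y)"
proof -
  note nz = assms(2,3)[THEN aunit_nonzero]
  have "inverse x - inverse y = - ((x - y) / (x * y))"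
    using nz by (simp add: field_simps)
  then have "adic \<Phi> k (inverse x - inverse y)"
    using assms by (simp add: adic_uminus adic_divide aunit_mult del: minus_diff_eq minus_divide_left)
  then have 1: "adic \<Phi> k (den (inverse x) - den (inverse y))"
    using assms(2,3)[THEN aunit_inverse] by (intro den_cong) auto
  have 2: "adic \<Phi> k (cv * ev * x ^ 6 - cv * ev * y ^ 6)"
    unfolding right_diff_distrib[symmetric]
    using assms aunit_cv[OF d_pos] aunit_ev[OF d_pos] by (intro adic_mult_left adic_cong_power) auto
  have "adic \<Phi> 0 (cv * ev * y ^ 6)" "adic \<Phi> 0 (den (inverse x))"
    using assms(2,3) aunit_inverse[OF assms(2)] aunit_cv[OF d_pos] aunit_ev[OF d_pos]
    by (auto intro!: adic_mult_left adic_power0 adic_den)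
  then show ?thesis
    unfolding num_eq_den_inverse[OF nz(1)] num_eq_den_inverse[OF nz(2)] by (rule adic_cong_mult[OF 2 1])
qed

lemma aunit_argument: "aunit \<Phi> (qv ^ 9 / (cv * ev))"
  by (intro aunit_divide aunit_power aunit_mult aunit_qv aunit_cv aunit_ev d_pos)

lemma \<rho>_block:
  assumes "j < d - 1"
  shows "adic \<Phi> 1 (\<rho> (l * d + j) - \<rho> j)"
proof -
  have w: "adic \<Phi> 1 (wq (l * d + j) - wq j)"
    unfolding wq_def by (rule qv_powi_cong[OF d_pos]) simp
  have z: "adic \<Phi> 1 (zq (l * d + j) - zq j)"
    unfolding zq_def by (rule qv_powi_cong[OF d_pos]) simp
  have "adic \<Phi> 1 (num (wq (l * d + j)) / den (zq (l * d + j)) - num (wq j) / den (zq j))"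
    using assms aunit_wq aunit_zq
    by (intro adic_cong_divide num_cong den_cong adic_num aunit_den_zq w z) auto
  then have "adic \<Phi> 1 ((num (wq (l * d + j)) / den (zq (l * d + j)) - num (wq j) / den (zq j)) * (qv ^ 9 / (cv * ev)))"
    using aunit_argument by (intro adic_mult_right) auto
  then show ?thesis
    unfolding \<rho>_def left_diff_distrib .
qed

text \<open>Inside a block the ratios repeat modulo \<Phi> as long as the degenerate index
  \<open>d - 1\<close> is not crossed, which \<open>k < d\<close> ensures. What lies before the
  block is collected in \<open>\<tau> (l * d)\<close>, for which integrality is enough.\<close>

lemma lhs_term_block:
  assumes "k < d"
  shows "adic \<Phi> 1 (lhs_term (l * d + k) - \<tau> (l * d) * lhs_term k)"
proof -
  have split: "\<tau> (l * d + k) = \<tau> (l * d) * (\<Prod>j<k. \<rho> (l * d + j))"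
    unfolding \<tau>_def by (induction k) simp_all
  have "adic \<Phi> 1 ((\<Prod>j<k. \<rho> (l * d + j)) - \<tau> k)"
    unfolding \<tau>_def using assms by (intro adic_cong_prod \<rho>_block adic_\<rho>) auto
  then have "adic \<Phi> 1 (qint (6 * int (l * d + k) - 1) * (\<Prod>j<k. \<rho> (l * d + j)) - lhs_term k)"
    unfolding lhs_term_def using assms
    by (intro adic_cong_mult qint_cong adic_qint adic_prod adic_\<rho>) auto
  then have "adic \<Phi> 1 (\<tau> (l * d) * (qint (6 * int (l * d + k) - 1) * (\<Prod>j<k. \<rho> (l * d + j)) - lhs_term k))"
    by (rule adic_mult_left[OF adic_\<tau>])
  then show ?thesis
    unfolding lhs_term_def[of "l * d + k"] split by (simp add: right_diff_distrib mult_ac)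
qed

text \<open>Such a term contains the ratio with index \<open>d1\<close>, whose numerator has the
  fourth power of a multiple of \<Phi>; no denominator degenerates before
  \<open>d - 1\<close>.\<close>

lemma lhs_term_large:
  assumes "d1 < k" "k < d"
  shows "adic \<Phi> 4 (lhs_term k)"
proof -
  have "adic \<Phi> 4 ((1 - wq d1) ^ 4)"
    using adic_power[of \<Phi> 1 "1 - wq d1" 4] adic_one_minus_qv_powi[OF d_pos d1(2)]
    by (simp add: wq_def)
  then have "adic \<Phi> 4 (\<rho> d1)"
    unfolding \<rho>_def num_def using assms adic_wq aunit_cv[OF d_pos] aunit_ev[OF d_pos] aunit_qv[OF d_pos]
    by (intro adic_mult_right[of _ _ "_ / _"] adic_divide adic_mult_right[of _ _ "_ ^ 4"] aunit_den_zq)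
      (auto intro!: adic_mult_left adic_diff adic_divide adic_power0 aunit_mult)
  moreover have "\<tau> k = \<rho> d1 * (\<Prod>j\<in>{..<k} - {d1}. \<rho> j)"
    unfolding \<tau>_def using assms by (subst prod.remove[of _ d1]) auto
  moreover have "adic \<Phi> 0 (\<Prod>j\<in>{..<k} - {d1}. \<rho> j)"
    using assms by (intro adic_prod adic_\<rho>) auto
  ultimately show ?thesis
    unfolding lhs_term_def by (auto intro: adic_mult_left adic_mult_right adic_qint)
qed

lemma adic_sum_lhs_term_initial:
  assumes "d1 < m" "m \<le> d"
  shows "adic \<Phi> 1 (\<Sum>k<m. lhs_term k)"
proof -
  have "(\<Sum>k<m. lhs_term k) = (\<Sum>k\<le>d1. lhs_term k) + (\<Sum>k\<in>{d1<..<m}. lhs_term k)"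
    using assms by (subst sum.union_disjoint[symmetric]) (auto intro!: sum.cong)
  moreover have "adic \<Phi> 1 (\<Sum>k\<le>d1. lhs_term k)"
    using adic_sum_lhs_term_weighted[of "\<lambda>_. 1"] by simp
  moreover have "adic \<Phi> 1 (\<Sum>k\<in>{d1<..<m}. lhs_term k)"
    using assms by (intro adic_sum adic_mono[OF lhs_term_large]) auto
  ultimately show ?thesis
    by (simp add: adic_add)
qed

lemma adic_sum_lhs_term_block:
  assumes "d1 < m" "m \<le> d"
  shows "adic \<Phi> 1 (\<Sum>k<m. lhs_term (l * d + k))"
proof -
  have "adic \<Phi> 1 ((\<Sum>k<m. lhs_term (l * d + k) - \<tau> (l * d) * lhs_term k) + \<tau> (l * d) * (\<Sum>k<m. lhs_term k))"
    using assms by (intro adic_add adic_sum lhs_term_block adic_mult_left[OF adic_\<tau>] adic_sum_lhs_term_initial) auto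
  then show ?thesis
    by (simp add: sum_subtractf sum_distrib_left)
qed

text \<open>The condition on \<open>M\<close> says that the last, possibly incomplete block still
  contains the whole range 0..d1 on which the reflection acts.\<close>

lemma adic_sum_lhs_term:
  assumes "d1 \<le> M mod d"
  shows "adic \<Phi> 1 (\<Sum>k\<le>M. lhs_term k)"
proof -
  have split: "(\<Sum>k<a + m. lhs_term k) = (\<Sum>k<a. lhs_term k) + (\<Sum>k<m. lhs_term (a + k))" for a m
    by (induction m) (simp_all add: add.assoc)
  have full: "adic \<Phi> 1 (\<Sum>k<l * d. lhs_term k)" for l
  proof (induction l)
    case (Suc l)
    then show ?case
      using split[of "l * d" d] adic_sum_lhs_term_block[of d l] d1(1) by (simp add: add.commute adic_add)
  qed simp
  have "Suc M = (M div d) * d + Suc (M mod d)"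
    by simp
  then have "(\<Sum>k\<le>M. lhs_term k) = (\<Sum>k<(M div d) * d. lhs_term k) + (\<Sum>k<Suc (M mod d). lhs_term ((M div d) * d + k))"
    unfolding lessThan_Suc_atMost[symmetric] by (metis split)
  moreover have "adic \<Phi> 1 (\<Sum>k<Suc (M mod d). lhs_term ((M div d) * d + k))"
    using assms d_pos by (intro adic_sum_lhs_term_block) (auto simp: Suc_le_eq)
  ultimately show ?thesis
    using full by (simp only: adic_add)
qed

end

section \<open>The deformed sums\<close>

text \<open>Reads the quotient from its top factor downwards. It converts factorials of N - r into a
  terminating parameter p^(-N).\<close>

lemma qpoch_self_ratio:
  assumes p: "\<And>k. k > 0 \<Longrightarrow> p ^ k \<noteq> 1" and "p \<noteq> 0" "r \<le> N"
  shows "qpoch p p N / qpoch p p (N - r) = qpoch (inverse (p ^ N)) p r * (\<Prod>j<r. - (p ^ (N - j)))"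
  using \<open>r \<le> N\<close>
proof (induction r)
  case 0
  then show ?case using qpoch_self_nonzero[OF p] by simp
next
  case (Suc r)
  define m where "m = N - Suc r"
  have m: "N - r = Suc m" "N = r + Suc m" using Suc.prems by (auto simp: m_def)
  have "1 - p * p ^ m \<noteq> 0" using p[of "Suc m"] by simp
  then have "qpoch p p N / qpoch p p m = qpoch p p N / qpoch p p (N - r) * (1 - p ^ Suc m)"
    unfolding m(1) by (simp add: qpoch_Suc)
  also have "1 - p ^ Suc m = (1 - inverse (p ^ N) * p ^ r) * - (p ^ (N - r))"
    unfolding m(1) using \<open>p \<noteq> 0\<close> by (subst m(2)) (simp add: power_add field_simps)
  finally show ?case
    using Suc by (simp add: m_def[symmetric] qpoch_Suc mult_ac)
qed

text \<open>The finite form multiplied by \<open>qpoch p p N * qpoch (a * p) p N\<close>, divided by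
  the two outer symbols. \<open>qpoch_self_ratio\<close> introduces the sixth parameter
  \<open>h\<close>, and the sign products merge into powers of 1/h.\<close>

theorem watson_transformation_classical:
  fixes a b c d e p :: F and N :: nat
  assumes p: "\<And>k. k > 0 \<Longrightarrow> p ^ k \<noteq> 1" "p \<noteq> 0"
    and a: "\<And>m. qpoch (a * p) p m \<noteq> 0" "a \<noteq> 1"
    and b: "b \<noteq> 0" "\<And>m. qpoch (a * p / b) p m \<noteq> 0"
    and c: "c \<noteq> 0" "\<And>m. qpoch (a * p / c) p m \<noteq> 0"
    and d: "d \<noteq> 0" "\<And>m. qpoch (a * p / d) p m \<noteq> 0"
    and e: "e \<noteq> 0" "\<And>m. qpoch (a * p / e) p m \<noteq> 0"
  defines "w \<equiv> a * p / (d * e)" and "h \<equiv> inverse (p ^ N)"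
  shows "(\<Sum>r\<le>N. (1 - a * p ^ (2 * r)) / (1 - a) * (a ^ 2 * p ^ 2 / (b * c * d * e * h)) ^ r
          * (qpoch a p r * qpoch b p r * qpoch c p r * qpoch d p r * qpoch e p r * qpoch h p r)
          / (qpoch p p r * qpoch (a * p / b) p r * qpoch (a * p / c) p r * qpoch (a * p / d) p r
             * qpoch (a * p / e) p r * qpoch (a * p / h) p r))
    = qpoch (a * p) p N / (qpoch (a * p / d) p N * qpoch (a * p / e) p N) *
      (\<Sum>j\<le>N. qpoch d p j * qpoch e p j * qpoch h p j * (\<Prod>i<j. - (p ^ (N - i)))
          * (qpoch w p (N - j) * w ^ j) * qpoch (a * p / (b * c)) p j
          / (qpoch p p j * qpoch (a * p / b) p j * qpoch (a * p / c) p j))"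
proof -
  define Q where "Q = qpoch (a * p) p N / (qpoch (a * p / d) p N * qpoch (a * p / e) p N)"
  define Z where "Z = a ^ 2 * p ^ 2 / (b * c * d * e)"
  have ap: "qpoch (a * p) p N / qpoch (a * p) p (N + r) = 1 / qpoch (a * p / h) p r" for r
    using a(1)[of N] p(2) by (simp add: qpoch_add h_def divide_inverse)
  have 1: "(1 - a * p ^ (2 * r)) / (1 - a) * (a ^ 2 * p ^ 2 / (b * c * d * e * h)) ^ r
          * (qpoch a p r * qpoch b p r * qpoch c p r * qpoch d p r * qpoch e p r * qpoch h p r)
          / (qpoch p p r * qpoch (a * p / b) p r * qpoch (a * p / c) p r * qpoch (a * p / d) p r
             * qpoch (a * p / e) p r * qpoch (a * p / h) p r)
     = qpoch p p N * qpoch (a * p) p N * ((1 - a * p ^ (2 * r)) / (1 - a) * (\<Prod>j<r. - (p ^ j)) * Z ^ r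
          * (qpoch a p r * qpoch b p r * qpoch c p r * qpoch d p r * qpoch e p r)
          / (qpoch p p r * qpoch (a * p / b) p r * qpoch (a * p / c) p r * qpoch (a * p / d) p r * qpoch (a * p / e) p r)
          / (qpoch p p (N - r) * qpoch (a * p) p (N + r)))" (is "?L = ?R") if r: "r \<le> N" for r
  proof -
    have "(\<Prod>j<r. - (p ^ j)) * (\<Prod>j<r. - (p ^ (N - j))) = (\<Prod>j<r. p ^ N)"
      unfolding prod.distrib[symmetric] using r by (intro prod.cong) (auto simp: power_add[symmetric])
    then have s: "(\<Prod>j<r. - (p ^ j)) * (\<Prod>j<r. - (p ^ (N - j))) = (inverse h) ^ r"
      by (simp add: h_def)
    have "?R = (1 - a * p ^ (2 * r)) / (1 - a) * ((\<Prod>j<r. - (p ^ j)) * Z ^ r)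
          * (qpoch a p r * qpoch b p r * qpoch c p r * qpoch d p r * qpoch e p r)
          / (qpoch p p r * qpoch (a * p / b) p r * qpoch (a * p / c) p r * qpoch (a * p / d) p r * qpoch (a * p / e) p r)
          * (qpoch p p N / qpoch p p (N - r)) * (qpoch (a * p) p N / qpoch (a * p) p (N + r))"
      by (simp add: mult_ac)
    also have "\<dots> = (1 - a * p ^ (2 * r)) / (1 - a) * (((\<Prod>j<r. - (p ^ j)) * (\<Prod>j<r. - (p ^ (N - j)))) * Z ^ r)
          * (qpoch a p r * qpoch b p r * qpoch c p r * qpoch d p r * qpoch e p r * qpoch h p r)
          / (qpoch p p r * qpoch (a * p / b) p r * qpoch (a * p / c) p r * qpoch (a * p / d) p r * qpoch (a * p / e) p r)
          * (1 / qpoch (a * p / h) p r)"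
    proof -
      have "qpoch p p N / qpoch p p (N - r) = qpoch h p r * (\<Prod>j<r. - (p ^ (N - j)))"
        unfolding h_def by (rule qpoch_self_ratio[OF p r])
      then show ?thesis
        by (simp only: ap) (simp add: mult_ac)
    qed
    also have "((\<Prod>j<r. - (p ^ j)) * (\<Prod>j<r. - (p ^ (N - j)))) * Z ^ r = (a ^ 2 * p ^ 2 / (b * c * d * e * h)) ^ r"
      unfolding s Z_def power_mult_distrib[symmetric] by (simp add: divide_inverse mult_ac)
    finally show ?thesis by simp
  qed
  have 2: "qpoch p p N * (qpoch d p j * qpoch e p j * qpoch w p (N - j) * w ^ j * qpoch (a * p / (b * c)) p j
          / (qpoch p p (N - j) * qpoch p p j * qpoch (a * p / b) p j * qpoch (a * p / c) p j))
      = qpoch d p j * qpoch e p j * qpoch h p j * (\<Prod>i<j. - (p ^ (N - i)))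
          * (qpoch w p (N - j) * w ^ j) * qpoch (a * p / (b * c)) p j
          / (qpoch p p j * qpoch (a * p / b) p j * qpoch (a * p / c) p j)" (is "?L = ?R") if j: "j \<le> N" for j
  proof -
    have "?L = (qpoch p p N / qpoch p p (N - j)) * (qpoch d p j * qpoch e p j * qpoch w p (N - j) * w ^ j * qpoch (a * p / (b * c)) p j)
          / (qpoch p p j * qpoch (a * p / b) p j * qpoch (a * p / c) p j)"
      by simp
    also have "qpoch p p N / qpoch p p (N - j) = qpoch h p j * (\<Prod>i<j. - (p ^ (N - i)))"
      unfolding h_def by (rule qpoch_self_ratio[OF p j])
    finally show ?thesis
      by (simp only: mult_ac)
  qed
  note W = watson_transformation[OF p(1) a b c d e, of N, folded w_def Z_def]
  have nz: "qpoch (a * p / d) p N * qpoch (a * p / e) p N \<noteq> 0"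
    using d(2) e(2) by simp
  have "X = Q * Y" if "qpoch (a * p / d) p N * qpoch (a * p / e) p N * T = U"
    "X = qpoch p p N * qpoch (a * p) p N * T" "Y = qpoch p p N * U" for X Y T U :: F
    unfolding that(2,3) that(1)[symmetric] Q_def using nz by simp
  note combine = this[OF W]
  show ?thesis
    unfolding Q_def[symmetric]
    by (rule combine, assumption, unfold sum_distrib_left, rule sum.cong[OF refl], rule 1, simp,
        rule sum.cong[OF refl], rule 2[symmetric], simp)
qed

text \<open>The deformed summand is kept as a product of three factors, so that its mixed difference
  in x and y is a product of two differences.\<close>

definition deform_const :: "nat \<Rightarrow> F" where
  "deform_const k = qint (6 * int k - 1) * (\<Prod>j<k. (1 - wq j) * ((1 - cv * wq j) * (1 - ev * wq j))
      / ((1 - zq j) * ((1 - zq j / cv) * (1 - zq j / ev))) * (qv ^ 9 / (cv * ev)))"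

definition deform_x :: "F \<Rightarrow> nat \<Rightarrow> F" where
  "deform_x x k = (\<Prod>j<k. ((1 - x * wq j) * (1 - wq j / x)) / ((1 - zq j / x) * (1 - zq j * x)))"

text \<open>Writing y - z instead of 1 - z/y absorbs the power y^(-k) that the deformation puts into
  the argument of the series.\<close>

definition deform_y :: "F \<Rightarrow> nat \<Rightarrow> F" where
  "deform_y y k = (\<Prod>j<k. (1 - y * wq j) / (y - zq j))"

lemma lhs_term_eq: "lhs_term k = deform_const k * deform_x 1 k * deform_y 1 k"
proof -
  have "\<rho> j = (1 - wq j) * ((1 - cv * wq j) * (1 - ev * wq j))
      / ((1 - zq j) * ((1 - zq j / cv) * (1 - zq j / ev))) * (qv ^ 9 / (cv * ev))
      * (((1 - 1 * wq j) * (1 - wq j / 1)) / ((1 - zq j / 1) * (1 - zq j * 1)))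
      * ((1 - 1 * wq j) / (1 - zq j))" for j
    unfolding \<rho>_def num_def den_def by (simp add: eval_nat_numeral mult_ac)
  then have "\<tau> k = (\<Prod>j<k. (1 - wq j) * ((1 - cv * wq j) * (1 - ev * wq j))
      / ((1 - zq j) * ((1 - zq j / cv) * (1 - zq j / ev))) * (qv ^ 9 / (cv * ev))) * deform_x 1 k * deform_y 1 k"
    unfolding \<tau>_def deform_x_def deform_y_def prod.distrib[symmetric] by (intro prod.cong refl)
  then show ?thesis
    by (simp only: lhs_term_def deform_const_def mult.assoc)
qed

lemma summand_qpoch:
  assumes "x \<noteq> 0" "y \<noteq> 0"
  shows "deform_const k * deform_x x k * deform_y y k = qint (6 * int k - 1) * (qv ^ 9 / (cv * ev * y)) ^ k
     * (qpoch (inverse qv) (qv ^ 3) k * qpoch (cv * inverse qv) (qv ^ 3) k * qpoch (ev * inverse qv) (qv ^ 3) k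
        * qpoch (x * inverse qv) (qv ^ 3) k * qpoch (inverse x * inverse qv) (qv ^ 3) k * qpoch (y * inverse qv) (qv ^ 3) k)
     / (qpoch (qv ^ 3) (qv ^ 3) k * qpoch (qv ^ 3 / cv) (qv ^ 3) k * qpoch (qv ^ 3 / ev) (qv ^ 3) k
        * qpoch (qv ^ 3 / x) (qv ^ 3) k * qpoch (qv ^ 3 * x) (qv ^ 3) k * qpoch (qv ^ 3 / y) (qv ^ 3) k)"
proof -
  define \<kappa> where "\<kappa> = qv ^ 9 / (cv * ev)"
  have "y - zq j = y * (1 - zq j / y)" for j
    using assms(2) by (simp add: field_simps)
  then have g: "deform_y y k = (\<Prod>j<k. 1 - y * wq j) / (y ^ k * (\<Prod>j<k. 1 - zq j / y))"
    by (simp add: deform_y_def prod_dividef prod.distrib)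
  have f: "deform_x x k = (\<Prod>j<k. 1 - x * wq j) * (\<Prod>j<k. 1 - inverse x * wq j)
      / ((\<Prod>j<k. 1 - zq j / x) * (\<Prod>j<k. 1 - zq j * x))"
  proof -
    have "inverse x * wq j = wq j / x" for j
      by (simp add: divide_inverse mult.commute)
    then show ?thesis
      by (simp only: deform_x_def prod_dividef prod.distrib)
  qed
  have a: "deform_const k = qint (6 * int k - 1) * ((\<Prod>j<k. 1 - wq j) * ((\<Prod>j<k. 1 - cv * wq j) * (\<Prod>j<k. 1 - ev * wq j))
      / ((\<Prod>j<k. 1 - zq j) * ((\<Prod>j<k. 1 - zq j / cv) * (\<Prod>j<k. 1 - zq j / ev))) * \<kappa> ^ k)"
    unfolding deform_const_def \<kappa>_def[symmetric] by (simp add: prod_dividef prod.distrib)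
  have "(qv ^ 9 / (cv * ev * y)) ^ k = \<kappa> ^ k / y ^ k"
    by (simp add: \<kappa>_def power_divide power_mult_distrib)
  then show ?thesis
    unfolding qpoch_wq qpoch_wq1 qpoch_zq qpoch_zq' qpoch_zq1 a f g by (simp add: mult_ac)
qed


text \<open>The right-hand side of Watson's transformation, as a function of the two parameters in
  which the sum is deformed. The factors \<open>qpoch v (qv ^ 3) (N - j)\<close> replace a quotient whose denominator
  may vanish modulo \<open>\<Phi>\<^sub>n\<close> when \<open>n = 2\<close>.\<close>

definition watson_rhs :: "nat \<Rightarrow> F \<Rightarrow> F \<Rightarrow> F" where
  "watson_rhs N x y = (\<Sum>j\<le>N. qpoch (x * inverse qv) (qv ^ 3) j * qpoch (inverse x * inverse qv) (qv ^ 3) j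
      * qpoch (y * inverse qv) (qv ^ 3) j * (\<Prod>i<j. - ((qv ^ 3) ^ (N - i)))
      * (qpoch (qv powi (5 - 3 * int N) / y) (qv ^ 3) (N - j) * (qv powi (5 - 3 * int N) / y) ^ j)
      * qpoch (qv ^ 4 / (cv * ev)) (qv ^ 3) j
      / (qpoch (qv ^ 3) (qv ^ 3) j * qpoch (qv ^ 3 / cv) (qv ^ 3) j * qpoch (qv ^ 3 / ev) (qv ^ 3) j))"

lemma cube_power_neq_1: "k > 0 \<Longrightarrow> (qv ^ 3) ^ k \<noteq> 1"
  using qv_power_neq_1[of "3 * k"] by (simp add: power_mult)

lemma qpoch_powi_nonzero:
  assumes "\<And>j. j < m \<Longrightarrow> 3 * int j + a \<noteq> 0"
  shows "qpoch (qv powi a) (qv ^ 3) m \<noteq> 0"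
  unfolding qpoch_powi using one_minus_qv_powi_nonzero assms by auto

lemma qpoch_cv_nonzero: "qpoch (qv ^ 3 / cv) (qv ^ 3) m \<noteq> 0"
  and qpoch_ev_nonzero: "qpoch (qv ^ 3 / ev) (qv ^ 3) m \<noteq> 0"
  using aunit_one_minus_cv[of 1, THEN aunit_nonzero] aunit_one_minus_ev[of 1, THEN aunit_nonzero]
  by (auto simp: qpoch_zq zq_power)

text \<open>Base q^3 and a = 1/q, with c/q and e/q as first pair. \<open>D\<close>,
  \<open>E\<close>, \<open>H\<close> stay free since the terminating parameter differs between the
  two uses. The factor -1/q comes from (1 - q^(6k-1))/(1 - 1/q) = - q [6k-1].\<close>

lemma watson_specialised:
  fixes D E H :: F
  assumes H: "H = inverse ((qv ^ 3) ^ N)"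
    and D: "D \<noteq> 0" "\<And>m. qpoch (qv ^ 2 / D) (qv ^ 3) m \<noteq> 0"
    and E: "E \<noteq> 0" "\<And>m. qpoch (qv ^ 2 / E) (qv ^ 3) m \<noteq> 0"
  shows "(\<Sum>k\<le>N. qint (6 * int k - 1) * (qv ^ 6 / (cv * ev * (D * E * H))) ^ k
     * (qpoch (inverse qv) (qv ^ 3) k * qpoch (cv * inverse qv) (qv ^ 3) k * qpoch (ev * inverse qv) (qv ^ 3) k
        * qpoch D (qv ^ 3) k * qpoch E (qv ^ 3) k * qpoch H (qv ^ 3) k)
     / (qpoch (qv ^ 3) (qv ^ 3) k * qpoch (qv ^ 3 / cv) (qv ^ 3) k * qpoch (qv ^ 3 / ev) (qv ^ 3) k
        * qpoch (qv ^ 2 / D) (qv ^ 3) k * qpoch (qv ^ 2 / E) (qv ^ 3) k * qpoch (qv ^ 2 / H) (qv ^ 3) k))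
   = - inverse qv * (qpoch (qv ^ 2) (qv ^ 3) N / (qpoch (qv ^ 2 / D) (qv ^ 3) N * qpoch (qv ^ 2 / E) (qv ^ 3) N)) *
     (\<Sum>j\<le>N. qpoch D (qv ^ 3) j * qpoch E (qv ^ 3) j * qpoch H (qv ^ 3) j * (\<Prod>i<j. - ((qv ^ 3) ^ (N - i)))
      * (qpoch (qv ^ 2 / (D * E)) (qv ^ 3) (N - j) * (qv ^ 2 / (D * E)) ^ j)
      * qpoch (qv ^ 4 / (cv * ev)) (qv ^ 3) j
      / (qpoch (qv ^ 3) (qv ^ 3) j * qpoch (qv ^ 3 / cv) (qv ^ 3) j * qpoch (qv ^ 3 / ev) (qv ^ 3) j))"
proof -
  have ap: "inverse qv * qv ^ 3 = qv ^ 2" "qv ^ 2 / (cv * inverse qv) = qv ^ 3 / cv"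
    "qv ^ 2 / (ev * inverse qv) = qv ^ 3 / ev"
    "qv ^ 2 / (cv * inverse qv * (ev * inverse qv)) = qv ^ 4 / (cv * ev)"
    by (simp_all add: field_simps eval_nat_numeral)
  have arg: "(inverse qv)\<^sup>2 * (qv ^ 3)\<^sup>2 / (cv * inverse qv * (ev * inverse qv) * D * E * H)
      = qv ^ 6 / (cv * ev * (D * E * H))"
    by (simp add: field_simps eval_nat_numeral)
  have coef: "(1 - inverse qv * (qv ^ 3) ^ (2 * k)) / (1 - inverse qv) = - qv * qint (6 * int k - 1)" for k
  proof -
    have "inverse qv * (qv ^ 3) ^ (2 * k) = qv powi (6 * int k - 1)"
      using powi_shift[of "- 1" "2 * k"] by simp
    moreover have "(1 - X) / (1 - inverse qv) = - qv * ((1 - X) / (1 - qv))" for X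
      using qv_power_neq_1[of 1] by (simp add: field_simps)
    ultimately show ?thesis by (simp add: qint_def)
  qed
  have "qpoch (qv ^ 2) (qv ^ 3) m \<noteq> 0" for m
    using qpoch_powi_nonzero[of m 2] by simp
  note W = watson_transformation_classical[OF cube_power_neq_1 _ _ _ _ _ _ _ D(1) _ E(1),
      of "inverse qv" "cv * inverse qv" "ev * inverse qv" N, folded H, unfolded ap arg coef]
  have "- qv * (\<Sum>k\<le>N. qint (6 * int k - 1) * (qv ^ 6 / (cv * ev * (D * E * H))) ^ k
     * (qpoch (inverse qv) (qv ^ 3) k * qpoch (cv * inverse qv) (qv ^ 3) k * qpoch (ev * inverse qv) (qv ^ 3) k
        * qpoch D (qv ^ 3) k * qpoch E (qv ^ 3) k * qpoch H (qv ^ 3) k)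
     / (qpoch (qv ^ 3) (qv ^ 3) k * qpoch (qv ^ 3 / cv) (qv ^ 3) k * qpoch (qv ^ 3 / ev) (qv ^ 3) k
        * qpoch (qv ^ 2 / D) (qv ^ 3) k * qpoch (qv ^ 2 / E) (qv ^ 3) k * qpoch (qv ^ 2 / H) (qv ^ 3) k))
   = qpoch (qv ^ 2) (qv ^ 3) N / (qpoch (qv ^ 2 / D) (qv ^ 3) N * qpoch (qv ^ 2 / E) (qv ^ 3) N) *
     (\<Sum>j\<le>N. qpoch D (qv ^ 3) j * qpoch E (qv ^ 3) j * qpoch H (qv ^ 3) j * (\<Prod>i<j. - ((qv ^ 3) ^ (N - i)))
      * (qpoch (qv ^ 2 / (D * E)) (qv ^ 3) (N - j) * (qv ^ 2 / (D * E)) ^ j)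
      * qpoch (qv ^ 4 / (cv * ev)) (qv ^ 3) j
      / (qpoch (qv ^ 3) (qv ^ 3) j * qpoch (qv ^ 3 / cv) (qv ^ 3) j * qpoch (qv ^ 3 / ev) (qv ^ 3) j))"
    (is "_ * ?S = ?R")
  proof (subst W[symmetric])
    show "inverse qv \<noteq> 1" using qv_power_neq_1[of 1] by (simp add: inverse_eq_1_iff)
  qed (use qpoch_cv_nonzero qpoch_ev_nonzero D(2) E(2) \<open>\<And>m. qpoch (qv ^ 2) (qv ^ 3) m \<noteq> 0\<close> in
      \<open>auto simp: sum_distrib_left intro!: sum.cong\<close>)
  moreover have "S = - inverse qv * R" if "- qv * S = R" for S R :: F
    using that by auto
  ultimately have "?S = - inverse qv * ?R" by blast
  then show ?thesis by (simp only: mult.assoc)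
qed

lemma qv_powi_add: "qv powi a * qv powi b = qv powi (a + b)"
  by (simp add: power_int_add)

lemma inverse_cube_power: "inverse ((qv ^ 3) ^ N) = qv powi (- (3 * int N))"
  using powi_shift[of 0 N] by (simp add: power_int_minus)

text \<open>Here 1/(x q) = q^(-3N) terminates the series; x/q and the undeformed 1/q play the roles
  of \<open>D\<close> and \<open>E\<close>.\<close>

lemma deformed_sum_x:
  assumes x: "x = qv powi (3 * int N - 1)"
  shows "(\<Sum>k\<le>N. deform_const k * deform_x x k * deform_y 1 k) = - inverse qv *
     (qpoch (qv ^ 2) (qv ^ 3) N / (qpoch (qv ^ 3 / x) (qv ^ 3) N * qpoch (qv ^ 3) (qv ^ 3) N)) * watson_rhs N x 1"
proof -
  have x0: "x \<noteq> 0" by (simp add: x)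
  have H: "inverse x * inverse qv = inverse ((qv ^ 3) ^ N)"
  proof -
    have "inverse x * inverse qv = qv powi (- (3 * int N - 1)) * qv powi (- 1)"
      unfolding x power_int_minus by simp
    then show ?thesis
      unfolding inverse_cube_power qv_powi_add by simp
  qed
  have D: "qv\<^sup>2 / (x * inverse qv) = qv ^ 3 / x" "qv\<^sup>2 / inverse qv = qv ^ 3"
    "qv\<^sup>2 / (inverse x * inverse qv) = qv ^ 3 * x"
    "qv ^ 6 / (cv * ev * (x * inverse qv * inverse qv * (inverse x * inverse qv))) = qv ^ 9 / (cv * ev)"
    using x0 by (simp_all add: field_simps eval_nat_numeral)
  have v: "qv\<^sup>2 / (x * inverse qv * inverse qv) = qv powi (5 - 3 * int N)"
  proof -
    have "qv powi 5 = qv powi (5 - 3 * int N) * qv powi (3 * int N - 1) * qv"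
      using qv_powi_add[of "5 - 3 * int N" "3 * int N - 1"] by (simp add: eval_nat_numeral)
    then show ?thesis
      unfolding x by (simp add: field_simps eval_nat_numeral)
  qed
  have nz1: "qpoch (qv ^ 3 / x) (qv ^ 3) m \<noteq> 0" for m
  proof -
    have "qv ^ 3 / x = qv powi (3 - (3 * int N - 1))"
      unfolding x by (subst power_int_diff) auto
    moreover have "3 * int j + (3 - (3 * int N - 1)) \<noteq> 0" for j by presburger
    ultimately show ?thesis using qpoch_powi_nonzero by simp
  qed
  have nz2: "qpoch (qv ^ 3) (qv ^ 3) m \<noteq> 0" for m
    using qpoch_self_nonzero[OF cube_power_neq_1] .
  note W = watson_specialised[of "inverse x * inverse qv" N "x * inverse qv" "inverse qv", OF H, unfolded D v]
  have "(\<Sum>k\<le>N. deform_const k * deform_x x k * deform_y 1 k) = (\<Sum>k\<le>N. qint (6 * int k - 1) * (qv ^ 9 / (cv * ev)) ^ k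
     * (qpoch (inverse qv) (qv ^ 3) k * qpoch (cv * inverse qv) (qv ^ 3) k * qpoch (ev * inverse qv) (qv ^ 3) k
        * qpoch (x * inverse qv) (qv ^ 3) k * qpoch (inverse qv) (qv ^ 3) k * qpoch (inverse x * inverse qv) (qv ^ 3) k)
     / (qpoch (qv ^ 3) (qv ^ 3) k * qpoch (qv ^ 3 / cv) (qv ^ 3) k * qpoch (qv ^ 3 / ev) (qv ^ 3) k
        * qpoch (qv ^ 3 / x) (qv ^ 3) k * qpoch (qv ^ 3) (qv ^ 3) k * qpoch (qv ^ 3 * x) (qv ^ 3) k))"
    unfolding summand_qpoch[OF x0 one_neq_zero] by (simp add: mult_ac)
  also have "\<dots> = - inverse qv *
     (qpoch (qv ^ 2) (qv ^ 3) N / (qpoch (qv ^ 3 / x) (qv ^ 3) N * qpoch (qv ^ 3) (qv ^ 3) N)) * watson_rhs N x 1"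
    using x0 nz1 nz2 by (subst W) (simp_all add: watson_rhs_def mult_ac)
  finally show ?thesis .
qed

text \<open>Here y/q terminates the series, with x/q and 1/(x q) as \<open>D\<close> and
  \<open>E\<close>. Thus x remains free and may be taken as q^n or as 1.\<close>

lemma deformed_sum_y:
  assumes y: "y = qv powi (1 - 3 * int N)" and x: "x \<noteq> 0" "\<And>m. qpoch (qv ^ 3 / x) (qv ^ 3) m \<noteq> 0"
    "\<And>m. qpoch (qv ^ 3 * x) (qv ^ 3) m \<noteq> 0"
  shows "(\<Sum>k\<le>N. deform_const k * deform_x x k * deform_y y k) = - inverse qv *
     (qpoch (qv ^ 2) (qv ^ 3) N / (qpoch (qv ^ 3 / x) (qv ^ 3) N * qpoch (qv ^ 3 * x) (qv ^ 3) N)) * watson_rhs N x y"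
proof -
  have y0: "y \<noteq> 0" by (simp add: y)
  have H: "y * inverse qv = inverse ((qv ^ 3) ^ N)"
  proof -
    have "y * inverse qv = qv powi (1 - 3 * int N) * qv powi (- 1)" by (simp add: y)
    then show ?thesis
      unfolding inverse_cube_power qv_powi_add by simp
  qed
  have D: "qv\<^sup>2 / (x * inverse qv) = qv ^ 3 / x" "qv\<^sup>2 / (inverse x * inverse qv) = qv ^ 3 * x"
    "qv\<^sup>2 / (y * inverse qv) = qv ^ 3 / y"
    "qv ^ 6 / (cv * ev * (x * inverse qv * (inverse x * inverse qv) * (y * inverse qv))) = qv ^ 9 / (cv * ev * y)"
    using x(1) y0 by (simp_all add: field_simps eval_nat_numeral)
  have v: "qv\<^sup>2 / (x * inverse qv * (inverse x * inverse qv)) = qv powi (5 - 3 * int N) / y"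
  proof -
    have "qv powi (5 - 3 * int N) = qv powi 4 * y"
      unfolding y qv_powi_add by simp
    then show ?thesis
      using x(1) y0 by (simp add: field_simps eval_nat_numeral)
  qed
  note W = watson_specialised[of "y * inverse qv" N "x * inverse qv" "inverse x * inverse qv", OF H, unfolded D v]
  have "(\<Sum>k\<le>N. deform_const k * deform_x x k * deform_y y k) = (\<Sum>k\<le>N. qint (6 * int k - 1) * (qv ^ 9 / (cv * ev * y)) ^ k
     * (qpoch (inverse qv) (qv ^ 3) k * qpoch (cv * inverse qv) (qv ^ 3) k * qpoch (ev * inverse qv) (qv ^ 3) k
        * qpoch (x * inverse qv) (qv ^ 3) k * qpoch (inverse x * inverse qv) (qv ^ 3) k * qpoch (y * inverse qv) (qv ^ 3) k)
     / (qpoch (qv ^ 3) (qv ^ 3) k * qpoch (qv ^ 3 / cv) (qv ^ 3) k * qpoch (qv ^ 3 / ev) (qv ^ 3) k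
        * qpoch (qv ^ 3 / x) (qv ^ 3) k * qpoch (qv ^ 3 * x) (qv ^ 3) k * qpoch (qv ^ 3 / y) (qv ^ 3) k))"
    unfolding summand_qpoch[OF x(1) y0] ..
  also have "\<dots> = - inverse qv *
     (qpoch (qv ^ 2) (qv ^ 3) N / (qpoch (qv ^ 3 / x) (qv ^ 3) N * qpoch (qv ^ 3 * x) (qv ^ 3) N)) * watson_rhs N x y"
    using x by (subst W) (simp_all add: watson_rhs_def)
  finally show ?thesis .
qed

section \<open>Identification of Watson's side with the stated one\<close>

lemma qpoch_inverse_square: "qpoch (inverse (qv\<^sup>2)) (qv ^ 3) k = (\<Prod>j<k. 1 - qv powi (3 * int j - 2))"
  using qpoch_powi[of "- 2" k] by (simp add: power_int_minus)

lemma one_minus_powi_flip: "1 - qv powi m = - (qv powi m) * (1 - qv powi (- m))"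
  using one_minus_powi_minus[of "- m"] by simp

lemma prod_lessThan_add: "(\<Prod>i<k + m. f i) = (\<Prod>i<k. f i) * (\<Prod>i<m. f (k + i :: nat) :: F)"
  by (induction m) (simp_all add: mult.assoc)

lemma qpoch_reflect:
  "qpoch (qv powi (5 - 3 * int N)) (qv ^ 3) m
    = (\<Prod>i<m. - (qv powi (2 - 3 * (int N - int m + int i))) * (1 - qv powi (3 * (int N - int m + int i) - 2)))"
proof -
  have "qpoch (qv powi (5 - 3 * int N)) (qv ^ 3) m = (\<Prod>i<m. 1 - qv powi (3 * int (m - Suc i) + (5 - 3 * int N)))"
    unfolding qpoch_powi by (rule prod.nat_diff_reindex[symmetric])
  also have "\<dots> = (\<Prod>i<m. - (qv powi (2 - 3 * (int N - int m + int i))) * (1 - qv powi (3 * (int N - int m + int i) - 2)))"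
  proof (intro prod.cong refl)
    fix i assume "i \<in> {..<m}"
    then have e: "3 * int (m - Suc i) + (5 - 3 * int N) = 2 - 3 * (int N - int m + int i)"
      by (simp add: of_nat_diff algebra_simps)
    show "1 - qv powi (3 * int (m - Suc i) + (5 - 3 * int N))
      = - (qv powi (2 - 3 * (int N - int m + int i))) * (1 - qv powi (3 * (int N - int m + int i) - 2))"
      unfolding e by (subst one_minus_powi_flip) simp
  qed
  finally show ?thesis .
qed

text \<open>Read backwards, the factors of (q^(5-3N); q^3)_(N-k) are, up to monomials, those of
  (q^(-2); q^3) with indices k, ..., N - 1. The monomials combine to q^(3k) times a quantity
  independent of \<open>k\<close>.\<close>

lemma watson_rhs_coefficient:
  assumes "k \<le> N"
  shows "(\<Prod>i<k. - ((qv ^ 3) ^ (N - i))) * (qpoch (qv powi (5 - 3 * int N)) (qv ^ 3) (N - k) * (qv powi (5 - 3 * int N)) ^ k)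
    = qv ^ (3 * k) * (\<Prod>i<N. - (qv powi (2 - 3 * int i)))
      * (qpoch (inverse (qv\<^sup>2)) (qv ^ 3) N / qpoch (inverse (qv\<^sup>2)) (qv ^ 3) k)"
proof -
  define m where "m = N - k"
  have N: "N = k + m" using assms by (simp add: m_def)
  have nz: "qpoch (inverse (qv\<^sup>2)) (qv ^ 3) k \<noteq> 0"
    unfolding qpoch_inverse_square
  proof (simp only: prod_zero_iff finite_lessThan, clarify)
    fix j :: nat
    have "3 * int j - 2 \<noteq> 0" by presburger
    then show "1 - qv powi (3 * int j - 2) = 0 \<Longrightarrow> False"
      using one_minus_qv_powi_nonzero by blast
  qed
  have 1: "(\<Prod>i<k. - ((qv ^ 3) ^ (N - i))) * (qv powi (5 - 3 * int N)) ^ k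
      = qv ^ (3 * k) * (\<Prod>i<k. - (qv powi (2 - 3 * int i)))"
  proof -
    have "- ((qv ^ 3) ^ (N - i)) * qv powi (5 - 3 * int N) = qv ^ 3 * - (qv powi (2 - 3 * int i))" if "i < k" for i
    proof -
      have "qv powi (5 - 3 * int N) * (qv ^ 3) ^ (N - i) = qv powi 3 * qv powi (2 - 3 * int i)"
        unfolding powi_shift qv_powi_add using that assms by (simp add: of_nat_diff)
      then show ?thesis by (simp add: mult.commute)
    qed
    then have "(\<Prod>i<k. - ((qv ^ 3) ^ (N - i)) * qv powi (5 - 3 * int N)) = (\<Prod>i<k. qv ^ 3 * - (qv powi (2 - 3 * int i)))"
      by (intro prod.cong) auto
    then show ?thesis
      by (simp only: prod.distrib prod_constant card_lessThan power_mult)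
  qed
  have 2: "qpoch (qv powi (5 - 3 * int N)) (qv ^ 3) m
      = (\<Prod>i<m. - (qv powi (2 - 3 * int (k + i)))) * (\<Prod>i<m. 1 - qv powi (3 * int (k + i) - 2))"
    unfolding qpoch_reflect prod.distrib[symmetric] by (simp add: N)
  have 3: "qpoch (inverse (qv\<^sup>2)) (qv ^ 3) N / qpoch (inverse (qv\<^sup>2)) (qv ^ 3) k
      = (\<Prod>i<m. 1 - qv powi (3 * int (k + i) - 2))"
    using nz unfolding qpoch_inverse_square N prod_lessThan_add by simp
  have 4: "(\<Prod>i<N. - (qv powi (2 - 3 * int i)))
      = (\<Prod>i<k. - (qv powi (2 - 3 * int i))) * (\<Prod>i<m. - (qv powi (2 - 3 * int (k + i))))"
    unfolding N by (rule prod_lessThan_add)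
  have "(\<Prod>i<k. - ((qv ^ 3) ^ (N - i))) * (qpoch (qv powi (5 - 3 * int N)) (qv ^ 3) m * (qv powi (5 - 3 * int N)) ^ k)
    = ((\<Prod>i<k. - ((qv ^ 3) ^ (N - i))) * (qv powi (5 - 3 * int N)) ^ k) * qpoch (qv powi (5 - 3 * int N)) (qv ^ 3) m"
    by (simp only: mult_ac)
  then show ?thesis
    unfolding 1 2 3 4 m_def[symmetric] by (simp only: mult_ac)
qed

text \<open>Up to monomials the reversed (q^(4-3N); q^3)_N is \<open>B\<close>, that is (1/q;
  q^3)_N. The symbol (q^2; q^3)_N is \<open>B\<close> shifted by one index: it loses 1 - 1/q and
  gains 1 - q^n, which produces [n].\<close>

lemma prefactor_eq:
  assumes n: "3 * N = n + 1"
  shows "- inverse qv * (qpoch (qv ^ 2) (qv ^ 3) N / (qpoch (qv powi (4 - 3 * int N)) (qv ^ 3) N * qpoch (qv ^ 3) (qv ^ 3) N))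
      * (\<Prod>i<N. - (qv powi (2 - 3 * int i)))
    = qint (int n) * qv ^ N / qpoch (qv ^ 3) (qv ^ 3) N"
proof -
  define B where "B = (\<Prod>i<N. 1 - qv powi (3 * int i - 1))"
  define \<sigma> where "\<sigma> = (\<Prod>i<N. - (qv powi (1 - 3 * int i)))"
  have B0: "B \<noteq> 0"
  proof -
    have "3 * int i - 1 \<noteq> 0" for i by presburger
    then show ?thesis using one_minus_qv_powi_nonzero by (auto simp: B_def)
  qed
  have \<sigma>0: "\<sigma> \<noteq> 0" by (simp add: \<sigma>_def)
  have 1: "qpoch (qv powi (4 - 3 * int N)) (qv ^ 3) N = \<sigma> * B"
  proof -
    have "qpoch (qv powi (4 - 3 * int N)) (qv ^ 3) N = (\<Prod>i<N. 1 - qv powi (3 * int (N - Suc i) + (4 - 3 * int N)))"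
      unfolding qpoch_powi by (rule prod.nat_diff_reindex[symmetric])
    also have "\<dots> = (\<Prod>i<N. - (qv powi (1 - 3 * int i)) * (1 - qv powi (3 * int i - 1)))"
    proof (intro prod.cong refl)
      fix i assume "i \<in> {..<N}"
      then have e: "3 * int (N - Suc i) + (4 - 3 * int N) = 1 - 3 * int i"
        by (simp add: of_nat_diff algebra_simps)
      show "1 - qv powi (3 * int (N - Suc i) + (4 - 3 * int N)) = - (qv powi (1 - 3 * int i)) * (1 - qv powi (3 * int i - 1))"
        unfolding e by (subst one_minus_powi_flip) simp
    qed
    finally show ?thesis by (simp only: prod.distrib \<sigma>_def B_def)
  qed
  have 2: "(\<Prod>i<N. - (qv powi (2 - 3 * int i))) = qv ^ N * \<sigma>"
  proof -
    have "- (qv powi (2 - 3 * int i)) = qv * - (qv powi (1 - 3 * int i))" for i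
      using qv_powi_add[of 1 "1 - 3 * int i"] by simp
    then show ?thesis by (simp only: prod.distrib prod_constant card_lessThan \<sigma>_def)
  qed
  have 3: "qpoch (qv ^ 2) (qv ^ 3) N = - (qint (int n) * qv * B)"
  proof -
    obtain m where m: "N = Suc m" using n by (cases N) auto
    have "qpoch (qv ^ 2) (qv ^ 3) N = (\<Prod>i<N. 1 - qv powi (3 * int i + 2))"
      using qpoch_powi[of 2 N] by simp
    also have "\<dots> = (\<Prod>i<m. 1 - qv powi (3 * int i + 2)) * (1 - qv powi int n)"
    proof -
      have "3 * int m + 2 = int n" using n by (simp add: m)
      then show ?thesis by (simp only: m prod.lessThan_Suc)
    qed
    finally have P: "qpoch (qv ^ 2) (qv ^ 3) N = (\<Prod>i<m. 1 - qv powi (3 * int i + 2)) * (1 - qv powi int n)" .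
    have B: "B = (1 - inverse qv) * (\<Prod>i<m. 1 - qv powi (3 * int i + 2))"
      unfolding B_def m prod.lessThan_Suc_shift by (simp add: algebra_simps)
    have "qv * (1 - inverse qv) = - (1 - qv)"
      by (simp add: right_diff_distrib)
    then have "qv * B = - (1 - qv) * (\<Prod>i<m. 1 - qv powi (3 * int i + 2))"
      by (simp only: B mult.assoc[symmetric])
    moreover have "1 - qv \<noteq> 0" using qv_power_neq_1[of 1] by simp
    ultimately have "qv * B / (1 - qv) = - (\<Prod>i<m. 1 - qv powi (3 * int i + 2))"
      by (simp add: field_simps)
    moreover have "qint (int n) * qv * B = (1 - qv powi int n) * (qv * B / (1 - qv))"
      by (simp add: qint_def)
    ultimately show ?thesis
      unfolding P by simp
  qed
  show ?thesis
    unfolding 1 2 3 using B0 \<sigma>0 by simp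
qed

section \<open>The congruence modulo the fourth power\<close>

text \<open>Logarithmic derivatives add under products, up to terms in \<epsilon>^2. It is applied
  with order 2 in x and order 1 in y.\<close>

lemma adic_prod_first_order:
  fixes k :: nat
  assumes "adic P s \<epsilon>"
    and "\<And>j. j < k \<Longrightarrow> adic P (2 * s) (f j - g j * (1 + \<epsilon> * l j))"
    and "\<And>j. j < k \<Longrightarrow> adic P 0 (f j)" "\<And>j. j < k \<Longrightarrow> adic P 0 (g j)" "\<And>j. j < k \<Longrightarrow> adic P 0 (l j)"
  shows "adic P (2 * s) ((\<Prod>j<k. f j) - (\<Prod>j<k. g j) * (1 + \<epsilon> * (\<Sum>j<k. l j)))"
  using assms(2-)
proof (induction k)
  case (Suc k)
  define p r t where "p = (\<Prod>j<k. f j)" "r = (\<Prod>j<k. g j)" "t = (\<Sum>j<k. l j)"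
  have \<epsilon>: "adic P 0 \<epsilon>" "adic P (2 * s) (\<epsilon> * \<epsilon>)"
    using assms(1) adic_mono[OF assms(1)] adic_mult[OF assms(1) assms(1)] by (auto simp: mult_2)
  have rt: "adic P 0 r" "adic P 0 t"
    unfolding p_r_t_def using Suc.prems by (auto intro!: adic_prod adic_sum)
  have "p * f k - r * g k * (1 + \<epsilon> * (t + l k))
     = (p - r * (1 + \<epsilon> * t)) * f k + r * (1 + \<epsilon> * t) * (f k - g k * (1 + \<epsilon> * l k)) + r * g k * t * l k * (\<epsilon> * \<epsilon>)"
    by (simp add: algebra_simps)
  moreover have "adic P (2 * s) ((p - r * (1 + \<epsilon> * t)) * f k)"
    unfolding p_r_t_def using Suc by (intro adic_mult_right) auto
  moreover have "adic P (2 * s) (r * (1 + \<epsilon> * t) * (f k - g k * (1 + \<epsilon> * l k)))"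
    using rt \<epsilon>(1) Suc.prems by (intro adic_mult_left adic_add adic_one) auto
  moreover have "adic P (2 * s) (r * g k * t * l k * (\<epsilon> * \<epsilon>))"
    using rt Suc.prems by (intro adic_mult_left[OF _ \<epsilon>(2)] adic_mult_left[of P _ 0]) auto
  ultimately show ?case
    by (simp add: p_r_t_def adic_add)
qed simp

text \<open>\<open>Ka\<close>, \<open>Kb\<close>, \<open>K0\<close> are the prefactors of Watson's
  transformation at the three points, the \<open>G\<close> its sums. Eliminating \<open>Gx1\<close>
  through the mixed difference leaves \<open>Ka * G11\<close> and \<open>(K0 - Kb) * G1y\<close>;
  the latter is - u s K0 G1y to first order, whence the minus sign in the theorem.\<close>

lemma adic_combination:
  assumes "adic P 1 Ka" "adic P 1 K0" "adic P 2 (Ka - Kb)" "adic P 2 (Ka - K0)"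
    and "adic P 4 (Kb - K0 * (1 + u * s))" "adic P 2 \<epsilon>" "adic P 3 (u * s - \<epsilon>)"
    and "adic P 0 G1y" "adic P 0 G11" "adic P 2 (Gxy - G1y)" "adic P 1 (G11 - G1y)"
    and "adic P 3 (Gx1 - Gxy - G11 + G1y)"
  shows "adic P 4 (Ka * Gx1 - Kb * Gxy + K0 * G1y - Ka * G11 * (1 - \<epsilon>))"
proof -
  have "adic P (1 + 3) (Ka * (Gx1 - Gxy - G11 + G1y))"
    by (rule adic_mult[OF assms(1,12)])
  moreover have "adic P (2 + 2) ((Ka - Kb) * (Gxy - G1y))"
    by (rule adic_mult[OF assms(3,10)])
  moreover have "adic P (4 + 0) ((Kb - K0 * (1 + u * s)) * G1y)"
    by (rule adic_mult[OF assms(5,8)])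
  moreover have "adic P (1 + 3 + 0) (K0 * (u * s - \<epsilon>) * G1y)"
    by (rule adic_mult[OF adic_mult[OF assms(2,7)] assms(8)])
  moreover have "adic P (2 + (2 + 0)) (\<epsilon> * ((Ka - K0) * G11 + K0 * (G11 - G1y)))"
    using adic_mult[OF assms(4,9)] adic_mult[OF assms(2,11)]
    by (intro adic_mult[OF assms(6)] adic_add) (auto simp: numeral_2_eq_2)
  ultimately have "adic P 4 (Ka * (Gx1 - Gxy - G11 + G1y) + (Ka - Kb) * (Gxy - G1y)
      - (Kb - K0 * (1 + u * s)) * G1y - K0 * (u * s - \<epsilon>) * G1y
      + \<epsilon> * ((Ka - K0) * G11 + K0 * (G11 - G1y)))"
    by (intro adic_add adic_diff) simp_all
  then show ?thesis
    by (simp add: algebra_simps)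
qed

locale top_modulus = inverse_of_three +
  assumes top: "3 * d1 = d + 1"
begin

definition x1 :: F where "x1 = qv powi (3 * int d1 - 1)"
definition y1 :: F where "y1 = qv powi (1 - 3 * int d1)"
text \<open>This is x1 + 1/x1 - 2, the variable through which the deformation in x enters.\<close>

definition u :: F where "u = (1 - x1)\<^sup>2 / x1"

lemma x1_eq: "x1 = qv powi int d"
proof -
  have "3 * int d1 - 1 = int d"
    using arg_cong[OF top, of int] by simp
  then show ?thesis by (simp only: x1_def)
qed

lemma y1_eq: "y1 = inverse x1"
  unfolding x1_def y1_def power_int_minus[symmetric] by simp

lemma aunit_x1: "aunit \<Phi> x1" and aunit_y1: "aunit \<Phi> y1"
  unfolding x1_def y1_def by (rule aunit_qv_powi[OF d_pos])+

lemma x1_nonzero [simp]: "x1 \<noteq> 0" and y1_nonzero [simp]: "y1 \<noteq> 0"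
  by (simp_all add: x1_def y1_def)

lemma adic_x1: "adic \<Phi> 1 (1 - x1)"
  unfolding x1_eq by (rule adic_one_minus_qv_powi[OF d_pos]) simp

lemma adic_y1: "adic \<Phi> 1 (y1 - 1)"
proof -
  have "y1 - 1 = (1 - x1) / x1" by (simp add: y1_eq field_simps)
  then show ?thesis using adic_divide[OF adic_x1 aunit_x1] by simp
qed

lemma adic_u: "adic \<Phi> 2 u"
  unfolding u_def using adic_power[OF adic_x1, of 2] by (intro adic_divide aunit_x1) simp

lemma aunit_small: assumes "j < d1" shows "aunit \<Phi> (1 - wq j)" "aunit \<Phi> (1 - zq j)"
proof -
  have "j mod d = j" using assms d1(1) by simp
  then show "aunit \<Phi> (1 - wq j)" "aunit \<Phi> (1 - zq j)"
    using assms d1(1) aunit_one_minus_wq[of j] aunit_one_minus_zq[of j] by auto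
qed

lemma aunit_small_x1:
  assumes "j < d1"
  shows "aunit \<Phi> (1 - zq j * x1)" "aunit \<Phi> (1 - zq j / x1)" "aunit \<Phi> (y1 - zq j)"
proof -
  have nd: "\<not> int d dvd 3 * int j + 3" using assms d1(1) by (simp add: dvd_zq_iff)
  have "zq j * x1 = qv powi (3 * int j + 3 + int d)" "zq j / x1 = qv powi (3 * int j + 3 - int d)"
    unfolding x1_eq zq_def by (simp_all add: power_int_add power_int_diff)
  moreover have "\<not> int d dvd 3 * int j + 3 + int d" "\<not> int d dvd 3 * int j + 3 - int d"
    using nd dvd_add_triv_right_iff[of "int d" "3 * int j + 3 - int d"] by simp_all
  ultimately show 1: "aunit \<Phi> (1 - zq j * x1)" "aunit \<Phi> (1 - zq j / x1)"
    by (auto intro!: aunit_one_minus_qv_powi[OF d_pos])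
  have "y1 - zq j = (1 - zq j * x1) / x1"
    by (simp add: y1_eq field_simps)
  then show "aunit \<Phi> (y1 - zq j)"
    using 1 aunit_x1 by (simp add: aunit_divide)
qed

lemma quadratic_factor: "(1 - x1 * a) * (1 - a / x1) = (1 - a)\<^sup>2 - u * a"
  by (simp add: u_def field_simps power2_eq_square)

lemma quadratic_factor': "(1 - a / x1) * (1 - a * x1) = (1 - a)\<^sup>2 - u * a"
  using quadratic_factor[of a] by (simp add: mult_ac)

text \<open>Logarithmic derivatives of \<open>deform_x\<close> with respect to x + 1/x - 2 and of
  \<open>deform_y\<close> with respect to y, both at the undeformed point.\<close>

definition dlog_x :: "nat \<Rightarrow> F" where
  "dlog_x k = (\<Sum>j<k. zq j / (1 - zq j)\<^sup>2 - wq j / (1 - wq j)\<^sup>2)"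
definition dlog_y :: "nat \<Rightarrow> F" where
  "dlog_y k = (\<Sum>j<k. - (wq j / (1 - wq j)) - 1 / (1 - zq j))"

lemma deform_x_expansion:
  assumes "k \<le> d1"
  shows "adic \<Phi> 4 (deform_x x1 k - deform_x 1 k * (1 + u * dlog_x k))"
proof -
  have "adic \<Phi> (2 * 2) (deform_x x1 k - deform_x 1 k * (1 + u * dlog_x k))"
    unfolding deform_x_def dlog_x_def
  proof (rule adic_prod_first_order[OF adic_u])
    fix j assume "j < k"
    then have j: "j < d1" using assms by simp
    note un = aunit_small[OF j] aunit_small_x1[OF j]
    define w z W Z where "w = wq j" "z = zq j" "W = (1 - w)\<^sup>2" "Z = (1 - z)\<^sup>2"
    have Z: "aunit \<Phi> Z" "aunit \<Phi> (Z - u * z)" and W: "aunit \<Phi> W"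
      using un aunit_mult[OF un(4,3)] unfolding w_z_W_Z_def quadratic_factor'
      by (auto intro: aunit_power)
    note nz = Z[THEN aunit_nonzero] aunit_nonzero[OF W]
    have wz: "adic \<Phi> 0 w" "adic \<Phi> 0 z" by (simp_all add: w_z_W_Z_def adic_wq adic_zq)
    have f: "(1 - x1 * wq j) * (1 - wq j / x1) / ((1 - zq j / x1) * (1 - zq j * x1)) = (W - u * w) / (Z - u * z)"
      unfolding quadratic_factor quadratic_factor' w_z_W_Z_def ..
    have g: "(1 - 1 * wq j) * (1 - wq j / 1) / ((1 - zq j / 1) * (1 - zq j * 1)) = W / Z"
      by (simp add: w_z_W_Z_def power2_eq_square)
    have l: "zq j / (1 - zq j)\<^sup>2 - wq j / (1 - wq j)\<^sup>2 = z / Z - w / W"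
      by (simp add: w_z_W_Z_def)
    \<comment> \<open>An exact remainder: keeping the deformed denominator leaves u^2 times an
      integral quantity instead of an infinite expansion.\<close>
    have "(W - u * w) / (Z - u * z) - W / Z * (1 + u * (z / Z - w / W))
        = u * u * (z * (W * z / Z - w) / (Z * (Z - u * z)))"
      using nz by (simp add: divide_simps) (simp add: algebra_simps)
    moreover have "adic \<Phi> (2 * 2) (u * u)"
      using adic_mult[OF adic_u adic_u] by simp
    moreover have "adic \<Phi> 0 (z * (W * z / Z - w) / (Z * (Z - u * z)))"
      using wz W Z by (intro adic_divide adic_mult_left adic_diff aunit_mult) auto
    ultimately show "adic \<Phi> (2 * 2) ((1 - x1 * wq j) * (1 - wq j / x1) / ((1 - zq j / x1) * (1 - zq j * x1))
        - (1 - 1 * wq j) * (1 - wq j / 1) / ((1 - zq j / 1) * (1 - zq j * 1))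
          * (1 + u * (zq j / (1 - zq j)\<^sup>2 - wq j / (1 - wq j)\<^sup>2)))"
      unfolding f g l by (simp only: adic_mult_right)
    show "adic \<Phi> 0 ((1 - x1 * wq j) * (1 - wq j / x1) / ((1 - zq j / x1) * (1 - zq j * x1)))"
      unfolding f using W Z wz adic_mono[OF adic_u] by (intro adic_divide adic_diff adic_mult_left) auto
    show "adic \<Phi> 0 ((1 - 1 * wq j) * (1 - wq j / 1) / ((1 - zq j / 1) * (1 - zq j * 1)))"
      unfolding g using W Z by (intro adic_divide) auto
    show "adic \<Phi> 0 (zq j / (1 - zq j)\<^sup>2 - wq j / (1 - wq j)\<^sup>2)"
      unfolding l using W Z wz by (intro adic_divide adic_diff) auto
  qed
  then show ?thesis by simp
qed

lemma deform_y_expansion: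
  assumes "k \<le> d1"
  shows "adic \<Phi> 2 (deform_y y1 k - deform_y 1 k * (1 + (y1 - 1) * dlog_y k))"
proof -
  have "adic \<Phi> (2 * 1) (deform_y y1 k - deform_y 1 k * (1 + (y1 - 1) * dlog_y k))"
    unfolding deform_y_def dlog_y_def
  proof (rule adic_prod_first_order[OF adic_y1])
    fix j assume "j < k"
    then have j: "j < d1" using assms by simp
    note un = aunit_small[OF j] aunit_small_x1[OF j]
    note nz = un[THEN aunit_nonzero]
    define w z \<eta> where "w = wq j" "z = zq j" "\<eta> = y1 - 1"
    note un' = un[folded w_z_\<eta>_def] and nz' = nz[folded w_z_\<eta>_def]
    have wz: "adic \<Phi> 0 w" "adic \<Phi> 0 z" by (simp_all add: w_z_\<eta>_def adic_wq adic_zq)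
    have y1: "y1 = 1 + \<eta>" by (simp add: w_z_\<eta>_def)
    have y1z: "1 + \<eta> - z \<noteq> 0" using nz'(5) by (simp add: y1)
    have "(1 - y1 * w) / (y1 - z) - (1 - 1 * w) / (1 - z) * (1 + \<eta> * (- (w / (1 - w)) - 1 / (1 - z)))
        = \<eta> * \<eta> * ((w + (1 - w) / (1 - z)) / ((1 - z) * (y1 - z)))"
      using nz'(1,2) y1z unfolding y1 by (simp add: divide_simps) (simp add: algebra_simps)
    moreover have "adic \<Phi> (2 * 1) (\<eta> * \<eta>)"
      unfolding w_z_\<eta>_def using adic_mult[OF adic_y1 adic_y1] by (simp add: numeral_2_eq_2)
    moreover have "adic \<Phi> 0 ((w + (1 - w) / (1 - z)) / ((1 - z) * (y1 - z)))"
      using wz un' by (intro adic_divide adic_add aunit_mult) auto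
    ultimately show "adic \<Phi> (2 * 1) ((1 - y1 * wq j) / (y1 - zq j) - (1 - 1 * wq j) / (1 - zq j)
        * (1 + (y1 - 1) * (- (wq j / (1 - wq j)) - 1 / (1 - zq j))))"
      unfolding w_z_\<eta>_def[symmetric] by (simp only: adic_mult_right)
    show "adic \<Phi> 0 ((1 - y1 * wq j) / (y1 - zq j))"
      using un adic_wq aunit_y1 by (intro adic_divide adic_diff adic_mult_left adic_one) auto
    show "adic \<Phi> 0 ((1 - 1 * wq j) / (1 - zq j))"
      using un by (intro adic_divide) auto
    show "adic \<Phi> 0 (- (wq j / (1 - wq j)) - 1 / (1 - zq j))"
      using un adic_wq by (intro adic_divide adic_diff adic_uminus adic_one) auto
  qed
  then show ?thesis by simp
qed

lemma one_minus_inverse_wq: "1 - inverse (wq j) = - ((1 - wq j) / wq j)"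
  by (simp add: field_simps)

lemma aunit_one_minus_inverse_wq: "j < d1 \<Longrightarrow> aunit \<Phi> (1 - inverse (wq j))"
  unfolding one_minus_inverse_wq using aunit_small(1) aunit_wq by (intro aunit_uminus aunit_divide)

lemma zq_reflect_one_minus:
  assumes "j < d1"
  shows "adic \<Phi> 1 ((1 - zq (d1 - Suc j)) - (1 - inverse (wq j)))"
  using adic_uminus[OF zq_reflect[OF assms]] by simp

text \<open>The function z/(1 - z)^2 is invariant under z -> 1/z, and reflection replaces
  \<open>zq\<close> by the inverse of \<open>wq\<close> modulo \<Phi>.\<close>

lemma square_ratio_reflect:
  assumes "j < d1"
  shows "adic \<Phi> 1 (zq (d1 - Suc j) / (1 - zq (d1 - Suc j))\<^sup>2 - wq j / (1 - wq j)\<^sup>2)"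
proof -
  have "wq j / (1 - wq j)\<^sup>2 = inverse (wq j) / (1 - inverse (wq j))\<^sup>2"
    unfolding one_minus_inverse_wq by (simp add: field_simps power2_eq_square)
  moreover have "adic \<Phi> 1 (zq (d1 - Suc j) / (1 - zq (d1 - Suc j))\<^sup>2 - inverse (wq j) / (1 - inverse (wq j))\<^sup>2)"
    using aunit_small(2)[of "d1 - Suc j"] aunit_one_minus_inverse_wq[OF assms] assms adic_zq
    by (intro adic_cong_divide zq_reflect adic_cong_power zq_reflect_one_minus aunit_power) auto
  ultimately show ?thesis by simp
qed

text \<open>Under z -> 1/w the function 1/(1 - z) becomes - w/(1 - w), so the two parts of the
  logarithmic derivative in y are exchanged.\<close>

lemma ratio_reflect:
  assumes "j < d1"
  shows "adic \<Phi> 1 (1 / (1 - zq (d1 - Suc j)) + wq j / (1 - wq j))"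
proof -
  have "wq j / (1 - wq j) = - (1 / (1 - inverse (wq j)))"
    unfolding one_minus_inverse_wq by simp
  moreover have "adic \<Phi> 1 (1 / (1 - zq (d1 - Suc j)) - 1 / (1 - inverse (wq j)))"
    using aunit_small(2)[of "d1 - Suc j"] aunit_one_minus_inverse_wq[OF assms] assms
    by (intro adic_cong_divide zq_reflect_one_minus) auto
  ultimately show ?thesis by simp
qed

text \<open>Reflection exchanges the \<open>zq\<close> part and the \<open>wq\<close> part of the
  summands. They enter with opposite signs, so the summands are antisymmetric and their partial sums
  symmetric.\<close>

lemma dlog_x_symmetric: "k \<le> d1 \<Longrightarrow> adic \<Phi> 1 (dlog_x (d1 - k) - dlog_x k)"
  unfolding dlog_x_def
proof (rule adic_partial_sum_symmetric[OF d_pos])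
  fix j assume j: "j < d1"
  then have j': "d1 - Suc (d1 - Suc j) = j" "d1 - Suc j < d1" by auto
  have "adic \<Phi> 1 ((zq (d1 - Suc j) / (1 - zq (d1 - Suc j))\<^sup>2 - wq j / (1 - wq j)\<^sup>2)
      + (zq j / (1 - zq j)\<^sup>2 - wq (d1 - Suc j) / (1 - wq (d1 - Suc j))\<^sup>2))"
    using square_ratio_reflect[OF j] square_ratio_reflect[OF j'(2)] unfolding j' by (rule adic_add)
  then show "adic \<Phi> 1 (zq (d1 - Suc j) / (1 - zq (d1 - Suc j))\<^sup>2 - wq (d1 - Suc j) / (1 - wq (d1 - Suc j))\<^sup>2
      + (zq j / (1 - zq j)\<^sup>2 - wq j / (1 - wq j)\<^sup>2))"
    by (simp only: add_diff_eq diff_add_eq add.commute add.left_commute diff_diff_eq2 diff_diff_eq)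
qed

lemma dlog_y_symmetric: "k \<le> d1 \<Longrightarrow> adic \<Phi> 1 (dlog_y (d1 - k) - dlog_y k)"
  unfolding dlog_y_def
proof (rule adic_partial_sum_symmetric[OF d_pos])
  fix j assume j: "j < d1"
  then have j': "d1 - Suc (d1 - Suc j) = j" "d1 - Suc j < d1" by auto
  define A B C D where "A = 1 / (1 - zq (d1 - Suc j))" "B = wq j / (1 - wq j)"
    "C = 1 / (1 - zq j)" "D = wq (d1 - Suc j) / (1 - wq (d1 - Suc j))"
  have "adic \<Phi> 1 (- ((A + B) + (C + D)))"
    using adic_add[OF ratio_reflect[OF j] ratio_reflect[OF j'(2)]] unfolding j' A_B_C_D_def
    by (rule adic_uminus)
  moreover have "- ((A + B) + (C + D)) = (- D - A) + (- B - C)" by simp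
  ultimately show "adic \<Phi> 1 (- (wq (d1 - Suc j) / (1 - wq (d1 - Suc j))) - 1 / (1 - zq (d1 - Suc j))
      + (- (wq j / (1 - wq j)) - 1 / (1 - zq j)))"
    unfolding A_B_C_D_def[symmetric] by (simp only:)
qed

end

text \<open>The stated side mixes two points: its sum belongs to x = y = 1, but q^(4-3N) in its
  prefactor is q^3/x at x = q^n. Hence the final expansion is made relative to that
  prefactor.\<close>

lemma sum_eq_watson_rhs:
  assumes n: "3 * N = n + 1"
  shows "qint (int n) * qv ^ N * qpoch (inverse (qv\<^sup>2)) (qv ^ 3) N / qpoch (qv ^ 3) (qv ^ 3) N
       * (\<Sum>k=0..N. qpoch (qv ^ 4 / (cv * ev)) (qv ^ 3) k * qpoch (inverse qv) (qv ^ 3) k ^ 3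
           / (qpoch (qv ^ 3 / cv) (qv ^ 3) k * qpoch (qv ^ 3 / ev) (qv ^ 3) k
              * qpoch (qv ^ 3) (qv ^ 3) k * qpoch (inverse (qv\<^sup>2)) (qv ^ 3) k) * qv ^ (3 * k))
    = - inverse qv * (qpoch (qv ^ 2) (qv ^ 3) N / (qpoch (qv powi (4 - 3 * int N)) (qv ^ 3) N * qpoch (qv ^ 3) (qv ^ 3) N))
      * watson_rhs N 1 1" (is "?c * (\<Sum>k=0..N. ?t k) = ?K * _")
proof -
  define \<sigma> where "\<sigma> = (\<Prod>i<N. - (qv powi (2 - 3 * int i)))"
  have "watson_rhs N 1 1 = (\<Sum>k\<le>N. \<sigma> * qpoch (inverse (qv\<^sup>2)) (qv ^ 3) N * ?t k)"
    unfolding watson_rhs_def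
  proof (intro sum.cong refl)
    fix k assume "k \<in> {..N}"
    then have k: "k \<le> N" by simp
    have "qpoch (1 * inverse qv) (qv ^ 3) k * qpoch (inverse 1 * inverse qv) (qv ^ 3) k
      * qpoch (1 * inverse qv) (qv ^ 3) k * (\<Prod>i<k. - ((qv ^ 3) ^ (N - i)))
      * (qpoch (qv powi (5 - 3 * int N) / 1) (qv ^ 3) (N - k) * (qv powi (5 - 3 * int N) / 1) ^ k)
      * qpoch (qv ^ 4 / (cv * ev)) (qv ^ 3) k
      / (qpoch (qv ^ 3) (qv ^ 3) k * qpoch (qv ^ 3 / cv) (qv ^ 3) k * qpoch (qv ^ 3 / ev) (qv ^ 3) k)
     = qpoch (inverse qv) (qv ^ 3) k ^ 3 * ((\<Prod>i<k. - ((qv ^ 3) ^ (N - i)))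
      * (qpoch (qv powi (5 - 3 * int N)) (qv ^ 3) (N - k) * (qv powi (5 - 3 * int N)) ^ k))
      * qpoch (qv ^ 4 / (cv * ev)) (qv ^ 3) k
      / (qpoch (qv ^ 3) (qv ^ 3) k * qpoch (qv ^ 3 / cv) (qv ^ 3) k * qpoch (qv ^ 3 / ev) (qv ^ 3) k)"
      by (simp add: power3_eq_cube mult_ac)
    also have "\<dots> = \<sigma> * qpoch (inverse (qv\<^sup>2)) (qv ^ 3) N * ?t k"
      unfolding watson_rhs_coefficient[OF k] \<sigma>_def by (simp add: mult_ac)
    finally show "qpoch (1 * inverse qv) (qv ^ 3) k * qpoch (inverse 1 * inverse qv) (qv ^ 3) k
      * qpoch (1 * inverse qv) (qv ^ 3) k * (\<Prod>i<k. - ((qv ^ 3) ^ (N - i)))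
      * (qpoch (qv powi (5 - 3 * int N) / 1) (qv ^ 3) (N - k) * (qv powi (5 - 3 * int N) / 1) ^ k)
      * qpoch (qv ^ 4 / (cv * ev)) (qv ^ 3) k
      / (qpoch (qv ^ 3) (qv ^ 3) k * qpoch (qv ^ 3 / cv) (qv ^ 3) k * qpoch (qv ^ 3 / ev) (qv ^ 3) k)
      = \<sigma> * qpoch (inverse (qv\<^sup>2)) (qv ^ 3) N * ?t k" .
  qed
  then have "?K * watson_rhs N 1 1 = (?K * \<sigma>) * qpoch (inverse (qv\<^sup>2)) (qv ^ 3) N * (\<Sum>k\<le>N. ?t k)"
    by (simp only: sum_distrib_left[symmetric] mult.assoc)
  also have "?K * \<sigma> = qint (int n) * qv ^ N / qpoch (qv ^ 3) (qv ^ 3) N"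
    unfolding \<sigma>_def by (rule prefactor_eq[OF n])
  finally show ?thesis
    by (simp add: atLeast0AtMost)
qed

section \<open>Divisibility of the right-hand side\<close>

context inverse_of_three
begin

lemma qpoch_cong:
  assumes "adic \<Phi> k (a - b)" "adic \<Phi> 0 a" "adic \<Phi> 0 b"
  shows "adic \<Phi> k (qpoch a (qv ^ 3) m - qpoch b (qv ^ 3) m)"
  unfolding qpoch_def
proof (rule adic_cong_prod)
  fix j
  have q: "adic \<Phi> 0 ((qv ^ 3) ^ j)"
    using aunit_qv[OF d_pos] by (intro adic_power0) auto
  have "(1 - a * (qv ^ 3) ^ j) - (1 - b * (qv ^ 3) ^ j) = - ((a - b) * (qv ^ 3) ^ j)"
    by (simp add: algebra_simps)
  then show "adic \<Phi> k ((1 - a * (qv ^ 3) ^ j) - (1 - b * (qv ^ 3) ^ j))"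
    using adic_uminus[OF adic_mult_right[OF assms(1) q]] by simp
  show "adic \<Phi> 0 (1 - a * (qv ^ 3) ^ j)" "adic \<Phi> 0 (1 - b * (qv ^ 3) ^ j)"
    using q assms by (auto intro!: adic_diff adic_mult_left)
qed

lemma adic_qpoch: "adic \<Phi> 0 a \<Longrightarrow> adic \<Phi> 0 (qpoch a (qv ^ 3) m)"
  unfolding qpoch_def using aunit_qv[OF d_pos] by (auto intro!: adic_prod adic_diff adic_mult_left adic_power0)

lemma aunit_qpoch_cv: "aunit \<Phi> (qpoch (qv ^ 3 / cv) (qv ^ 3) m)"
  and aunit_qpoch_ev: "aunit \<Phi> (qpoch (qv ^ 3 / ev) (qv ^ 3) m)"
  unfolding qpoch_zq zq_power
  using aunit_one_minus_cv[OF d_pos] aunit_one_minus_ev[OF d_pos] by (auto intro!: aunit_prod)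

lemma card_residue: "r < d \<Longrightarrow> (k + (d - 1 - r)) div d = k div d + (if k mod d > r then 1 else 0)"
proof -
  assume r: "r < d"
  have "(k + (d - 1 - r)) div d = (k div d * d + (k mod d + (d - 1 - r))) div d"
    by (simp add: add.assoc[symmetric])
  also have "\<dots> = k div d + (k mod d + (d - 1 - r)) div d"
    by (rule div_mult_self3) (use d_pos in simp)
  also have "(k mod d + (d - 1 - r)) div d = (if k mod d > r then 1 else 0)"
  proof (cases "k mod d > r")
    case True
    then have eq: "k mod d + (d - 1 - r) = d + (k mod d - Suc r)" using r by simp
    have "k mod d - Suc r < d" using d_pos by (meson less_imp_diff_less mod_less_divisor)
    then have "(d + (k mod d - Suc r)) div d = 1" using d_pos by (simp only: div_add_self1) simp
    then show ?thesis using True by (simp only: eq if_True)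
  next
    case False
    then have "k mod d + (d - 1 - r) < d" using r by simp
    then show ?thesis using False by simp
  qed
  finally show ?thesis .
qed

text \<open>The product of the two Pochhammer symbols in the numerator has at least as many factors divisible
  by \<open>\<Phi>\<^sub>d\<close> as the denominator.\<close>

lemma adic_rhs_factor:
  assumes N: "N mod d = d1" and k: "k \<le> N"
  shows "adic \<Phi> 0 (qpoch (inverse (qv\<^sup>2)) (qv ^ 3) N / qpoch (inverse (qv\<^sup>2)) (qv ^ 3) k
     * qpoch (inverse qv) (qv ^ 3) k / qpoch (qv ^ 3) (qv ^ 3) N)"
proof -
  \<comment> \<open>The exponents of the numerator in one list: the first \<open>k\<close> come from
    (1/q; q^3)_k, the others from the quotient of the two symbols with base parameter
    q^(-2).\<close>
  define f where "f j = (if j < k then 3 * int j - 1 else 3 * int j - 2)" for j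
  define d2 where "d2 = (2 * d1) mod d"
  have d2: "d2 < d" using d_pos by (simp add: d2_def)
  have f0: "f j \<noteq> 0" for j unfolding f_def by presburger
  have c2: "card {j. j < m \<and> int d dvd 3 * int j - 2} = m div d + (if m mod d > d2 then 1 else 0)" for m
    using card_mod_eq[OF d2, of m] card_residue[OF d2, of m] by (simp add: dvd_twice_iff d2_def)
  have c1: "card {j. j < m \<and> int d dvd 3 * int j - 1} = m div d + (if m mod d > d1 then 1 else 0)" for m
    using card_mod_eq[OF d1(1), of m] card_residue[OF d1(1), of m] by (simp add: dvd_wq_iff)
  have "{j \<in> {..<N}. int d dvd f j} = {j. j < k \<and> int d dvd 3 * int j - 1}
      \<union> ({j. j < N \<and> int d dvd 3 * int j - 2} - {j. j < k \<and> int d dvd 3 * int j - 2})"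
    using k by (auto simp: f_def)
  moreover have sub: "{j. j < k \<and> int d dvd 3 * int j - 2} \<subseteq> {j. j < N \<and> int d dvd 3 * int j - 2}"
    using k by auto
  then have "card ({j. j < k \<and> int d dvd 3 * int j - 1}
      \<union> ({j. j < N \<and> int d dvd 3 * int j - 2} - {j. j < k \<and> int d dvd 3 * int j - 2})) = card {j. j < k \<and> int d dvd 3 * int j - 1}
      + (card {j. j < N \<and> int d dvd 3 * int j - 2} - card {j. j < k \<and> int d dvd 3 * int j - 2})"
    using k by (subst card_Un_disjoint) (auto intro!: card_Diff_subset)
  with calculation have card_f: "card {j \<in> {..<N}. int d dvd f j} = card {j. j < k \<and> int d dvd 3 * int j - 1}
      + (card {j. j < N \<and> int d dvd 3 * int j - 2} - card {j. j < k \<and> int d dvd 3 * int j - 2})"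
    by simp
  have "adic \<Phi> 0 ((\<Prod>j\<in>{..<N}. 1 - qv powi f j) / (\<Prod>j\<in>{..<N}. 1 - qv powi (3 * int j + 3)))"
  proof (rule adic_prod_ratio)
    \<comment> \<open>The residue \<open>d1\<close> of \<open>N\<close> decides the count: if
      \<open>k mod d\<close> exceeds \<open>d2\<close>, then it exceeds \<open>d1\<close> or
      \<open>d1\<close> exceeds \<open>d2\<close>, so a factor lost to the divided symbol is always
      compensated.\<close>
    have "k div d \<le> N div d" using k by (rule div_le_mono)
    then show "card {j \<in> {..<N}. int d dvd 3 * int j + 3} \<le> card {j \<in> {..<N}. int d dvd f j}"
      unfolding card_f c1 c2 card_zq N by auto
  qed (use f0 in auto)
  moreover have "(\<Prod>j\<in>{..<N}. 1 - qv powi f j) = qpoch (inverse (qv\<^sup>2)) (qv ^ 3) N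
      / qpoch (inverse (qv\<^sup>2)) (qv ^ 3) k * qpoch (inverse qv) (qv ^ 3) k"
  proof -
    obtain m where m: "N = k + m" using k le_Suc_ex by blast
    have "3 * int j - 2 \<noteq> 0" for j by presburger
    then have "(\<Prod>j<k. 1 - qv powi (3 * int j - 2)) \<noteq> 0"
      using one_minus_qv_powi_nonzero by (simp add: prod_zero_iff)
    then show ?thesis
      unfolding m qpoch_inverse_square qpoch_wq1 prod_lessThan_add by (simp add: f_def wq_def)
  qed
  ultimately show ?thesis
    by (simp add: qpoch_zq1 zq_def)
qed

text \<open>[n] supplies the factor \<Phi>. The remainder is integral only after the quotient of
  Pochhammer symbols is moved into the sum, since single summands can have \<Phi> in their
  denominators.\<close>

lemma adic_rhs:
  assumes N: "N mod d = d1" and n: "d dvd n" "n > 0"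
  shows "adic \<Phi> 1 (qint (int n) * qv ^ N * qpoch (inverse (qv\<^sup>2)) (qv ^ 3) N / qpoch (qv ^ 3) (qv ^ 3) N
       * (1 - qint (int n) ^ 2 * (\<Sum>i=1..N. qv ^ (3 * i) / qint (int (3 * i)) ^ 2))
       * (\<Sum>k=0..N. qpoch (qv ^ 4 / (cv * ev)) (qv ^ 3) k * qpoch (inverse qv) (qv ^ 3) k ^ 3
           / (qpoch (qv ^ 3 / cv) (qv ^ 3) k * qpoch (qv ^ 3 / ev) (qv ^ 3) k
              * qpoch (qv ^ 3) (qv ^ 3) k * qpoch (inverse (qv\<^sup>2)) (qv ^ 3) k) * qv ^ (3 * k)))"
    (is "adic _ _ (_ * _ * _ / _ * (1 - ?\<epsilon>) * (\<Sum>k=0..N. ?t k))")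
proof -
  have q: "adic \<Phi> 0 (qv ^ m)" for m
    using aunit_qv[OF d_pos] by (intro adic_power0) auto
  have q1: "adic \<Phi> 1 (qint (int n))"
    unfolding qint_def using n(1)
    by (intro adic_divide adic_one_minus_qv_powi[OF d_pos] aunit_one_minus_qv) simp
  \<comment> \<open>[3i] may be divisible by \<Phi>, but then so is [n]; the quotient is integral
    although 1/[3i] need not be.\<close>
  have "adic \<Phi> 0 (qint (int n) / qint (int (3 * i)))" if "i > 0" for i
  proof -
    have "adic \<Phi> 0 ((\<Prod>j\<in>{0::nat}. 1 - qv powi int n) / (\<Prod>j\<in>{0::nat}. 1 - qv powi int (3 * i)))"
    proof (rule adic_prod_ratio)
      show "card {j \<in> {0::nat}. int d dvd int (3 * i)} \<le> card {j \<in> {0::nat}. int d dvd int n}"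
        using n(1) by (intro card_mono) auto
    qed (use that n in auto)
    moreover have "1 - qv \<noteq> 0" using qv_power_neq_1[of 1] by simp
    ultimately show ?thesis by (simp add: qint_def)
  qed
  then have "adic \<Phi> 0 (\<Sum>i=1..N. qv ^ (3 * i) * (qint (int n) / qint (int (3 * i))) ^ 2)"
    using q q[of 1] by (intro adic_sum adic_mult_left adic_power0) auto
  moreover have "?\<epsilon> = (\<Sum>i=1..N. qv ^ (3 * i) * (qint (int n) / qint (int (3 * i))) ^ 2)"
    by (simp add: sum_distrib_left power_divide mult.commute)
  ultimately have \<epsilon>: "adic \<Phi> 0 (1 - ?\<epsilon>)"
    by (simp add: adic_diff)
  define c where "c = qpoch (inverse (qv\<^sup>2)) (qv ^ 3) N / qpoch (qv ^ 3) (qv ^ 3) N"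
  have "adic \<Phi> 0 (c * ?t k)" if k: "k \<le> N" for k
  proof -
    have "c * ?t k = (qpoch (inverse (qv\<^sup>2)) (qv ^ 3) N / qpoch (inverse (qv\<^sup>2)) (qv ^ 3) k
     * qpoch (inverse qv) (qv ^ 3) k / qpoch (qv ^ 3) (qv ^ 3) N)
     * (qpoch (inverse qv) (qv ^ 3) k / qpoch (qv ^ 3) (qv ^ 3) k)
     * (qpoch (inverse qv) (qv ^ 3) k * qpoch (qv ^ 4 / (cv * ev)) (qv ^ 3) k * qv ^ (3 * k)
        / (qpoch (qv ^ 3 / cv) (qv ^ 3) k * qpoch (qv ^ 3 / ev) (qv ^ 3) k))"
      by (simp add: c_def power3_eq_cube mult_ac)
    moreover have "adic \<Phi> 0 (qpoch (inverse qv) (qv ^ 3) k / qpoch (qv ^ 3) (qv ^ 3) k)"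
      unfolding qpoch_wq1 qpoch_zq1 by (rule adic_wq_zq_ratio)
    moreover have "adic \<Phi> 0 (qpoch (inverse qv) (qv ^ 3) k * qpoch (qv ^ 4 / (cv * ev)) (qv ^ 3) k * qv ^ (3 * k)
        / (qpoch (qv ^ 3 / cv) (qv ^ 3) k * qpoch (qv ^ 3 / ev) (qv ^ 3) k))"
      using q aunit_inverse[OF aunit_qv[OF d_pos]] aunit_cv[OF d_pos] aunit_ev[OF d_pos]
      by (intro adic_divide adic_mult_left adic_qpoch aunit_mult aunit_qpoch_cv aunit_qpoch_ev) auto
    ultimately show ?thesis
      using adic_rhs_factor[OF N k] by (simp only: adic_mult_left)
  qed
  then have "adic \<Phi> 0 (\<Sum>k=0..N. c * ?t k)"
    by (intro adic_sum) auto
  then have "adic \<Phi> 1 (qint (int n) * (qv ^ N * ((1 - ?\<epsilon>) * (\<Sum>k=0..N. c * ?t k))))"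
    using q1 \<epsilon> q by (intro adic_mult_right[OF q1] adic_mult_left)
  moreover have "qint (int n) * (qv ^ N * ((1 - X) * (\<Sum>k=0..N. c * ?t k)))
     = qint (int n) * qv ^ N * qpoch (inverse (qv\<^sup>2)) (qv ^ 3) N / qpoch (qv ^ 3) (qv ^ 3) N * (1 - X) * (\<Sum>k=0..N. ?t k)" for X
    unfolding sum_distrib_left[symmetric] c_def by (simp add: mult_ac)
  ultimately show ?thesis
    by (simp only:)
qed

end

section \<open>The mixed second difference of the deformed sum\<close>

context top_modulus
begin

lemma adic_deform_const: "k \<le> d1 \<Longrightarrow> adic \<Phi> 0 (deform_const k)"
  unfolding deform_const_def
  using aunit_argument adic_wq aunit_small(2) aunit_one_minus_cv[OF d_pos] aunit_one_minus_ev[OF d_pos]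
    aunit_cv[OF d_pos] aunit_ev[OF d_pos]
  by (intro adic_mult_left[OF adic_qint] adic_prod adic_mult_right[OF _ aunit_adic] adic_divide
      adic_mult_left adic_diff adic_one aunit_mult) (auto simp: zq_power)

lemma adic_deform_x_1: "k \<le> d1 \<Longrightarrow> adic \<Phi> 0 (deform_x 1 k)"
  unfolding deform_x_def using adic_wq aunit_small(2)
  by (intro adic_prod adic_divide adic_mult_left adic_diff adic_one aunit_mult) auto

lemma adic_deform_y_1: "k \<le> d1 \<Longrightarrow> adic \<Phi> 0 (deform_y 1 k)"
  unfolding deform_y_def using adic_wq aunit_small(2)
  by (intro adic_prod adic_divide adic_mult_left adic_diff adic_one) auto

lemma adic_dlog_x: "k \<le> d1 \<Longrightarrow> adic \<Phi> 0 (dlog_x k)"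
  unfolding dlog_x_def using adic_wq adic_zq aunit_small
  by (intro adic_sum adic_diff adic_divide aunit_power) auto

lemma adic_dlog_y: "k \<le> d1 \<Longrightarrow> adic \<Phi> 0 (dlog_y k)"
  unfolding dlog_y_def using adic_wq aunit_small
  by (intro adic_sum adic_diff adic_uminus adic_divide adic_one) auto

definition deformed_sum :: "F \<Rightarrow> F \<Rightarrow> F" where
  "deformed_sum x y = (\<Sum>k\<le>d1. deform_const k * deform_x x k * deform_y y k)"

text \<open>Up to terms of order 4, the mixed second difference is \<open>- u (y1 - 1)\<close>, which has order 3, times the
  sum of the terms \<open>lhs_term k\<close> weighted with the logarithmic derivatives \<open>dlog_x k\<close> and \<open>dlog_y k\<close>; the symmetry of the weights makes the
  last sum vanish modulo \<open>\<Phi>\<close>.\<close>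

lemma mixed_difference:
  "adic \<Phi> 4 (deformed_sum x1 1 - deformed_sum x1 y1 - deformed_sum 1 1 + deformed_sum 1 y1)"
proof -
  define \<eta> where "\<eta> = y1 - 1"
  define a where "a k = deform_x x1 k - deform_x 1 k * (1 + u * dlog_x k)" for k
  define b where "b k = deform_y y1 k - deform_y 1 k * (1 + \<eta> * dlog_y k)" for k
  \<comment> \<open>The mixed difference of a summand is minus the product of its first-order parts
    plus remainders \<open>a\<close> and \<open>b\<close>; \<open>r\<close> collects the products
    that contain a remainder.\<close>
  define r where "r k = deform_const k * (a k * (b k + deform_y 1 k * (\<eta> * dlog_y k)) + deform_x 1 k * (dlog_x k * (u * b k)))" for k
  have u\<eta>: "adic \<Phi> 3 (u * \<eta>)"
    using adic_mult[OF adic_u adic_y1] by (simp add: \<eta>_def)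
  have "adic \<Phi> 4 (r k)" if k: "k \<le> d1" for k
  proof -
    have a: "adic \<Phi> 4 (a k)" and b: "adic \<Phi> 2 (b k)"
      unfolding a_def b_def \<eta>_def by (rule deform_x_expansion[OF k], rule deform_y_expansion[OF k])
    have "adic \<Phi> 4 (u * b k)"
      using adic_mult[OF adic_u b] by simp
    moreover have "adic \<Phi> 0 (b k + deform_y 1 k * (\<eta> * dlog_y k))"
      using adic_mono[OF b] adic_mono[OF adic_y1] adic_deform_y_1[OF k] adic_dlog_y[OF k]
      unfolding \<eta>_def by (intro adic_add adic_mult_left) auto
    ultimately show ?thesis
      unfolding r_def using a adic_deform_x_1[OF k] adic_dlog_x[OF k]
      by (intro adic_mult_left[OF adic_deform_const[OF k]] adic_add[of _ _ "a k * _"] adic_mult_right[of _ _ "a k"]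
          adic_mult_left[of _ "deform_x 1 k"] adic_mult_left[of _ "dlog_x k"])
  qed
  then have "adic \<Phi> 4 (\<Sum>k\<le>d1. r k)"
    by (intro adic_sum) auto
  moreover have "adic \<Phi> 1 (\<Sum>k\<le>d1. lhs_term k * (dlog_x k * dlog_y k))"
    using adic_dlog_x adic_dlog_y dlog_x_symmetric dlog_y_symmetric
    by (intro adic_sum_lhs_term_weighted adic_mult_left adic_cong_mult) auto
  then have "adic \<Phi> 4 (u * \<eta> * (\<Sum>k\<le>d1. lhs_term k * (dlog_x k * dlog_y k)))"
    using adic_mult[OF u\<eta>] by fastforce
  ultimately have "adic \<Phi> 4 (- ((\<Sum>k\<le>d1. r k) + u * \<eta> * (\<Sum>k\<le>d1. lhs_term k * (dlog_x k * dlog_y k))))"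
    by (intro adic_uminus adic_add)
  also have "- ((\<Sum>k\<le>d1. r k) + u * \<eta> * (\<Sum>k\<le>d1. lhs_term k * (dlog_x k * dlog_y k)))
      = (\<Sum>k\<le>d1. deform_const k * deform_x x1 k * deform_y 1 k - deform_const k * deform_x x1 k * deform_y y1 k - deform_const k * deform_x 1 k * deform_y 1 k + deform_const k * deform_x 1 k * deform_y y1 k)"
  proof -
    have "- (r k + u * \<eta> * (lhs_term k * (dlog_x k * dlog_y k))) = deform_const k * deform_x x1 k * deform_y 1 k - deform_const k * deform_x x1 k * deform_y y1 k
        - deform_const k * deform_x 1 k * deform_y 1 k + deform_const k * deform_x 1 k * deform_y y1 k" for k
      unfolding r_def lhs_term_eq a_def b_def by (simp add: algebra_simps)
    then show ?thesis
      by (simp only: sum_distrib_left sum.distrib[symmetric] sum_negf[symmetric])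
  qed
  finally show ?thesis
    by (simp only: deformed_sum_def sum.distrib sum_subtractf)
qed

end

section \<open>Expansion of the three evaluations\<close>

context top_modulus
begin

definition rhs_const :: "nat \<Rightarrow> F" where
  "rhs_const j = (\<Prod>i<j. - ((qv ^ 3) ^ (d1 - i))) * qpoch (qv ^ 4 / (cv * ev)) (qv ^ 3) j
      / (qpoch (qv ^ 3) (qv ^ 3) j * qpoch (qv ^ 3 / cv) (qv ^ 3) j * qpoch (qv ^ 3 / ev) (qv ^ 3) j)"
definition rhs_x :: "F \<Rightarrow> nat \<Rightarrow> F" where
  "rhs_x x j = (\<Prod>i<j. (1 - x * wq i) * (1 - inverse x * wq i))"
definition rhs_y :: "F \<Rightarrow> nat \<Rightarrow> F" where
  "rhs_y y j = qpoch (y * inverse qv) (qv ^ 3) j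
      * (qpoch (qv powi (5 - 3 * int d1) / y) (qv ^ 3) (d1 - j) * (qv powi (5 - 3 * int d1) / y) ^ j)"

lemma watson_rhs_factors: "watson_rhs d1 x y = (\<Sum>j\<le>d1. rhs_const j * rhs_x x j * rhs_y y j)"
  unfolding watson_rhs_def rhs_const_def rhs_x_def rhs_y_def prod.distrib qpoch_wq[of x] qpoch_wq[of "inverse x"]
  by (intro sum.cong refl) (simp add: mult_ac)

lemma adic_qv_power: "adic \<Phi> 0 (qv ^ m)"
  using aunit_qv[OF d_pos] by (intro adic_power0) auto

lemma aunit_qpoch_cube: "j \<le> d1 \<Longrightarrow> aunit \<Phi> (qpoch (qv ^ 3) (qv ^ 3) j)"
  unfolding qpoch_zq1 using aunit_small(2) by (intro aunit_prod) auto

lemma adic_rhs_const: "j \<le> d1 \<Longrightarrow> adic \<Phi> 0 (rhs_const j)"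
  unfolding rhs_const_def using adic_qv_power adic_qv_power[of 1] aunit_cv[OF d_pos] aunit_ev[OF d_pos]
  by (intro adic_divide adic_mult_left adic_prod adic_uminus adic_power0 adic_qpoch aunit_mult
      aunit_qpoch_cube aunit_qpoch_cv aunit_qpoch_ev) auto

lemma adic_rhs_x: "aunit \<Phi> x \<Longrightarrow> adic \<Phi> 0 (rhs_x x j)"
  unfolding rhs_x_def using adic_wq aunit_inverse[of \<Phi> x]
  by (intro adic_prod adic_mult_left adic_diff adic_one) auto

lemma adic_rhs_y: "aunit \<Phi> y \<Longrightarrow> adic \<Phi> 0 (rhs_y y j)"
  unfolding rhs_y_def using aunit_inverse[OF aunit_qv[OF d_pos]] aunit_qv_powi[OF d_pos]
  by (intro adic_mult_left adic_qpoch adic_power0 adic_divide) auto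

lemma rhs_x_cong: "adic \<Phi> 2 (rhs_x x1 j - rhs_x 1 j)"
  unfolding rhs_x_def
proof (rule adic_cong_prod)
  fix i
  have "(1 - x1 * wq i) * (1 - inverse x1 * wq i) - (1 - 1 * wq i) * (1 - inverse 1 * wq i) = - (u * wq i)"
    using quadratic_factor[of "wq i"] by (simp add: divide_inverse mult.commute power2_eq_square)
  then show "adic \<Phi> 2 ((1 - x1 * wq i) * (1 - inverse x1 * wq i) - (1 - 1 * wq i) * (1 - inverse 1 * wq i))"
    using adic_uminus[OF adic_mult_right[OF adic_u adic_wq]] by simp
  show "adic \<Phi> 0 ((1 - x1 * wq i) * (1 - inverse x1 * wq i))"
    "adic \<Phi> 0 ((1 - 1 * wq i) * (1 - inverse 1 * wq i))"
    using adic_wq aunit_x1 aunit_inverse[OF aunit_x1]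
    by (auto intro!: adic_mult_left adic_diff)
qed

lemma rhs_y_cong: "adic \<Phi> 1 (rhs_y 1 j - rhs_y y1 j)"
proof -
  define v where "v = qv powi (5 - 3 * int d1)"
  have v: "aunit \<Phi> v" unfolding v_def by (rule aunit_qv_powi[OF d_pos])
  have "v / 1 - v / y1 = v * (y1 - 1) / y1"
    by (simp add: field_simps)
  then have vc: "adic \<Phi> 1 (v / 1 - v / y1)"
    using adic_divide[OF adic_mult_left[OF aunit_adic[OF v] adic_y1] aunit_y1] by simp
  have va: "adic \<Phi> 0 (v / 1)" "adic \<Phi> 0 (v / y1)"
    using v aunit_y1 by (auto intro: adic_divide)
  have qi: "adic \<Phi> 0 (inverse qv)"
    using aunit_inverse[OF aunit_qv[OF d_pos]] by auto
  have yq: "adic \<Phi> 0 (y1 * inverse qv)"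
    using qi aunit_y1 by (intro adic_mult_left) auto
  have "1 * inverse qv - y1 * inverse qv = - ((y1 - 1) * inverse qv)"
    by (simp add: algebra_simps)
  then have yc: "adic \<Phi> 1 (1 * inverse qv - y1 * inverse qv)"
    using adic_uminus[OF adic_mult_right[OF adic_y1 qi]] by simp
  show ?thesis
    unfolding rhs_y_def v_def[symmetric]
    by (rule adic_cong_mult[OF qpoch_cong[OF yc] adic_cong_mult[OF qpoch_cong[OF vc] adic_cong_power[OF vc]]])
      (use qi yq va in \<open>auto intro!: adic_qpoch adic_mult_left adic_power0\<close>)
qed

definition watson_prefactor :: "F \<Rightarrow> F \<Rightarrow> F" where
  "watson_prefactor a b = qpoch (qv ^ 2) (qv ^ 3) d1 / (qpoch a (qv ^ 3) d1 * qpoch b (qv ^ 3) d1)"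

text \<open>The last factor has exponent 2 + 3 (d1 - 1) = d. Every prefactor inherits order 1 from
  it, which supplies one of the four orders.\<close>

lemma adic_qpoch_square: "adic \<Phi> 1 (qpoch (qv ^ 2) (qv ^ 3) d1)"
proof -
  obtain m where m: "d1 = Suc m" using top by (cases d1) auto
  have "qpoch (qv ^ 2) (qv ^ 3) d1 = qpoch (qv ^ 2) (qv ^ 3) m * (1 - qv powi int d)"
  proof -
    have "2 + 3 * m = d" using top m by simp
    then show ?thesis
      by (simp add: m qpoch_Suc power_mult[symmetric] power_add[symmetric])
  qed
  moreover have "adic \<Phi> 1 (1 - qv powi int d)"
    by (rule adic_one_minus_qv_powi[OF d_pos]) simp
  ultimately show ?thesis
    using adic_qpoch[OF adic_qv_power] by (simp only: adic_mult_left)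
qed

lemma aunit_denominators:
  "aunit \<Phi> (qpoch (qv ^ 3 / x1) (qv ^ 3) d1)" "aunit \<Phi> (qpoch (qv ^ 3 * x1) (qv ^ 3) d1)"
  "aunit \<Phi> (qpoch (qv ^ 3) (qv ^ 3) d1)"
  unfolding qpoch_zq qpoch_zq' qpoch_zq1 using aunit_small(2) aunit_small_x1 by (auto intro!: aunit_prod)

lemma denominators_cong:
  "adic \<Phi> 1 (qpoch (qv ^ 3 / x1) (qv ^ 3) d1 - qpoch (qv ^ 3) (qv ^ 3) d1)"
  "adic \<Phi> 1 (qpoch (qv ^ 3 * x1) (qv ^ 3) d1 - qpoch (qv ^ 3) (qv ^ 3) d1)"
proof -
  have "qv ^ 3 / x1 - qv ^ 3 = qv ^ 3 * (1 - x1) / x1" "qv ^ 3 * x1 - qv ^ 3 = - (qv ^ 3 * (1 - x1))"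
    by (simp_all add: field_simps)
  then have c: "adic \<Phi> 1 (qv ^ 3 / x1 - qv ^ 3)" "adic \<Phi> 1 (qv ^ 3 * x1 - qv ^ 3)"
    using adic_mult_left[OF adic_qv_power adic_x1] aunit_x1 by (auto simp: adic_divide adic_uminus simp del: minus_mult_right)
  show "adic \<Phi> 1 (qpoch (qv ^ 3 / x1) (qv ^ 3) d1 - qpoch (qv ^ 3) (qv ^ 3) d1)"
    "adic \<Phi> 1 (qpoch (qv ^ 3 * x1) (qv ^ 3) d1 - qpoch (qv ^ 3) (qv ^ 3) d1)"
    by (rule qpoch_cong[OF c(1)]; use adic_qv_power aunit_x1 in \<open>auto intro!: adic_divide\<close>)
      (rule qpoch_cong[OF c(2)]; use adic_qv_power aunit_x1 in \<open>auto intro!: adic_mult_left\<close>)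
qed

text \<open>Up to (1 - q)^2 and the shift i = j + 1 this is the sum in the correction factor of the
  theorem.\<close>

definition sq_sum :: F where "sq_sum = (\<Sum>j<d1. zq j / (1 - zq j)\<^sup>2)"

text \<open>The two denominators pair up to factors (1 - z)^2 - u z, whose reciprocals have
  logarithmic derivative z/(1 - z)^2 at u = 0. This is the origin of the correction factor.\<close>

lemma watson_prefactor_expansion:
  "adic \<Phi> 4 (watson_prefactor (qv ^ 3 / x1) (qv ^ 3 * x1) - watson_prefactor (qv ^ 3) (qv ^ 3) * (1 + u * sq_sum))"
proof -
  have "adic \<Phi> (2 * 2) ((\<Prod>j<d1. 1 / ((1 - zq j)\<^sup>2 - u * zq j)) - (\<Prod>j<d1. 1 / (1 - zq j)\<^sup>2) * (1 + u * sq_sum))"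
    unfolding sq_sum_def
  proof (rule adic_prod_first_order[OF adic_u])
    fix j assume j: "j < d1"
    define z Z where "z = zq j" "Z = (1 - z)\<^sup>2"
    have Z: "aunit \<Phi> Z" "aunit \<Phi> (Z - u * z)"
      using aunit_small[OF j] aunit_mult[OF aunit_small_x1(2)[OF j] aunit_small_x1(1)[OF j]] unfolding z_Z_def quadratic_factor'
      by (auto intro: aunit_power)
    have z: "adic \<Phi> 0 z" by (simp add: z_Z_def adic_zq)
    have "1 / (Z - u * z) - 1 / Z * (1 + u * (z / Z)) = u * u * (z * z / (Z * Z * (Z - u * z)))"
      using Z[THEN aunit_nonzero] by (simp add: divide_simps) (simp add: algebra_simps)
    moreover have "adic \<Phi> (2 * 2) (u * u)"
      using adic_mult[OF adic_u adic_u] by simp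
    moreover have "adic \<Phi> 0 (z * z / (Z * Z * (Z - u * z)))"
      using z Z by (intro adic_divide adic_mult_left aunit_mult) auto
    ultimately show "adic \<Phi> (2 * 2) (1 / ((1 - zq j)\<^sup>2 - u * zq j) - 1 / (1 - zq j)\<^sup>2 * (1 + u * (zq j / (1 - zq j)\<^sup>2)))"
      unfolding z_Z_def[symmetric] by (simp only: adic_mult_right)
    show "adic \<Phi> 0 (1 / ((1 - zq j)\<^sup>2 - u * zq j))" "adic \<Phi> 0 (1 / (1 - zq j)\<^sup>2)"
      "adic \<Phi> 0 (zq j / (1 - zq j)\<^sup>2)"
      unfolding z_Z_def[symmetric] using z Z by (auto intro!: adic_divide)
  qed
  then have "adic \<Phi> 4 (qpoch (qv ^ 2) (qv ^ 3) d1 *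
      ((\<Prod>j<d1. 1 / ((1 - zq j)\<^sup>2 - u * zq j)) - (\<Prod>j<d1. 1 / (1 - zq j)\<^sup>2) * (1 + u * sq_sum)))"
    by (intro adic_mult_left adic_qpoch adic_qv_power) simp
  moreover have "watson_prefactor (qv ^ 3 / x1) (qv ^ 3 * x1) = qpoch (qv ^ 2) (qv ^ 3) d1 * (\<Prod>j<d1. 1 / ((1 - zq j)\<^sup>2 - u * zq j))"
    unfolding watson_prefactor_def qpoch_zq qpoch_zq' prod.distrib[symmetric] quadratic_factor' by (simp add: prod_dividef)
  moreover have "watson_prefactor (qv ^ 3) (qv ^ 3) = qpoch (qv ^ 2) (qv ^ 3) d1 * (\<Prod>j<d1. 1 / (1 - zq j)\<^sup>2)"
    unfolding watson_prefactor_def qpoch_zq1 prod.distrib[symmetric] power2_eq_square by (simp add: prod_dividef)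
  ultimately show ?thesis
    by (simp add: right_diff_distrib mult.assoc)
qed

lemma adic_watson_prefactor: "aunit \<Phi> (qpoch a (qv ^ 3) d1) \<Longrightarrow> aunit \<Phi> (qpoch b (qv ^ 3) d1) \<Longrightarrow> adic \<Phi> 1 (watson_prefactor a b)"
  unfolding watson_prefactor_def by (intro adic_divide adic_qpoch_square aunit_mult)

text \<open>One order comes from the common numerator, the other from the difference of the
  denominators.\<close>

lemma watson_prefactor_cong:
  "adic \<Phi> 2 (watson_prefactor (qv ^ 3 / x1) (qv ^ 3) - watson_prefactor (qv ^ 3 / x1) (qv ^ 3 * x1))"
  "adic \<Phi> 2 (watson_prefactor (qv ^ 3 / x1) (qv ^ 3) - watson_prefactor (qv ^ 3) (qv ^ 3))"
proof -
  define Q A B Z where "Q = qpoch (qv ^ 2) (qv ^ 3) d1" "A = qpoch (qv ^ 3 / x1) (qv ^ 3) d1"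
    "B = qpoch (qv ^ 3 * x1) (qv ^ 3) d1" "Z = qpoch (qv ^ 3) (qv ^ 3) d1"
  note un = aunit_denominators[folded Q_A_B_Z_def]
  note nz = un[THEN aunit_nonzero]
  have "Q / (A * Z) - Q / (A * B) = Q * (B - Z) / (A * Z * B)" "Q / (A * Z) - Q / (Z * Z) = - (Q * (A - Z) / (A * Z * Z))"
    using nz by (simp_all add: divide_simps) (simp_all add: algebra_simps)
  moreover have "adic \<Phi> 2 (Q * (B - Z))" "adic \<Phi> 2 (Q * (A - Z))"
    using adic_mult[OF adic_qpoch_square denominators_cong(1)] adic_mult[OF adic_qpoch_square denominators_cong(2)]
    unfolding Q_A_B_Z_def by (simp_all add: numeral_2_eq_2)
  ultimately have "adic \<Phi> 2 (Q / (A * Z) - Q / (A * B))" "adic \<Phi> 2 (Q / (A * Z) - Q / (Z * Z))"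
    using un by (auto intro!: adic_divide adic_uminus aunit_mult simp del: minus_divide_left minus_mult_right)
  then show "adic \<Phi> 2 (watson_prefactor (qv ^ 3 / x1) (qv ^ 3) - watson_prefactor (qv ^ 3 / x1) (qv ^ 3 * x1))"
    "adic \<Phi> 2 (watson_prefactor (qv ^ 3 / x1) (qv ^ 3) - watson_prefactor (qv ^ 3) (qv ^ 3))"
    by (simp_all add: watson_prefactor_def Q_A_B_Z_def)
qed

lemma qint_sum_eq:
  "qint (int d) ^ 2 * (\<Sum>i=1..d1. qv ^ (3 * i) / qint (int (3 * i)) ^ 2) = (1 - x1)\<^sup>2 * sq_sum"
proof -
  have nz: "1 - qv \<noteq> 0" using qv_power_neq_1[of 1] by simp
  have "(\<Sum>i=1..d1. qv ^ (3 * i) / qint (int (3 * i)) ^ 2) = (\<Sum>j<d1. qv ^ (3 * Suc j) / qint (int (3 * Suc j)) ^ 2)"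
    by (rule sum.reindex_bij_witness[of _ Suc "\<lambda>i. i - 1"]) auto
  also have "\<dots> = (\<Sum>j<d1. (1 - qv)\<^sup>2 * (zq j / (1 - zq j)\<^sup>2))"
  proof (intro sum.cong refl)
    fix j
    have "qv powi int (3 * Suc j) = zq j" "qv ^ (3 * Suc j) = zq j"
      by (simp_all add: zq_power add.commute flip: power_int_of_nat)
    then show "qv ^ (3 * Suc j) / qint (int (3 * Suc j)) ^ 2 = (1 - qv)\<^sup>2 * (zq j / (1 - zq j)\<^sup>2)"
      unfolding qint_def by (simp only: power_divide) simp
  qed
  also have "\<dots> = (1 - qv)\<^sup>2 * sq_sum"
    by (simp only: sum_distrib_left[symmetric] sq_sum_def)
  finally show ?thesis
    using nz by (simp add: qint_def x1_eq power_divide)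
qed

lemma adic_watson_rhs: "aunit \<Phi> x \<Longrightarrow> aunit \<Phi> y \<Longrightarrow> adic \<Phi> 0 (watson_rhs d1 x y)"
  unfolding watson_rhs_factors by (intro adic_sum adic_mult_left adic_rhs_const adic_rhs_x adic_rhs_y) auto

lemma deformed_sums:
  "deformed_sum x1 1 = - inverse qv * watson_prefactor (qv ^ 3 / x1) (qv ^ 3) * watson_rhs d1 x1 1"
  "deformed_sum x1 y1 = - inverse qv * watson_prefactor (qv ^ 3 / x1) (qv ^ 3 * x1) * watson_rhs d1 x1 y1"
  "deformed_sum 1 y1 = - inverse qv * watson_prefactor (qv ^ 3) (qv ^ 3) * watson_rhs d1 1 y1"
proof -
  show "deformed_sum x1 1 = - inverse qv * watson_prefactor (qv ^ 3 / x1) (qv ^ 3) * watson_rhs d1 x1 1"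
    unfolding deformed_sum_def watson_prefactor_def by (rule deformed_sum_x[OF x1_def])
  have p3: "qv ^ 3 = qv powi 3" by simp
  have "qv ^ 3 / x1 = qv powi (3 - (3 * int d1 - 1))" "qv ^ 3 * x1 = qv powi (3 + (3 * int d1 - 1))"
    unfolding p3 x1_def divide_inverse power_int_minus[symmetric] qv_powi_add by simp_all
  moreover have "3 * int j + (3 - (3 * int d1 - 1)) \<noteq> 0" "3 * int j + (3 + (3 * int d1 - 1)) \<noteq> 0" for j
    by presburger+
  ultimately have "qpoch (qv ^ 3 / x1) (qv ^ 3) m \<noteq> 0" "qpoch (qv ^ 3 * x1) (qv ^ 3) m \<noteq> 0" for m
    by (simp_all only: qpoch_powi_nonzero not_False_eq_True)
  then show "deformed_sum x1 y1 = - inverse qv * watson_prefactor (qv ^ 3 / x1) (qv ^ 3 * x1) * watson_rhs d1 x1 y1"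
    unfolding deformed_sum_def watson_prefactor_def by (intro deformed_sum_y[OF y1_def]) auto
  have "qpoch (qv ^ 3) (qv ^ 3) m \<noteq> 0" for m
    by (rule qpoch_self_nonzero[OF cube_power_neq_1])
  then show "deformed_sum 1 y1 = - inverse qv * watson_prefactor (qv ^ 3) (qv ^ 3) * watson_rhs d1 1 y1"
    unfolding deformed_sum_def watson_prefactor_def using deformed_sum_y[OF y1_def, of 1] by simp
qed

text \<open>\<open>mixed_difference\<close> expresses the undeformed sum through the three
  evaluations, and \<open>adic_combination\<close> then compresses them to the prefactor at (x1, 1)
  times the undeformed Watson sum.\<close>

lemma deformed_sum_cong:
  "adic \<Phi> 4 (deformed_sum 1 1
    - (- inverse qv * watson_prefactor (qv ^ 3 / x1) (qv ^ 3) * watson_rhs d1 1 1 * (1 - (1 - x1)\<^sup>2 * sq_sum)))"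
proof -
  have s: "adic \<Phi> 0 sq_sum"
    unfolding sq_sum_def using adic_zq aunit_small(2) by (intro adic_sum adic_divide aunit_power) auto
  have x2: "adic \<Phi> 2 ((1 - x1)\<^sup>2)"
    using adic_power[OF adic_x1, of 2] by simp
  \<comment> \<open>The theorem has [n]^2, hence (1 - x1)^2, where the expansion gives
    \<open>u\<close>. The discrepancy has order 3 and is multiplied by a prefactor of order
    1.\<close>
  have "u * sq_sum - (1 - x1)\<^sup>2 * sq_sum = (1 - x1)\<^sup>2 * (1 - x1) * sq_sum / x1"
    by (simp add: u_def field_simps)
  moreover have "adic \<Phi> (2 + 1 + 0) ((1 - x1)\<^sup>2 * (1 - x1) * sq_sum)"
    by (intro adic_mult x2 adic_x1 s)
  ultimately have us: "adic \<Phi> 3 (u * sq_sum - (1 - x1)\<^sup>2 * sq_sum)"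
    using aunit_x1 by (simp add: adic_divide)
  have g: "adic \<Phi> 2 (watson_rhs d1 x1 y1 - watson_rhs d1 1 y1)"
    unfolding watson_rhs_factors sum_subtractf[symmetric] left_diff_distrib[symmetric] right_diff_distrib[symmetric]
    by (intro adic_sum adic_mult_right[OF _ adic_rhs_y[OF aunit_y1]] adic_mult_left[OF adic_rhs_const rhs_x_cong]) auto
  have h: "adic \<Phi> 1 (watson_rhs d1 1 1 - watson_rhs d1 1 y1)"
    unfolding watson_rhs_factors sum_subtractf[symmetric] right_diff_distrib[symmetric]
    by (intro adic_sum adic_mult_left[OF _ rhs_y_cong] adic_mult_left adic_rhs_const adic_rhs_x) auto
  have "adic \<Phi> 3 ((rhs_x x1 j - rhs_x 1 j) * (rhs_y 1 j - rhs_y y1 j))" for j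
    using adic_mult[OF rhs_x_cong[of j] rhs_y_cong[of j]] by simp
  then have "adic \<Phi> 3 (\<Sum>j\<le>d1. rhs_const j * ((rhs_x x1 j - rhs_x 1 j) * (rhs_y 1 j - rhs_y y1 j)))"
    by (intro adic_sum adic_mult_left[OF adic_rhs_const]) auto
  also have "(\<Sum>j\<le>d1. rhs_const j * ((rhs_x x1 j - rhs_x 1 j) * (rhs_y 1 j - rhs_y y1 j)))
     = (\<Sum>j\<le>d1. rhs_const j * rhs_x x1 j * rhs_y 1 j - rhs_const j * rhs_x x1 j * rhs_y y1 j - rhs_const j * rhs_x 1 j * rhs_y 1 j + rhs_const j * rhs_x 1 j * rhs_y y1 j)"
    by (intro sum.cong refl) (simp add: algebra_simps)
  finally have gh: "adic \<Phi> 3 (watson_rhs d1 x1 1 - watson_rhs d1 x1 y1 - watson_rhs d1 1 1 + watson_rhs d1 1 y1)"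
    by (simp only: watson_rhs_factors sum.distrib sum_subtractf)
  note D = aunit_denominators
  have "adic \<Phi> 4 (watson_prefactor (qv ^ 3 / x1) (qv ^ 3) * watson_rhs d1 x1 1 - watson_prefactor (qv ^ 3 / x1) (qv ^ 3 * x1) * watson_rhs d1 x1 y1
      + watson_prefactor (qv ^ 3) (qv ^ 3) * watson_rhs d1 1 y1
      - watson_prefactor (qv ^ 3 / x1) (qv ^ 3) * watson_rhs d1 1 1 * (1 - (1 - x1)\<^sup>2 * sq_sum))"
    by (rule adic_combination[OF adic_watson_prefactor[OF D(1,3)] adic_watson_prefactor[OF D(3,3)] watson_prefactor_cong watson_prefactor_expansion
          adic_mult_right[OF x2 s] us adic_watson_rhs[OF aunit_one aunit_y1] adic_watson_rhs[OF aunit_one aunit_one] g h gh])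
  then have "adic \<Phi> 4 (- inverse qv * (watson_prefactor (qv ^ 3 / x1) (qv ^ 3) * watson_rhs d1 x1 1 - watson_prefactor (qv ^ 3 / x1) (qv ^ 3 * x1) * watson_rhs d1 x1 y1
      + watson_prefactor (qv ^ 3) (qv ^ 3) * watson_rhs d1 1 y1
      - watson_prefactor (qv ^ 3 / x1) (qv ^ 3) * watson_rhs d1 1 1 * (1 - (1 - x1)\<^sup>2 * sq_sum)))"
    using aunit_inverse[OF aunit_qv[OF d_pos]] by (intro adic_mult_left adic_uminus) auto
  from adic_diff[OF this mixed_difference] show ?thesis
    unfolding deformed_sums by (simp add: algebra_simps)
qed

end

section \<open>Assembly of the congruence\<close>

context top_modulus
begin

text \<open>The terms between the two admissible values of \<open>M\<close> have order 4 by
  \<open>lhs_term_large\<close>, so both truncations lie in the same class.\<close>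

lemma adic_difference:
  assumes "M = d1 \<or> M = d - 1"
  shows "adic \<Phi> 4 ((\<Sum>k\<le>M. lhs_term k)
    - (qint (int d) * qv ^ d1 * qpoch (inverse (qv\<^sup>2)) (qv ^ 3) d1 / qpoch (qv ^ 3) (qv ^ 3) d1
       * (1 - qint (int d) ^ 2 * (\<Sum>i=1..d1. qv ^ (3 * i) / qint (int (3 * i)) ^ 2))
       * (\<Sum>k=0..d1. qpoch (qv ^ 4 / (cv * ev)) (qv ^ 3) k * qpoch (inverse qv) (qv ^ 3) k ^ 3
           / (qpoch (qv ^ 3 / cv) (qv ^ 3) k * qpoch (qv ^ 3 / ev) (qv ^ 3) k
              * qpoch (qv ^ 3) (qv ^ 3) k * qpoch (inverse (qv\<^sup>2)) (qv ^ 3) k) * qv ^ (3 * k))))"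
    (is "adic _ _ (_ - ?c * (1 - ?\<epsilon>) * ?s)")
proof -
  have "(\<Sum>k\<le>M. lhs_term k) = deformed_sum 1 1 + (\<Sum>k\<in>{d1<..M}. lhs_term k)"
  proof -
    have "{..M} = {..d1} \<union> {d1<..M}" using assms d1(1) by auto
    moreover have "(\<Sum>k\<in>{..d1} \<union> {d1<..M}. lhs_term k) = (\<Sum>k\<le>d1. lhs_term k) + (\<Sum>k\<in>{d1<..M}. lhs_term k)"
      by (rule sum.union_disjoint) auto
    ultimately show ?thesis
      by (simp add: deformed_sum_def lhs_term_eq)
  qed
  moreover have "adic \<Phi> 4 (\<Sum>k\<in>{d1<..M}. lhs_term k)"
    using assms d_pos by (intro adic_sum lhs_term_large) auto
  moreover have "?c * (1 - ?\<epsilon>) * ?s = - inverse qv * watson_prefactor (qv ^ 3 / x1) (qv ^ 3) * watson_rhs d1 1 1 * (1 - (1 - x1)\<^sup>2 * sq_sum)"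
  proof -
    have p3: "qv ^ 3 = qv powi 3" by simp
    have "qv ^ 3 / x1 = qv powi (4 - 3 * int d1)"
      unfolding p3 x1_def divide_inverse power_int_minus[symmetric] qv_powi_add by simp
    then have cs: "?c * ?s = - inverse qv * watson_prefactor (qv ^ 3 / x1) (qv ^ 3) * watson_rhs d1 1 1"
      unfolding watson_prefactor_def using sum_eq_watson_rhs[OF top] by simp
    have "?c * (1 - ?\<epsilon>) * ?s = (?c * ?s) * (1 - ?\<epsilon>)"
      by (simp only: mult_ac)
    also note cs
    finally show ?thesis
      by (simp only: qint_sum_eq)
  qed
  ultimately show ?thesis
    using adic_add[OF deformed_sum_cong] by (simp only: add_diff_eq diff_add_eq)
qed

end

theorem theorem2p1:
  fixes n M :: nat
  assumes "n > 0" and "n mod 3 = 2"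
    and "M = (n + 1) div 3 \<or> M = n - 1"
  shows "qcong
    (\<Sum>k=0..M. qint (6 * int k - 1)
        * qpoch (inverse qv) (qv ^ 3) k ^ 4
        * qpoch (cv * inverse qv) (qv ^ 3) k * qpoch (ev * inverse qv) (qv ^ 3) k
        / (qpoch (qv ^ 3) (qv ^ 3) k ^ 4
           * qpoch (qv ^ 3 / cv) (qv ^ 3) k * qpoch (qv ^ 3 / ev) (qv ^ 3) k)
        * (qv ^ 9 / (cv * ev)) ^ k)
    (qint (int n) * qv ^ ((n + 1) div 3)
       * qpoch (inverse (qv ^ 2)) (qv ^ 3) ((n + 1) div 3)
       / qpoch (qv ^ 3) (qv ^ 3) ((n + 1) div 3)
       * (1 - qint (int n) ^ 2 * (\<Sum>i=1..(n + 1) div 3. qv ^ (3 * i) / qint (int (3 * i)) ^ 2))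
       * (\<Sum>k=0..(n + 1) div 3.
           qpoch (qv ^ 4 / (cv * ev)) (qv ^ 3) k * qpoch (inverse qv) (qv ^ 3) k ^ 3
           / (qpoch (qv ^ 3 / cv) (qv ^ 3) k * qpoch (qv ^ 3 / ev) (qv ^ 3) k
              * qpoch (qv ^ 3) (qv ^ 3) k * qpoch (inverse (qv ^ 2)) (qv ^ 3) k)
           * qv ^ (3 * k)))
    (qintR n * cycloR n ^ 3)"
proof -
  define N where "N = (n + 1) div 3"
  have N: "3 * N = n + 1" using assms(2) unfolding N_def by presburger
  have n2: "n \<ge> 2" using assms(2) by presburger
  have Nn: "N < n" using N n2 by simp
  define L where "L = (\<Sum>k\<le>M. lhs_term k)"
  define X where "X = qint (int n) * qv ^ N * qpoch (inverse (qv\<^sup>2)) (qv ^ 3) N / qpoch (qv ^ 3) (qv ^ 3) N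
       * (1 - qint (int n) ^ 2 * (\<Sum>i=1..N. qv ^ (3 * i) / qint (int (3 * i)) ^ 2))
       * (\<Sum>k=0..N. qpoch (qv ^ 4 / (cv * ev)) (qv ^ 3) k * qpoch (inverse qv) (qv ^ 3) k ^ 3
           / (qpoch (qv ^ 3 / cv) (qv ^ 3) k * qpoch (qv ^ 3 / ev) (qv ^ 3) k
              * qpoch (qv ^ 3) (qv ^ 3) k * qpoch (inverse (qv\<^sup>2)) (qv ^ 3) k) * qv ^ (3 * k))"
  have M: "M = N \<or> M = n - 1" using assms(3) by (simp add: N_def)
  \<comment> \<open>Since 3 N = n + 1 and \<open>d\<close> divides \<open>n\<close>, the residue of
    \<open>N\<close> inverts 3 modulo \<open>d\<close>.\<close>
  have loc: "inverse_of_three d (N mod d)" if d: "d dvd n" "d \<noteq> 1" for d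
  proof
    show "d > 1" using d n2 by (metis One_nat_def dvd_0_left_iff gr0I linorder_neqE_nat less_one not_numeral_le_zero)
    then show "N mod d < d" by simp
    have "3 * int (N mod d) - 1 = int n - 3 * int d * int (N div d)"
    proof -
      have "int N = int d * int (N div d) + int (N mod d)"
        by (simp flip: of_nat_mult of_nat_add)
      then show ?thesis using N by (simp add: algebra_simps)
    qed
    moreover have "int d dvd int n - 3 * int d * int (N div d)"
      using d(1) by (intro dvd_diff) auto
    ultimately show "int d dvd 3 * int (N mod d) - 1" by simp
  qed
  have low: "adic (cycloR d) 1 (L - X)" if dn: "d dvd n" "d \<noteq> 1" for d
  proof -
    interpret inverse_of_three d "N mod d" by (rule loc[OF dn])
    have "(n - 1) mod d = d - 1"
    proof -
      obtain m where m: "n = d * m" using dn by auto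
      then have "n - 1 = (d - 1) + d * (m - 1)"
        using assms(1) d_pos by (cases m) auto
      then have "(n - 1) mod d = (d - 1) mod d"
        by (simp only: mod_mult_self2)
      then show ?thesis using d_pos by simp
    qed
    \<comment> \<open>For M = n - 1 the residue is d - 1, the largest possible one; for M = N there
      is equality.\<close>
    then have "N mod d \<le> M mod d"
      using M d1(1) by auto
    then show ?thesis
      unfolding L_def X_def using dn(1) assms(1) by (intro adic_diff adic_sum_lhs_term adic_rhs) auto
  qed
  have "adic (cycloR n) 4 (L - X)"
  proof -
    have "inverse_of_three n N" using loc[of n] Nn n2 by simp
    then interpret top_modulus n N
      by (rule top_modulus.intro) (simp add: top_modulus_axioms_def N)
    show ?thesis
      unfolding L_def X_def by (rule adic_difference[OF M])
  qed
  then have high: "adic (cycloR n ^ 4) 1 (L - X)"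
    by (rule adic_power_modulus) simp
  \<comment> \<open>The divisor \<open>n\<close> is set apart: one factor from [n] and three from
    the cube make its modulus a fourth power.\<close>
  define A where "A = {d. d dvd n \<and> d \<noteq> 1} - {n}"
  have fin: "finite {d. d dvd n \<and> d \<noteq> 1}" using assms(1) by simp
  have pos: "d > 0" if "d dvd n" for d using that assms(1) by (rule_tac dvd_pos_nat)
  have "adic (\<Prod>d\<in>A. cycloR d) 1 (L - X)"
  proof (rule adic_combine_prod)
    show "adic 1 1 (L - X)"
      using low[of n] n2 unfolding adic_def by (auto simp: mult.assoc)
  qed (use fin low pos in \<open>auto simp: A_def intro!: coprime_cycloR\<close>)
  moreover have "coprime (\<Prod>d\<in>A. cycloR d) (cycloR n ^ 4)"
    using pos assms(1) by (intro prod_coprime_left) (auto simp: A_def intro!: coprime_cycloR)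
  ultimately have "adic ((\<Prod>d\<in>A. cycloR d) * cycloR n ^ 4) 1 (L - X)"
    using high by (intro adic_combine)
  moreover have "qintR n * cycloR n ^ 3 = (\<Prod>d\<in>A. cycloR d) * cycloR n ^ 4"
    unfolding qintR_eq_prod[OF assms(1)] A_def
    using n2 by (subst prod.remove[OF fin, of n]) (auto simp: eval_nat_numeral mult_ac)
  ultimately show ?thesis
    unfolding qcong_iff_adic summand_eq N_def[symmetric]
    by (simp only: L_def X_def lhs_term_def atLeast0AtMost)
qed

end
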